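(* For every $n \ge 1$ the pure braid group $PB_n$ on $n$ strands is RFRS. In fact, for every $n\ge 1$ and every prime $p$, the group $PB_n$ is RFR$p$.
   Context: For a group $G$, let $\operatorname{rad}_{\mathbb{Q}}(G)=\ker\bigl(G\to H_1(G;\mathbb{Q})\bigr)$. A group $G$ is called RFRS (residually finite rationally solvable) if there is a descending chain $G=G_0\geq G_1\geq G_2\geq\cdots$ of finite-index normal subgroups of $G$ with $\bigcap_i G_i=1$ such that for each $i$ the subgroup $G_{i+1}$ contains $\operatorname{rad}_{\mathbb{Q}}(G_i)$. Let $p$ be a prime. A finitely generated group $G$ is called RFR$p$ (residually finite rationally $p$) if there is a sequence of subgroups $\{G_i\}_{i\ge 0}$ of $G$ with $G_0=G$ such that: (1) for each $i$, $G_{i+1}$ is a normal subgroup of $G_i$ and $\operatorname{rad}_{\mathbb{Q}}(G_i)\leq G_{i+1}$; (2) $\bigcap_{i\ge 0}G_i=\{1\}$; (3) for each $i$, the quotient $G_i/G_{i+1}$ is a finite elementary abelian $p$-group. The pure braid group $PB_n$ is the kernel of the natural homomorphism from the braid group $B_n$ on $n$ strands to the symmetric group on $n$ letters. *)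

theory Defs
  imports "HOL-Algebra.Algebra" "HOL-Library.Poly_Mapping" "HOL-Computational_Algebra.Primes"
begin

section \<open>First rational homology of a group\<close>

text \<open>
  The low-degree part of the inhomogeneous bar complex of \<open>G\<close> with trivial coefficients \<open>\<rat>\<close>:
  \<open>n\<close>-chains are finitely supported rational combinations of \<open>n\<close>-tuples of group elements, and
  \<open>d\<^sub>2 [g|h] = [h] - [gh] + [g]\<close>.  Since the coefficients are trivial, \<open>d\<^sub>1 = 0\<close>, so every
  1-chain is a cycle.
\<close>

definition rat_chains :: "'a set \<Rightarrow> ('a \<Rightarrow>\<^sub>0 rat) monoid" where
  "rat_chains S = \<lparr>carrier = {c. Poly_Mapping.keys c \<subseteq> S}, monoid.mult = (+), one = 0\<rparr>"

definition bar_boundary2 ::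
    "('a, 'm) monoid_scheme \<Rightarrow> ('a \<times> 'a \<Rightarrow>\<^sub>0 rat) \<Rightarrow> ('a \<Rightarrow>\<^sub>0 rat)" where
  "bar_boundary2 G c = (\<Sum>(g, h) \<in> Poly_Mapping.keys c.
      Poly_Mapping.single h (Poly_Mapping.lookup c (g, h))
    - Poly_Mapping.single (g \<otimes>\<^bsub>G\<^esub> h) (Poly_Mapping.lookup c (g, h))
    + Poly_Mapping.single g (Poly_Mapping.lookup c (g, h)))"

definition rat_boundaries1 :: "('a, 'm) monoid_scheme \<Rightarrow> ('a \<Rightarrow>\<^sub>0 rat) set" where
  "rat_boundaries1 G = bar_boundary2 G ` carrier (rat_chains (carrier G \<times> carrier G))"

definition rat_H1 :: "('a, 'm) monoid_scheme \<Rightarrow> ('a \<Rightarrow>\<^sub>0 rat) set monoid" where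
  "rat_H1 G = rat_chains (carrier G) Mod rat_boundaries1 G"

definition to_rat_H1 :: "('a, 'm) monoid_scheme \<Rightarrow> 'a \<Rightarrow> ('a \<Rightarrow>\<^sub>0 rat) set" where
  "to_rat_H1 G g = rat_boundaries1 G #>\<^bsub>rat_chains (carrier G)\<^esub> Poly_Mapping.single g 1"

definition rad_Q :: "('a, 'm) monoid_scheme \<Rightarrow> 'a set" where
  "rad_Q G = kernel G (rat_H1 G) (to_rat_H1 G)"


section \<open>The properties RFRS and RFRp\<close>

definition RFRS :: "('a, 'm) monoid_scheme \<Rightarrow> bool" where
  "RFRS G \<longleftrightarrow> group G \<and>
    (\<exists>H :: nat \<Rightarrow> 'a set. H 0 = carrier G \<and>
      (\<forall>i. H i \<lhd> G \<and> finite (rcosets\<^bsub>G\<^esub> (H i)) \<and> H (Suc i) \<subseteq> H i \<and>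
           rad_Q (G\<lparr>carrier := H i\<rparr>) \<subseteq> H (Suc i)) \<and>
      (\<Inter>i. H i) = {\<one>\<^bsub>G\<^esub>})"

definition finitely_generated_group :: "('a, 'm) monoid_scheme \<Rightarrow> bool" where
  "finitely_generated_group G \<longleftrightarrow>
    group G \<and> (\<exists>S. finite S \<and> S \<subseteq> carrier G \<and> generate G S = carrier G)"

definition finite_elementary_abelian :: "nat \<Rightarrow> ('a, 'm) monoid_scheme \<Rightarrow> bool" where
  "finite_elementary_abelian p G \<longleftrightarrow>
    comm_group G \<and> finite (carrier G) \<and> (\<forall>x \<in> carrier G. x [^]\<^bsub>G\<^esub> p = \<one>\<^bsub>G\<^esub>)"

definition RFRp :: "nat \<Rightarrow> ('a, 'm) monoid_scheme \<Rightarrow> bool" where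
  "RFRp p G \<longleftrightarrow> finitely_generated_group G \<and>
    (\<exists>H :: nat \<Rightarrow> 'a set. H 0 = carrier G \<and>
      (\<forall>i. subgroup (H i) G \<and>
           H (Suc i) \<lhd> G\<lparr>carrier := H i\<rparr> \<and>
           rad_Q (G\<lparr>carrier := H i\<rparr>) \<subseteq> H (Suc i) \<and>
           finite_elementary_abelian p (G\<lparr>carrier := H i\<rparr> Mod H (Suc i))) \<and>
      (\<Inter>i. H i) = {\<one>\<^bsub>G\<^esub>})"


section \<open>Braid groups and pure braid groups\<close>

text \<open>
  The braid group on \<open>n\<close> strands is given by Artin's presentation, with generators
  \<open>\<sigma>\<^sub>1, \<dots>, \<sigma>\<^sub>n\<^sub>-\<^sub>1\<close>.  In a word, the letter \<open>(i, True)\<close> stands for \<open>\<sigma>\<^sub>i\<close> and \<open>(i, False)\<close> for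
  the inverse of \<open>\<sigma>\<^sub>i\<close>.
\<close>

type_synonym braid_word = "(nat \<times> bool) list"

definition braid_words :: "nat \<Rightarrow> braid_word set" where
  "braid_words n = lists ({1..<n} \<times> UNIV)"

inductive braid_equiv :: "nat \<Rightarrow> braid_word \<Rightarrow> braid_word \<Rightarrow> bool" for n :: nat where
  refl: "w \<in> braid_words n \<Longrightarrow> braid_equiv n w w"
| sym: "braid_equiv n v w \<Longrightarrow> braid_equiv n w v"
| trans: "braid_equiv n u v \<Longrightarrow> braid_equiv n v w \<Longrightarrow> braid_equiv n u w"
| cancel: "u \<in> braid_words n \<Longrightarrow> v \<in> braid_words n \<Longrightarrow> i \<in> {1..<n} \<Longrightarrow>
    braid_equiv n (u @ [(i, b), (i, \<not> b)] @ v) (u @ v)"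
| far: "u \<in> braid_words n \<Longrightarrow> v \<in> braid_words n \<Longrightarrow> i \<in> {1..<n} \<Longrightarrow> j \<in> {1..<n} \<Longrightarrow>
    i + 2 \<le> j \<Longrightarrow>
    braid_equiv n (u @ [(i, True), (j, True)] @ v) (u @ [(j, True), (i, True)] @ v)"
| braid: "u \<in> braid_words n \<Longrightarrow> v \<in> braid_words n \<Longrightarrow> i \<in> {1..<n} \<Longrightarrow> Suc i \<in> {1..<n} \<Longrightarrow>
    braid_equiv n (u @ [(i, True), (Suc i, True), (i, True)] @ v)
                  (u @ [(Suc i, True), (i, True), (Suc i, True)] @ v)"

definition braid_rel :: "nat \<Rightarrow> (braid_word \<times> braid_word) set" where
  "braid_rel n = {(v, w). braid_equiv n v w}"

definition braid_group :: "nat \<Rightarrow> braid_word set monoid" where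
  "braid_group n =
    \<lparr>carrier = braid_words n // braid_rel n,
     monoid.mult = (\<lambda>A B. \<Union>v\<in>A. \<Union>w\<in>B. braid_rel n `` {v @ w}),
     one = braid_rel n `` {[]}\<rparr>"

definition word_perm :: "braid_word \<Rightarrow> nat \<Rightarrow> nat" where
  "word_perm w = foldr (\<lambda>(i, b) f. transpose i (Suc i) \<circ> f) w id"

text \<open>\<open>word_perm\<close> is constant on each class, see \<open>braid_perm_class\<close> below.\<close>

definition braid_perm :: "braid_word set \<Rightarrow> nat \<Rightarrow> nat" where
  "braid_perm A = the_elem (word_perm ` A)"

definition pure_braid_group :: "nat \<Rightarrow> braid_word set monoid" where
  "pure_braid_group n =
    (braid_group n)\<lparr>carrier := kernel (braid_group n) (sym_group n) braid_perm\<rparr>"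


section \<open>Well-definedness\<close>

lemma braid_words_Nil [simp]: "[] \<in> braid_words n"
  by (simp add: braid_words_def)

lemma braid_words_append [simp]:
  "v @ w \<in> braid_words n \<longleftrightarrow> v \<in> braid_words n \<and> w \<in> braid_words n"
  by (auto simp: braid_words_def)

lemma braid_words_Cons [simp]:
  "(i, b) # w \<in> braid_words n \<longleftrightarrow> i \<in> {1..<n} \<and> w \<in> braid_words n"
  by (auto simp: braid_words_def)

lemma braid_equiv_words: "braid_equiv n v w \<Longrightarrow> v \<in> braid_words n \<and> w \<in> braid_words n"
  by (induction rule: braid_equiv.induct) auto

lemma equiv_braid_rel: "equiv (braid_words n) (braid_rel n)"
  by (rule equivI)
     (auto simp: braid_rel_def refl_on_def sym_def trans_def
           dest: braid_equiv_words intro: braid_equiv.refl braid_equiv.sym braid_equiv.trans)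

lemma braid_equiv_context:
  assumes "braid_equiv n v w" "a \<in> braid_words n" "c \<in> braid_words n"
  shows "braid_equiv n (a @ v @ c) (a @ w @ c)"
  using assms
proof (induction rule: braid_equiv.induct)
  case (cancel u v i b)
  then show ?case using braid_equiv.cancel[of "a @ u" n "v @ c" i b] by simp
next
  case (far u v i j)
  then show ?case using braid_equiv.far[of "a @ u" n "v @ c" i j] by simp
next
  case (braid u v i)
  then show ?case using braid_equiv.braid[of "a @ u" n "v @ c" i] by simp
qed (auto intro: braid_equiv.refl braid_equiv.sym braid_equiv.trans)

lemma braid_equiv_append:
  assumes "braid_equiv n v v'" "braid_equiv n w w'"
  shows "braid_equiv n (v @ w) (v' @ w')"
  using braid_equiv_context[OF assms(1), of "[]" w] braid_equiv_context[OF assms(2), of v' "[]"]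
    braid_equiv_words[OF assms(1)] braid_equiv_words[OF assms(2)]
  by (auto intro: braid_equiv.trans)

lemma braid_class_eq_iff:
  assumes "v \<in> braid_words n" "w \<in> braid_words n"
  shows "braid_rel n `` {v} = braid_rel n `` {w} \<longleftrightarrow> braid_equiv n v w"
  using eq_equiv_class_iff[OF equiv_braid_rel assms] by (simp add: braid_rel_def)

lemma braid_group_mult_class:
  assumes "v \<in> braid_words n" "w \<in> braid_words n"
  shows "braid_rel n `` {v} \<otimes>\<^bsub>braid_group n\<^esub> braid_rel n `` {w} = braid_rel n `` {v @ w}"
proof -
  have c2: "congruent2 (braid_rel n) (braid_rel n) (\<lambda>v w. braid_rel n `` {v @ w})"
  proof (rule congruent2I')
    fix v v' w w' assume "(v, v') \<in> braid_rel n" "(w, w') \<in> braid_rel n"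
    then have "braid_equiv n (v @ w) (v' @ w')"
      by (auto simp: braid_rel_def intro: braid_equiv_append)
    then show "braid_rel n `` {v @ w} = braid_rel n `` {v' @ w'}"
      using braid_equiv_words braid_class_eq_iff by blast
  qed
  show ?thesis
    using UN_equiv_class2[OF equiv_braid_rel equiv_braid_rel c2 assms]
    by (simp add: braid_group_def)
qed

lemma braid_group_carrierE:
  assumes "A \<in> carrier (braid_group n)"
  obtains w where "w \<in> braid_words n" "A = braid_rel n `` {w}"
  using assms by (auto simp: braid_group_def quotient_def)

lemma braid_group_class_carrier [simp]:
  "w \<in> braid_words n \<Longrightarrow> braid_rel n `` {w} \<in> carrier (braid_group n)"
  by (auto simp: braid_group_def intro: quotientI)

lemma braid_word_left_inverse:
  "w \<in> braid_words n \<Longrightarrow>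
    map (\<lambda>(i, b). (i, \<not> b)) (rev w) \<in> braid_words n \<and>
    braid_equiv n (map (\<lambda>(i, b). (i, \<not> b)) (rev w) @ w) []"
proof (induction w)
  case Nil
  then show ?case by (simp add: braid_equiv.refl)
next
  case (Cons x w)
  obtain i b where x: "x = (i, b)" by force
  let ?w' = "map (\<lambda>(i, b). (i, \<not> b)) (rev w)"
  have w: "w \<in> braid_words n" "i \<in> {1..<n}" using Cons.prems by (auto simp: x)
  then have IH: "?w' \<in> braid_words n" "braid_equiv n (?w' @ w) []" using Cons.IH by auto
  have "braid_equiv n (?w' @ [(i, \<not> b), (i, \<not> \<not> b)] @ w) (?w' @ w)"
    using IH w by (intro braid_equiv.cancel) auto
  then show ?case using IH w by (auto simp: x intro: braid_equiv.trans)
qed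

lemma group_braid_group: "group (braid_group n)"
proof (rule groupI)
  show "\<one>\<^bsub>braid_group n\<^esub> \<in> carrier (braid_group n)"
    by (auto simp: braid_group_def intro: quotientI)
  have one: "\<one>\<^bsub>braid_group n\<^esub> = braid_rel n `` {[]}" by (simp add: braid_group_def)
  show "A \<otimes>\<^bsub>braid_group n\<^esub> B \<in> carrier (braid_group n)"
    if "A \<in> carrier (braid_group n)" "B \<in> carrier (braid_group n)" for A B
    using that by (auto elim!: braid_group_carrierE simp: braid_group_mult_class)
  show "A \<otimes>\<^bsub>braid_group n\<^esub> B \<otimes>\<^bsub>braid_group n\<^esub> C = A \<otimes>\<^bsub>braid_group n\<^esub> (B \<otimes>\<^bsub>braid_group n\<^esub> C)"
    if "A \<in> carrier (braid_group n)" "B \<in> carrier (braid_group n)" "C \<in> carrier (braid_group n)"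
    for A B C
    using that by (auto elim!: braid_group_carrierE simp: braid_group_mult_class)
  show "\<one>\<^bsub>braid_group n\<^esub> \<otimes>\<^bsub>braid_group n\<^esub> A = A" if "A \<in> carrier (braid_group n)" for A
    using that by (auto elim!: braid_group_carrierE simp: braid_group_mult_class one)
  show "\<exists>B\<in>carrier (braid_group n). B \<otimes>\<^bsub>braid_group n\<^esub> A = \<one>\<^bsub>braid_group n\<^esub>"
    if A: "A \<in> carrier (braid_group n)" for A
  proof -
    obtain w where w: "w \<in> braid_words n" "A = braid_rel n `` {w}"
      using A by (rule braid_group_carrierE)
    let ?w' = "map (\<lambda>(i, b). (i, \<not> b)) (rev w)"
    have w': "?w' \<in> braid_words n" "braid_equiv n (?w' @ w) []"
      using braid_word_left_inverse[OF w(1)] by auto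
    then have "braid_rel n `` {?w'} \<otimes>\<^bsub>braid_group n\<^esub> A = \<one>\<^bsub>braid_group n\<^esub>"
      using w braid_class_eq_iff[of "?w' @ w" n "[]"]
      by (simp add: braid_group_mult_class one)
    then show ?thesis using w' by (meson braid_group_class_carrier)
  qed
qed

lemma word_perm_append: "word_perm (v @ w) = word_perm v \<circ> word_perm w"
proof (induction v)
  case Nil
  then show ?case by (simp add: word_perm_def)
next
  case (Cons x v)
  then show ?case by (cases x) (simp add: word_perm_def o_assoc)
qed

lemma word_perm_cong: "braid_equiv n v w \<Longrightarrow> word_perm v = word_perm w"
proof (induction rule: braid_equiv.induct)
  case (cancel u v i b)
  have "word_perm [(i, b), (i, \<not> b)] = id" by (simp add: word_perm_def)
  then show ?case by (simp only: word_perm_append) simp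
next
  case (far u v i j)
  have "word_perm [(i, True), (j, True)] = word_perm [(j, True), (i, True)]"
    using far by (auto simp: word_perm_def fun_eq_iff transpose_def)
  then show ?case by (simp only: word_perm_append)
next
  case (braid u v i)
  have "word_perm [(i, True), (Suc i, True), (i, True)] =
        word_perm [(Suc i, True), (i, True), (Suc i, True)]"
    by (auto simp: word_perm_def fun_eq_iff transpose_def)
  then show ?case by (simp only: word_perm_append)
qed auto

lemma braid_perm_class:
  assumes "w \<in> braid_words n"
  shows "braid_perm (braid_rel n `` {w}) = word_perm w"
proof -
  have "word_perm ` (braid_rel n `` {w}) = {word_perm w}"
    using assms word_perm_cong[of n w] by (force simp: braid_rel_def intro: braid_equiv.refl)
  then show ?thesis by (simp add: braid_perm_def)
qed

lemma word_perm_permutes: "w \<in> braid_words n \<Longrightarrow> word_perm w permutes {1..n}"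
proof (induction w)
  case Nil
  then show ?case using permutes_id[of "{1..n}"] by (simp add: word_perm_def id_def)
next
  case (Cons x w)
  obtain i b where x: "x = (i, b)" by force
  have "transpose i (Suc i) permutes {1..n}"
    using Cons.prems by (intro permutes_swap_id) (auto simp: x)
  then have "transpose i (Suc i) \<circ> word_perm w permutes {1..n}"
    using Cons by (intro permutes_compose) (auto simp: x)
  then show ?case by (simp add: x word_perm_def o_def)
qed

lemma braid_perm_hom: "braid_perm \<in> hom (braid_group n) (sym_group n)"
proof (rule homI)
  show "braid_perm A \<in> carrier (sym_group n)" if "A \<in> carrier (braid_group n)" for A
    using that
    by (elim braid_group_carrierE)
       (simp only: braid_perm_class sym_group_carrier word_perm_permutes)
  show "braid_perm (A \<otimes>\<^bsub>braid_group n\<^esub> B) = braid_perm A \<otimes>\<^bsub>sym_group n\<^esub> braid_perm B"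
    if "A \<in> carrier (braid_group n)" "B \<in> carrier (braid_group n)" for A B
    using that
    by (auto elim!: braid_group_carrierE
             simp: braid_perm_class braid_group_mult_class sym_group_mult word_perm_append)
qed

lemma group_pure_braid_group: "group (pure_braid_group n)"
proof -
  interpret group_hom "braid_group n" "sym_group n" braid_perm
    by (simp add: group_hom_def group_hom_axioms_def group_braid_group sym_group_is_group
        braid_perm_hom)
  show ?thesis
    unfolding pure_braid_group_def
    by (intro subgroup.subgroup_is_group subgroup_kernel group_braid_group)
qed

lemma comm_group_rat_chains: "comm_group (rat_chains S)"
proof (rule comm_groupI)
  show "c \<otimes>\<^bsub>rat_chains S\<^esub> d \<in> carrier (rat_chains S)"
    if "c \<in> carrier (rat_chains S)" "d \<in> carrier (rat_chains S)" for c d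
    using that Poly_Mapping.keys_add[of c d] by (auto simp: rat_chains_def)
  show "\<exists>d\<in>carrier (rat_chains S). d \<otimes>\<^bsub>rat_chains S\<^esub> c = \<one>\<^bsub>rat_chains S\<^esub>"
    if "c \<in> carrier (rat_chains S)" for c
    using that by (intro bexI[of _ "- c"]) (auto simp: rat_chains_def)
qed (auto simp: rat_chains_def add_ac)

lemma bar_boundary2_eq:
  assumes "finite T" "Poly_Mapping.keys c \<subseteq> T"
  shows "bar_boundary2 G c = (\<Sum>(g, h) \<in> T.
      Poly_Mapping.single h (Poly_Mapping.lookup c (g, h))
    - Poly_Mapping.single (g \<otimes>\<^bsub>G\<^esub> h) (Poly_Mapping.lookup c (g, h))
    + Poly_Mapping.single g (Poly_Mapping.lookup c (g, h)))"
  unfolding bar_boundary2_def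
  by (rule sum.mono_neutral_left) (use assms in \<open>auto simp: in_keys_iff\<close>)

lemma bar_boundary2_add: "bar_boundary2 G (c + d) = bar_boundary2 G c + bar_boundary2 G d"
proof -
  let ?T = "Poly_Mapping.keys c \<union> Poly_Mapping.keys d"
  show ?thesis
    using Poly_Mapping.keys_add[of c d]
    by (simp add: bar_boundary2_eq[of ?T] sum.distrib[symmetric] split_def lookup_add single_add
        algebra_simps)
qed

lemma bar_boundary2_single:
  "bar_boundary2 G (Poly_Mapping.single (g, h) q) =
    Poly_Mapping.single h q - Poly_Mapping.single (g \<otimes>\<^bsub>G\<^esub> h) q + Poly_Mapping.single g q"
  by (simp add: bar_boundary2_eq[of "{(g, h)}"])

lemma bar_boundary2_hom:
  assumes "group G"
  shows "group_hom (rat_chains (carrier G \<times> carrier G)) (rat_chains (carrier G)) (bar_boundary2 G)"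
proof -
  interpret group G by fact
  interpret C1: comm_group "rat_chains (carrier G)" by (rule comm_group_rat_chains)
  interpret C2: comm_group "rat_chains (carrier G \<times> carrier G)" by (rule comm_group_rat_chains)
  have "Poly_Mapping.keys (bar_boundary2 G c) \<subseteq> carrier G"
    if "Poly_Mapping.keys c \<subseteq> carrier G \<times> carrier G" for c
  proof
    fix x assume x: "x \<in> Poly_Mapping.keys (bar_boundary2 G c)"
    show "x \<in> carrier G"
    proof (rule ccontr)
      assume nx: "x \<notin> carrier G"
      have "Poly_Mapping.lookup (bar_boundary2 G c) x = 0"
        unfolding bar_boundary2_def lookup_sum
      proof (intro sum.neutral ballI)
        fix z assume z: "z \<in> Poly_Mapping.keys c"
        obtain g h where gh: "z = (g, h)" by force
        have "g \<in> carrier G" "h \<in> carrier G" using z that by (auto simp: gh)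
        then have "g \<noteq> x" "h \<noteq> x" "g \<otimes>\<^bsub>G\<^esub> h \<noteq> x" using nx m_closed by blast+
        then show "Poly_Mapping.lookup (case z of (g, h) \<Rightarrow>
              Poly_Mapping.single h (Poly_Mapping.lookup c (g, h))
            - Poly_Mapping.single (g \<otimes>\<^bsub>G\<^esub> h) (Poly_Mapping.lookup c (g, h))
            + Poly_Mapping.single g (Poly_Mapping.lookup c (g, h))) x = 0"
          by (simp add: gh lookup_add lookup_minus lookup_single when_def)
      qed
      then show False using x by (simp add: in_keys_iff)
    qed
  qed
  then have "bar_boundary2 G \<in> hom (rat_chains (carrier G \<times> carrier G)) (rat_chains (carrier G))"
    by (intro homI) (auto simp: rat_chains_def bar_boundary2_add)
  then show ?thesis by unfold_locales
qed

lemma rat_boundaries1_normal: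
  assumes "group G"
  shows "rat_boundaries1 G \<lhd> rat_chains (carrier G)"
proof -
  interpret group_hom "rat_chains (carrier G \<times> carrier G)" "rat_chains (carrier G)" "bar_boundary2 G"
    by (rule bar_boundary2_hom[OF assms])
  show ?thesis
    unfolding rat_boundaries1_def
    by (intro comm_group.normal_iff_subgroup[THEN iffD2] comm_group_rat_chains img_is_subgroup)
qed

lemma to_rat_H1_hom:
  assumes "group G"
  shows "group_hom G (rat_H1 G) (to_rat_H1 G)"
proof -
  interpret group G by fact
  interpret N: normal "rat_boundaries1 G" "rat_chains (carrier G)"
    by (rule rat_boundaries1_normal[OF assms])
  have single: "Poly_Mapping.single g 1 \<in> carrier (rat_chains (carrier G))"
    if "g \<in> carrier G" for g using that by (auto simp: rat_chains_def)
  have "to_rat_H1 G (g \<otimes>\<^bsub>G\<^esub> h) = to_rat_H1 G g <#>\<^bsub>rat_chains (carrier G)\<^esub> to_rat_H1 G h"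
    if gh: "g \<in> carrier G" "h \<in> carrier G" for g h
  proof -
    let ?s = "\<lambda>x. Poly_Mapping.single x (1::rat)"
    have "bar_boundary2 G (Poly_Mapping.single (g, h) 1) \<in> rat_boundaries1 G"
      using gh by (auto simp: rat_boundaries1_def rat_chains_def)
    then have "?s h - ?s (g \<otimes>\<^bsub>G\<^esub> h) + ?s g \<in> rat_boundaries1 G"
      by (simp add: bar_boundary2_single)
    moreover have "(?s h - ?s (g \<otimes>\<^bsub>G\<^esub> h) + ?s g) \<otimes>\<^bsub>rat_chains (carrier G)\<^esub> ?s (g \<otimes>\<^bsub>G\<^esub> h)
        = ?s g \<otimes>\<^bsub>rat_chains (carrier G)\<^esub> ?s h"
      by (simp add: rat_chains_def)
    ultimately have "?s g \<otimes>\<^bsub>rat_chains (carrier G)\<^esub> ?s h \<in> to_rat_H1 G (g \<otimes>\<^bsub>G\<^esub> h)"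
      unfolding to_rat_H1_def r_coset_def by force
    then have "to_rat_H1 G (g \<otimes>\<^bsub>G\<^esub> h) =
        rat_boundaries1 G #>\<^bsub>rat_chains (carrier G)\<^esub> (?s g \<otimes>\<^bsub>rat_chains (carrier G)\<^esub> ?s h)"
      unfolding to_rat_H1_def
      using N.repr_independence[OF _ single N.is_subgroup] gh by blast
    then show ?thesis
      using N.rcos_sum[OF single single] gh by (simp add: to_rat_H1_def)
  qed
  then have "to_rat_H1 G \<in> hom G (rat_H1 G)"
    using single by (intro homI) (auto simp: rat_H1_def FactGroup_def RCOSETS_def to_rat_H1_def)
  then show ?thesis
    using N.factorgroup_is_group by (simp add: group_hom_def group_hom_axioms_def rat_H1_def is_group)
qed

end

theory Submission
  imports Defs
begin

text \<open>
  For a subgroup \<open>H\<close> let \<open>rat_core p G H\<close> be the set of all \<open>h \<in> H\<close> with \<open>p dvd \<chi> h\<close> for every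
  homomorphism \<open>\<chi>\<close> from \<open>H\<close> to the integers.  It contains \<open>rad_Q H\<close>, the quotient by it is an
  elementary abelian \<open>p\<close>-group, and it is functorial in \<open>H\<close>.  Iterating it gives a descending
  series of subgroups, each normal in \<open>G\<close>; if \<open>G\<close> is finitely generated and the intersection of
  the series, the residual, is trivial, then this one series shows that \<open>G\<close> is both RFRp and RFRS
  (\<open>rat_residual_trivial_imp_RFR\<close>).  By functoriality every homomorphism maps residual into
  residual, and the residual of \<open>H\<close> is contained in that of any subgroup \<open>L\<close> between \<open>rat_core p G H\<close>
  and \<open>H\<close>.

  Forgetting the last strand is a homomorphism from \<open>PB\<^sub>n\<^sub>+\<^sub>1\<close> to \<open>PB\<^sub>n\<close> whose kernel is free on the
  loops of the last strand around the others, and a pure braid conjugates each of these loops to a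
  conjugate of it within the kernel.  By induction on \<open>n\<close> the residual of \<open>PB\<^sub>n\<^sub>+\<^sub>1\<close> lies in this free
  kernel, so it remains to treat words in the loops.

  That is the purpose of \<open>conjugated_basis_residual\<close>, for any group \<open>K\<close> with a free normal subgroup
  \<open>F\<close> on a basis \<open>B\<close> of at least two elements, each of which is conjugated by \<open>K\<close> only to
  \<open>F\<close>-conjugates of itself.  Let \<open>u \<in> F\<close> be in the residual and let \<open>x \<in> B\<close> be the first letter of a
  word for it; an inverse in this place is removed by replacing \<open>u\<close> with a conjugate of
  \<open>u\<^sup>-\<^sup>1\<close>.  The exponent of \<open>x\<close> gives a homomorphism from \<open>F\<close> to the integers; for each other
  \<open>y \<in> B\<close> it extends to \<open>K\<close> by sending \<open>g\<close> to the exponent of \<open>x\<close> in \<open>h\<close>, where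
  \<open>g y g\<^sup>-\<^sup>1 = h y h\<^sup>-\<^sup>1\<close> (\<open>twist\<close>).  The elements on which all these extensions are divisible by \<open>p\<close> form a
  subgroup \<open>K'\<close> that contains \<open>rat_core p G K\<close>.  Its intersection with \<open>F\<close> is free on
  \<open>x\<^sup>p\<close> and the elements \<open>x\<^sup>k y x\<^sup>-\<^sup>k\<close> with \<open>0 \<le> k < p\<close>, and \<open>K'\<close> again conjugates each of these
  elements only to conjugates of itself.  So the pair \<open>K'\<close>, \<open>B'\<close> is of the same kind, and \<open>u\<close> is in its
  residual.  In the new basis \<open>u\<close> has a shorter word: the Schreier rewriting process
  never lengthens a word, and it drops the first letter, since this letter leads from the coset of
  \<open>1\<close> to the different coset of \<open>x\<close>.  Induction on the length shows \<open>u = 1\<close>.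

  Geometrically the passage from \<open>B\<close> to \<open>B'\<close> is the covering \<open>z \<mapsto> z\<^sup>p\<close> of the punctured plane, branched
  over the puncture that \<open>x\<close> encircles.  Only such planar coverings are needed, and on them a
  suitable subgroup of finite index still acts trivially on first homology; this fails for
  general abelian coverings.
\<close>

section \<open>The rational p-series of a group\<close>

definition rat_core :: "nat \<Rightarrow> ('a, 'm) monoid_scheme \<Rightarrow> 'a set \<Rightarrow> 'a set" where
  "rat_core p G H = {h \<in> H. \<forall>\<chi>\<in>hom (G\<lparr>carrier := H\<rparr>) integer_group. int p dvd \<chi> h}"

primrec rat_series :: "nat \<Rightarrow> ('a, 'm) monoid_scheme \<Rightarrow> 'a set \<Rightarrow> nat \<Rightarrow> 'a set" where
  "rat_series p G H 0 = H"
| "rat_series p G H (Suc i) = rat_core p G (rat_series p G H i)"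

definition rat_residual :: "nat \<Rightarrow> ('a, 'm) monoid_scheme \<Rightarrow> 'a set \<Rightarrow> 'a set" where
  "rat_residual p G H = (\<Inter>i. rat_series p G H i)"

lemma int_hom_iff:
  "\<chi> \<in> hom (G\<lparr>carrier := H\<rparr>) integer_group \<longleftrightarrow> (\<forall>x\<in>H. \<forall>y\<in>H. \<chi> (x \<otimes>\<^bsub>G\<^esub> y) = \<chi> x + \<chi> y)"
  by (auto simp: hom_def)

lemma rat_core_subset: "rat_core p G H \<subseteq> H"
  by (auto simp: rat_core_def)

lemma rat_core_dvd:
  assumes "h \<in> rat_core p G H" "\<And>x y. x \<in> H \<Longrightarrow> y \<in> H \<Longrightarrow> \<chi> (x \<otimes>\<^bsub>G\<^esub> y) = \<chi> x + \<chi> y"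
  shows "int p dvd \<chi> h"
  using assms by (auto simp: rat_core_def int_hom_iff)

lemma rat_series_subset: "rat_series p G H i \<subseteq> H"
proof (induction i)
  case (Suc i)
  then show ?case using rat_core_subset[of p G "rat_series p G H i"] by auto
qed simp

lemma rat_residual_subset: "rat_residual p G H \<subseteq> H"
  unfolding rat_residual_def by (metis INT_lower UNIV_I rat_series.simps(1))

text \<open>
  Homomorphisms to the integers can be pulled back along any homomorphism.
\<close>

lemma rat_core_image:
  assumes f: "\<And>x. x \<in> H \<Longrightarrow> f x \<in> L"
    "\<And>x y. x \<in> H \<Longrightarrow> y \<in> H \<Longrightarrow> f (x \<otimes>\<^bsub>G\<^esub> y) = f x \<otimes>\<^bsub>K\<^esub> f y"
    and h: "h \<in> rat_core p G H"
  shows "f h \<in> rat_core p K L"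
  unfolding rat_core_def
proof (intro CollectI conjI ballI)
  show "f h \<in> L" using f(1) subsetD[OF rat_core_subset h] by blast
  fix \<chi> assume "\<chi> \<in> hom (K\<lparr>carrier := L\<rparr>) integer_group"
  then show "int p dvd \<chi> (f h)"
    using rat_core_dvd[OF h, of "\<chi> \<circ> f"] f by (simp add: int_hom_iff)
qed

lemma rat_series_image:
  assumes f: "\<And>x. x \<in> H \<Longrightarrow> f x \<in> L"
    "\<And>x y. x \<in> H \<Longrightarrow> y \<in> H \<Longrightarrow> f (x \<otimes>\<^bsub>G\<^esub> y) = f x \<otimes>\<^bsub>K\<^esub> f y"
  shows "f ` rat_series p G H i \<subseteq> rat_series p K L i"
proof (induction i)
  case (Suc i)
  show ?case
  proof
    fix y assume "y \<in> f ` rat_series p G H (Suc i)"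
    then obtain h where h: "h \<in> rat_core p G (rat_series p G H i)" "y = f h" by auto
    have "f h \<in> rat_core p K (rat_series p K L i)"
    proof (rule rat_core_image[of "rat_series p G H i" f "rat_series p K L i" G K, OF _ _ h(1)])
      show "f x \<in> rat_series p K L i" if "x \<in> rat_series p G H i" for x
        using Suc that by blast
      show "f (x \<otimes>\<^bsub>G\<^esub> y) = f x \<otimes>\<^bsub>K\<^esub> f y"
        if "x \<in> rat_series p G H i" "y \<in> rat_series p G H i" for x y
        by (rule f(2)) (use that rat_series_subset[of p G H i] in blast)+
    qed
    then show "y \<in> rat_series p K L (Suc i)" using h by simp
  qed
next
  case 0
  then show ?case using f(1) by (simp add: image_subset_iff)
qed

lemma rat_residual_image:
  assumes "\<And>x. x \<in> H \<Longrightarrow> f x \<in> L"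
    "\<And>x y. x \<in> H \<Longrightarrow> y \<in> H \<Longrightarrow> f (x \<otimes>\<^bsub>G\<^esub> y) = f x \<otimes>\<^bsub>K\<^esub> f y"
    and h: "h \<in> rat_residual p G H"
  shows "f h \<in> rat_residual p K L"
  unfolding rat_residual_def
proof
  fix i
  have "f ` rat_series p G H i \<subseteq> rat_series p K L i" by (rule rat_series_image[of H f L G K]) (fact assms)+
  then show "f h \<in> rat_series p K L i" using h by (auto simp: rat_residual_def)
qed

text \<open>
  Passing to \<open>L\<close> costs one step of the series and nothing in the limit.  This is what allows an
  element of the residual to be followed into an infinite tower of subgroups.
\<close>

lemma rat_residual_between:
  assumes "rat_core p G H \<subseteq> L" "L \<subseteq> H"
  shows "rat_residual p G H \<subseteq> rat_residual p G L"
proof -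
  have "rat_series p G H (Suc i) \<subseteq> rat_series p G L i" for i
  proof (induction i)
    case (Suc i)
    show ?case
    proof
      fix h assume "h \<in> rat_series p G H (Suc (Suc i))"
      then have "h \<in> rat_core p G (rat_series p G H (Suc i))" by simp
      then have "h \<in> rat_core p G (rat_series p G L i)"
        using Suc
        by (intro rat_core_image[of "rat_series p G H (Suc i)" "\<lambda>x. x" "rat_series p G L i" G G h p]) auto
      then show "h \<in> rat_series p G L (Suc i)" by simp
    qed
  qed (use assms in simp)
  then show ?thesis unfolding rat_residual_def by blast
qed

context group
begin

lemma int_hom_one:
  assumes "subgroup H G" "\<chi> \<in> hom (G\<lparr>carrier := H\<rparr>) integer_group"
  shows "\<chi> \<one> = 0"
  using assms(2) subgroup.one_closed[OF assms(1)] r_one[OF one_closed]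
  by (fastforce simp: int_hom_iff)

lemma int_hom_inv:
  assumes H: "subgroup H G" and \<chi>: "\<chi> \<in> hom (G\<lparr>carrier := H\<rparr>) integer_group"
    and x: "x \<in> H"
  shows "\<chi> (inv x) = - \<chi> x"
proof -
  have "\<chi> (x \<otimes> inv x) = \<chi> x + \<chi> (inv x)"
    using H x \<chi> by (auto simp: int_hom_iff subgroup.m_inv_closed)
  moreover have "x \<otimes> inv x = \<one>" using H x by (simp add: subgroup.mem_carrier)
  ultimately show ?thesis using int_hom_one[OF H \<chi>] by simp
qed

lemma subgroup_nat_pow:
  assumes "subgroup H G" "x \<in> H"
  shows "x [^] (k::nat) \<in> H"
  using assms by (induction k) (auto intro: subgroup.one_closed subgroup.m_closed)

lemma int_hom_pow:
  assumes H: "subgroup H G" and \<chi>: "\<chi> \<in> hom (G\<lparr>carrier := H\<rparr>) integer_group"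
    and x: "x \<in> H"
  shows "\<chi> (x [^] (k::nat)) = int k * \<chi> x"
proof (induction k)
  case (Suc k)
  have "x [^] k \<in> H" by (rule subgroup_nat_pow[OF H x])
  then have "\<chi> (x [^] k \<otimes> x) = \<chi> (x [^] k) + \<chi> x" using \<chi> x by (simp add: int_hom_iff)
  then show ?case using Suc by (simp add: algebra_simps)
qed (use int_hom_one[OF H \<chi>] in auto)

lemma subgroup_rat_core:
  assumes H: "subgroup H G"
  shows "subgroup (rat_core p G H) G"
proof (rule subgroupI)
  show "rat_core p G H \<subseteq> carrier G"
    using rat_core_subset[of p G H] subgroup.subset[OF H] by blast
  have "\<one> \<in> rat_core p G H"
    using subgroup.one_closed[OF H] by (auto simp: rat_core_def dest!: int_hom_one[OF H])
  then show "rat_core p G H \<noteq> {}" by blast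
  show "inv a \<in> rat_core p G H" if "a \<in> rat_core p G H" for a
    using that subgroup.m_inv_closed[OF H]
    by (auto simp: rat_core_def) (metis int_hom_inv[OF H] dvd_minus_iff)
  show "a \<otimes> b \<in> rat_core p G H" if "a \<in> rat_core p G H" "b \<in> rat_core p G H" for a b
    using that subgroup.m_closed[OF H] by (simp add: rat_core_def int_hom_iff)
qed

lemma subgroup_rat_series:
  "subgroup H G \<Longrightarrow> subgroup (rat_series p G H i) G"
  by (induction i) (auto intro: subgroup_rat_core)

lemma subgroup_rat_residual:
  assumes "subgroup H G" shows "subgroup (rat_residual p G H) G"
  unfolding rat_residual_def using subgroup_rat_series[OF assms] by (intro subgroups_Inter) auto

lemma conj_mult_distrib:
  assumes "g \<in> carrier G" "x \<in> carrier G" "y \<in> carrier G"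
  shows "g \<otimes> (x \<otimes> y) \<otimes> inv g = (g \<otimes> x \<otimes> inv g) \<otimes> (g \<otimes> y \<otimes> inv g)"
  using assms by (simp add: m_assoc inv_solve_left)

lemma rat_series_conj:
  assumes H: "subgroup H G" and g: "g \<in> H" and h: "h \<in> rat_series p G H i"
  shows "g \<otimes> h \<otimes> inv g \<in> rat_series p G H i"
proof -
  have "(\<lambda>x. g \<otimes> x \<otimes> inv g) ` rat_series p G H i \<subseteq> rat_series p G H i"
  proof (rule rat_series_image[of H "\<lambda>x. g \<otimes> x \<otimes> inv g" H G G])
    show "g \<otimes> x \<otimes> inv g \<in> H" if "x \<in> H" for x
      using g that by (simp add: subgroup.m_closed[OF H] subgroup.m_inv_closed[OF H])
    show "g \<otimes> (x \<otimes> y) \<otimes> inv g = g \<otimes> x \<otimes> inv g \<otimes> (g \<otimes> y \<otimes> inv g)" if "x \<in> H" "y \<in> H" for x y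
      by (intro conj_mult_distrib subgroup.mem_carrier[OF H] g that)
  qed
  from subsetD[OF this imageI[OF h]] show ?thesis .
qed

lemma rat_residual_conj:
  assumes "subgroup H G" "g \<in> H" "h \<in> rat_residual p G H"
  shows "g \<otimes> h \<otimes> inv g \<in> rat_residual p G H"
  using assms rat_series_conj by (auto simp: rat_residual_def)

lemma rat_series_normal:
  assumes H: "subgroup H G"
  shows "rat_series p G H i \<lhd> G\<lparr>carrier := H\<rparr>"
proof -
  interpret H: group "G\<lparr>carrier := H\<rparr>" by (rule subgroup_imp_group[OF H])
  show ?thesis
    unfolding H.normal_inv_iff
  proof (intro conjI ballI)
    show "subgroup (rat_series p G H i) (G\<lparr>carrier := H\<rparr>)"
      by (rule subgroup_incl[OF subgroup_rat_series[OF H] H rat_series_subset])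
    fix g h assume "g \<in> carrier (G\<lparr>carrier := H\<rparr>)" and h: "h \<in> rat_series p G H i"
    then have g: "g \<in> H" by simp
    show "g \<otimes>\<^bsub>G\<lparr>carrier := H\<rparr>\<^esub> h \<otimes>\<^bsub>G\<lparr>carrier := H\<rparr>\<^esub> inv\<^bsub>G\<lparr>carrier := H\<rparr>\<^esub> g \<in> rat_series p G H i"
      using rat_series_conj[OF H g h] by (simp add: m_inv_consistent[OF H g])
  qed
qed

text \<open>
  By induction \<open>\<chi>\<close> takes values divisible by \<open>p\<^sup>i\<close> on the \<open>i\<close>-th term, for dividing it by \<open>p\<^sup>i\<close>
  leaves a homomorphism to the integers.
\<close>

lemma rat_residual_integer:
  assumes "2 \<le> p" and \<chi>: "\<chi> \<in> hom (G\<lparr>carrier := H\<rparr>) integer_group"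
    and u: "u \<in> rat_residual p G H"
  shows "\<chi> u = 0"
proof -
  have dvd: "x \<in> rat_series p G H i \<Longrightarrow> int p ^ i dvd \<chi> x" for i x
  proof (induction i arbitrary: x)
    case (Suc i)
    let ?\<psi> = "\<lambda>x. \<chi> x div int p ^ i"
    have x: "x \<in> rat_core p G (rat_series p G H i)" using Suc.prems by simp
    have "int p dvd ?\<psi> x"
    proof (rule rat_core_dvd[OF x, where \<chi> = ?\<psi>])
      fix a b assume ab: "a \<in> rat_series p G H i" "b \<in> rat_series p G H i"
      then have "a \<in> H" "b \<in> H" using rat_series_subset[of p G H i] by auto
      then have "\<chi> (a \<otimes> b) = \<chi> a + \<chi> b" using \<chi> by (simp add: int_hom_iff)
      then show "?\<psi> (a \<otimes> b) = ?\<psi> a + ?\<psi> b"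
        using div_plus_div_distrib_dvd_left[OF Suc.IH[OF ab(1)], of "\<chi> b"] by simp
    qed
    moreover have "int p ^ i dvd \<chi> x" using Suc.IH subsetD[OF rat_core_subset x] by blast
    ultimately show ?case
      by (metis dvd_mult_div_cancel mult_dvd_mono dvd_refl power_Suc2)
  qed simp
  show ?thesis
  proof (rule ccontr)
    assume nz: "\<chi> u \<noteq> 0"
    (* A nonzero value is not divisible by the power of p whose exponent is its absolute value. *)
    define m where "m = nat \<bar>\<chi> u\<bar>"
    have "u \<in> rat_series p G H m" using u by (simp add: rat_residual_def)
    then have "int p ^ m dvd \<chi> u" by (rule dvd)
    from dvd_imp_le_int[OF nz this] have "int p ^ m \<le> \<bar>\<chi> u\<bar>" by simp
    moreover have "m < p ^ m" using assms(1) by (simp add: power_gt_expt)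
    then have "int m < int (p ^ m)" by (simp only: of_nat_less_iff)
    then have "int m < int p ^ m" by simp
    ultimately show False by (simp add: m_def)
  qed
qed

end


section \<open>From a trivial residual to RFRS and RFRp\<close>

text \<open>
  A homomorphism to the integers extends linearly to rational 1-chains and vanishes there on
  boundaries, hence factors through rational homology.
\<close>

lemma rad_Q_integer:
  assumes G: "group G" and \<chi>: "\<chi> \<in> hom G integer_group" and g: "g \<in> rad_Q G"
  shows "\<chi> g = 0"
proof -
  interpret group G by fact
  define ev :: "('a \<Rightarrow>\<^sub>0 rat) \<Rightarrow> rat" where
    "ev c = (\<Sum>x\<in>Poly_Mapping.keys c. Poly_Mapping.lookup c x * of_int (\<chi> x))" for c
  have ev_eq: "ev c = (\<Sum>x\<in>T. Poly_Mapping.lookup c x * of_int (\<chi> x))"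
    if "finite T" "Poly_Mapping.keys c \<subseteq> T" for c T
    unfolding ev_def by (rule sum.mono_neutral_left) (use that in \<open>auto simp: in_keys_iff\<close>)
  have ev_add: "ev (c + d) = ev c + ev d" for c d
    using Poly_Mapping.keys_add[of c d]
    by (simp add: ev_eq[of "Poly_Mapping.keys c \<union> Poly_Mapping.keys d"] sum.distrib[symmetric]
        lookup_add algebra_simps)
  have ev_single: "ev (Poly_Mapping.single x q) = q * of_int (\<chi> x)" for x q
    by (simp add: ev_eq[of "{x}"])
  have ev_minus: "ev (c - d) = ev c - ev d" for c d
    using ev_add[of "c - d" d] by simp
  have ev_sum: "ev (sum f T) = (\<Sum>x\<in>T. ev (f x))" if "finite T" for f :: "'a \<times> 'a \<Rightarrow> _" and T
    using that by (induction T) (auto simp: ev_add, simp add: ev_def)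
  have gc: "g \<in> carrier G" and "to_rat_H1 G g = \<one>\<^bsub>rat_H1 G\<^esub>"
    using g by (auto simp: rad_Q_def kernel_def)
  then have eq: "to_rat_H1 G g = rat_boundaries1 G" by (simp add: rat_H1_def)
  interpret N: normal "rat_boundaries1 G" "rat_chains (carrier G)"
    by (rule rat_boundaries1_normal[OF G])
  have "Poly_Mapping.single g 1 \<in> to_rat_H1 G g"
    unfolding to_rat_H1_def
    by (rule N.rcos_self[OF _ N.is_subgroup]) (use gc in \<open>simp add: rat_chains_def\<close>)
  then obtain c where c: "Poly_Mapping.keys c \<subseteq> carrier G \<times> carrier G"
    and s: "Poly_Mapping.single g 1 = bar_boundary2 G c"
    unfolding eq by (auto simp: rat_boundaries1_def rat_chains_def)
  have "ev (bar_boundary2 G c) = 0"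
    unfolding bar_boundary2_def ev_sum[OF finite_keys]
    by (rule sum.neutral) (use c \<chi> in \<open>auto simp: ev_add ev_minus ev_single hom_def algebra_simps subset_iff\<close>)
  then show ?thesis unfolding s[symmetric] by (simp add: ev_single)
qed

context group
begin

text \<open>
  Finite index, expressed by a finite set that meets every coset, so that no quotient has to be formed.
\<close>

definition finite_index_in :: "'a set \<Rightarrow> 'a set \<Rightarrow> bool" where
  "finite_index_in H L \<longleftrightarrow> (\<exists>T. finite T \<and> T \<subseteq> L \<and> (\<forall>g\<in>L. \<exists>h\<in>H. \<exists>t\<in>T. g = h \<otimes> t))"

lemma finite_index_in_refl: "subgroup H G \<Longrightarrow> finite_index_in H H"
  unfolding finite_index_in_def
  by (rule exI[of _ "{\<one>}"]) (auto simp: subgroup.one_closed intro!: bexI r_one[symmetric] dest: subgroup.mem_carrier)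

lemma finite_index_in_trans:
  assumes "finite_index_in H L" "finite_index_in L M" "H \<subseteq> L" "L \<subseteq> M" "subgroup M G"
  shows "finite_index_in H M"
proof -
  obtain S T where S: "finite S" "S \<subseteq> L" "\<forall>g\<in>L. \<exists>h\<in>H. \<exists>t\<in>S. g = h \<otimes> t"
    and T: "finite T" "T \<subseteq> M" "\<forall>g\<in>M. \<exists>h\<in>L. \<exists>t\<in>T. g = h \<otimes> t"
    using assms(1,2) unfolding finite_index_in_def by blast
  show ?thesis
    unfolding finite_index_in_def
  proof (intro exI[of _ "(\<lambda>(s, t). s \<otimes> t) ` (S \<times> T)"] conjI ballI)
    show "finite ((\<lambda>(s, t). s \<otimes> t) ` (S \<times> T))" by (intro finite_imageI finite_cartesian_product S T)
    show "(\<lambda>(s, t). s \<otimes> t) ` (S \<times> T) \<subseteq> M"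
      using S(2) T(2) assms(4) subgroup.m_closed[OF assms(5)] by force
    fix g assume "g \<in> M"
    then obtain l t where l: "l \<in> L" "t \<in> T" "g = l \<otimes> t" using T by blast
    then obtain h s where h: "h \<in> H" "s \<in> S" "l = h \<otimes> s" using S by blast
    have "g = h \<otimes> (s \<otimes> t)"
      using h l S T assms subgroup.mem_carrier[OF assms(5)] by (simp add: subset_iff m_assoc)
    then show "\<exists>h\<in>H. \<exists>x\<in>(\<lambda>(s, t). s \<otimes> t) ` (S \<times> T). g = h \<otimes> x" using h l by blast
  qed
qed

lemma finite_index_imp_finite_rcosets:
  assumes "finite_index_in H (carrier G)" "subgroup H G"
  shows "finite (rcosets H)"
proof -
  obtain T where T: "finite T" "T \<subseteq> carrier G" "\<forall>g\<in>carrier G. \<exists>h\<in>H. \<exists>t\<in>T. g = h \<otimes> t"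
    using assms(1) unfolding finite_index_in_def by blast
  have "rcosets H \<subseteq> (\<lambda>t. H #> t) ` T"
  proof
    fix C assume "C \<in> rcosets H"
    then obtain g where g: "g \<in> carrier G" "C = H #> g" by (auto simp: RCOSETS_def)
    then obtain h t where h: "h \<in> H" "t \<in> T" "g = h \<otimes> t" using T by blast
    have "g \<in> H #> t" using h by (auto simp: r_coset_def)
    then have "H #> t = H #> g" using repr_independence assms(2) T h by blast
    then show "C \<in> (\<lambda>t. H #> t) ` T" using g h by blast
  qed
  then show ?thesis using T(1) finite_surj by blast
qed

text \<open>
  Schreier's lemma, without any choice of unique coset representatives.
\<close>

lemma finite_index_finitely_generated:
  assumes S: "finite S" "S \<subseteq> carrier G" and H: "subgroup H G"
    and cof: "finite_index_in H (generate G S)" and HS: "H \<subseteq> generate G S"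
  shows "\<exists>Y. finite Y \<and> Y \<subseteq> H \<and> generate G Y = H"
proof -
  let ?L = "generate G S"
  have L: "subgroup ?L G" by (rule generate_is_subgroup[OF S(2)])
  obtain T0 where T0: "finite T0" "T0 \<subseteq> ?L" "\<forall>g\<in>?L. \<exists>h\<in>H. \<exists>t\<in>T0. g = h \<otimes> t"
    using cof unfolding finite_index_in_def by blast
  define T where "T = insert \<one> T0"
  have T: "finite T" "T \<subseteq> ?L" "\<And>g. g \<in> ?L \<Longrightarrow> \<exists>h\<in>H. \<exists>t\<in>T. g = h \<otimes> t" "\<one> \<in> T"
    using T0 subgroup.one_closed[OF L] unfolding T_def by blast+
  define S' where "S' = S \<union> (\<lambda>s. inv s) ` S"
  have S': "finite S'" "S' \<subseteq> ?L" using S by (auto simp: S'_def generate.incl generate.inv)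
  define Y where "Y = H \<inter> (T \<union> (\<lambda>(t, s, t'). t \<otimes> s \<otimes> inv t') ` (T \<times> S' \<times> T))"
  have Y: "finite Y" "Y \<subseteq> H" using T S' by (auto simp: Y_def)
  have Hc: "H \<subseteq> carrier G" by (rule subgroup.subset[OF H])
  have Lc: "?L \<subseteq> carrier G" by (rule subgroup.subset[OF L])
  have YG: "subgroup (generate G Y) G" by (rule generate_is_subgroup) (use Y Hc in blast)
  have YH: "generate G Y \<subseteq> H" by (rule generate_subgroup_incl[OF Y(2) H])
  (* The product set <Y> T absorbs right multiplication by the generators and contains 1. *)
  have step: "\<exists>y\<in>generate G Y. \<exists>t\<in>T. g \<otimes> s = y \<otimes> t"
    if g: "\<exists>y\<in>generate G Y. \<exists>t\<in>T. g = y \<otimes> t" and s: "s \<in> S'" for g s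
  proof -
    obtain y t where yt: "y \<in> generate G Y" "t \<in> T" "g = y \<otimes> t" using g by blast
    have "t \<otimes> s \<in> ?L" using yt(2) T(2) s S'(2) subgroup.m_closed[OF L] by blast
    then obtain h t' where h: "h \<in> H" "t' \<in> T" "t \<otimes> s = h \<otimes> t'" using T(3) by blast
    have c: "t \<in> carrier G" "s \<in> carrier G" "t' \<in> carrier G" "y \<in> carrier G" "h \<in> carrier G"
      using yt h s T(2) S'(2) Lc YH Hc by blast+
    have "h = t \<otimes> s \<otimes> inv t'" using h(3) c by (simp add: m_assoc)
    then have "h \<in> Y" using h yt s by (force simp: Y_def)
    then have "y \<otimes> h \<in> generate G Y" using yt(1) by (blast intro: generate.eng generate.incl)
    moreover have "g \<otimes> s = (y \<otimes> h) \<otimes> t'" using h(3) yt(3) c by (simp add: m_assoc)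
    ultimately show ?thesis using h by blast
  qed
  have all: "g \<in> ?L \<Longrightarrow> \<exists>y\<in>generate G Y. \<exists>t\<in>T. g0 \<otimes> g = y \<otimes> t"
    if "g0 \<in> carrier G" "\<exists>y\<in>generate G Y. \<exists>t\<in>T. g0 = y \<otimes> t" for g0 g
  proof -
    assume "g \<in> ?L"
    then show ?thesis using that
    proof (induction arbitrary: g0 rule: generate.induct)
      case (eng h1 h2)
      have c: "h1 \<in> carrier G" "h2 \<in> carrier G" using eng Lc by blast+
      then show ?case using eng.IH(2)[of "g0 \<otimes> h1"] eng.IH(1)[of g0] eng.prems by (simp add: m_assoc)
    qed (use step S'_def in auto)
  qed
  have "H \<subseteq> generate G Y"
  proof
    fix h assume h: "h \<in> H"
    have "\<exists>y\<in>generate G Y. \<exists>t\<in>T. \<one> = y \<otimes> t" using T(4) subgroup.one_closed[OF YG] by force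
    then obtain y t where yt: "y \<in> generate G Y" "t \<in> T" "h = y \<otimes> t"
      using all[of \<one> h] h HS Hc l_one[of h] one_closed by (metis subsetD)
    have c: "t \<in> carrier G" "y \<in> H" using yt T(2) Lc YH by blast+
    have "t = inv y \<otimes> h" using yt c Hc by (auto simp: m_assoc[symmetric] subset_iff)
    then have "t \<in> H" using h c H by (simp add: subgroup.m_closed subgroup.m_inv_closed)
    then have "t \<in> Y" using yt by (simp add: Y_def)
    then show "h \<in> generate G Y" using yt by (simp add: generate.eng generate.incl)
  qed
  then show ?thesis using Y YH by blast
qed

text \<open>
  Modulo \<open>p\<close> a homomorphism to the integers is determined by its values on the finitely many
  generators.  Hence the coset of \<open>h\<close> is determined by the finite set \<open>sig h\<close> of pairs consisting of
  the reduction of some \<open>\<chi>\<close> on the generators and the residue of \<open>\<chi> h\<close>.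
\<close>

lemma finite_index_rat_core:
  assumes p: "0 < p" and S: "finite S" "S \<subseteq> carrier G"
  shows "finite_index_in (rat_core p G (generate G S)) (generate G S)"
proof -
  let ?L = "generate G S"
  have L: "subgroup ?L G" by (rule generate_is_subgroup[OF S(2)])
  let ?E = "PiE S (\<lambda>_. {0..<int p})"
  define red where "red \<chi> = restrict (\<lambda>s. \<chi> s mod int p) S" for \<chi> :: "'a \<Rightarrow> int"
  define sig where
    "sig h = (\<lambda>\<chi>. (red \<chi>, \<chi> h mod int p)) ` hom (G\<lparr>carrier := ?L\<rparr>) integer_group" for h
  have sigE: "sig h \<in> Pow (?E \<times> {0..<int p})" for h
    using p by (auto simp: sig_def red_def)
  have "finite ?E" using S(1) by (intro finite_PiE) auto
  then have "finite (Pow (?E \<times> {0..<int p}))" by simp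
  then have fin: "finite (sig ` ?L)"
    by (rule finite_subset[rotated]) (rule image_subsetI, rule sigE)
  have det: "\<chi> h mod int p = \<psi> h mod int p"
    if \<chi>: "\<chi> \<in> hom (G\<lparr>carrier := ?L\<rparr>) integer_group"
      and \<psi>: "\<psi> \<in> hom (G\<lparr>carrier := ?L\<rparr>) integer_group"
      and r: "red \<chi> = red \<psi>" and h: "h \<in> ?L" for \<chi> \<psi> h
  proof -
    have s: "\<chi> s mod int p = \<psi> s mod int p" if "s \<in> S" for s
      using fun_cong[OF r, of s] that by (simp add: red_def)
    have "int p dvd \<chi> h - \<psi> h" using h
    proof (induction rule: generate.induct)
      case one
      then show ?case using int_hom_one[OF L \<chi>] int_hom_one[OF L \<psi>] by simp
    next
      case (incl h)
      then show ?case using s by (simp add: mod_eq_dvd_iff)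
    next
      case (inv h)
      then have "\<chi> (inv h) = - \<chi> h" "\<psi> (inv h) = - \<psi> h" "int p dvd \<psi> h - \<chi> h"
        using int_hom_inv[OF L \<chi>] int_hom_inv[OF L \<psi>] s[of h]
        by (auto simp: generate.incl mod_eq_dvd_iff dvd_diff_commute)
      then show ?case by simp
    next
      case (eng h1 h2)
      then have "\<chi> (h1 \<otimes> h2) - \<psi> (h1 \<otimes> h2) = (\<chi> h1 - \<psi> h1) + (\<chi> h2 - \<psi> h2)"
        using \<chi> \<psi> by (simp add: int_hom_iff)
      then show ?case using dvd_add[OF eng.IH] by simp
    qed
    then show ?thesis by (simp add: mod_eq_dvd_iff)
  qed
  have core: "h \<otimes> inv t \<in> rat_core p G ?L" if h: "h \<in> ?L" and t: "t \<in> ?L" and eq: "sig h = sig t" for h t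
    unfolding rat_core_def
  proof (intro CollectI conjI ballI)
    show "h \<otimes> inv t \<in> ?L" by (rule subgroup.m_closed[OF L h subgroup.m_inv_closed[OF L t]])
    fix \<chi> assume \<chi>: "\<chi> \<in> hom (G\<lparr>carrier := ?L\<rparr>) integer_group"
    have "(red \<chi>, \<chi> h mod int p) \<in> sig h" unfolding sig_def using \<chi> by (rule imageI)
    then have "(red \<chi>, \<chi> h mod int p) \<in> sig t" using eq by simp
    then obtain \<psi> where \<psi>: "\<psi> \<in> hom (G\<lparr>carrier := ?L\<rparr>) integer_group" "red \<chi> = red \<psi>"
      "\<chi> h mod int p = \<psi> t mod int p" by (auto simp: sig_def)
    then have "\<chi> h mod int p = \<chi> t mod int p" using det[OF \<chi> \<psi>(1,2) t] by simp
    then show "int p dvd \<chi> (h \<otimes> inv t)"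
      using h \<chi> int_hom_inv[OF L \<chi> t] subgroup.m_inv_closed[OF L t]
      by (simp add: int_hom_iff mod_eq_dvd_iff)
  qed
  let ?T = "inv_into ?L sig ` sig ` ?L"
  show ?thesis
    unfolding finite_index_in_def
  proof (intro exI[of _ ?T] conjI ballI)
    show "finite ?T" using fin by blast
    show "?T \<subseteq> ?L" by (auto intro: inv_into_into)
    fix h assume h: "h \<in> ?L"
    let ?t = "inv_into ?L sig (sig h)"
    have t: "?t \<in> ?L" "sig ?t = sig h" by (rule inv_into_into f_inv_into_f, rule imageI, rule h)+
    have "h \<otimes> inv ?t \<in> rat_core p G ?L" using core h t by simp
    moreover have "h = h \<otimes> inv ?t \<otimes> ?t"
      using h t subgroup.mem_carrier[OF L] by (simp add: m_assoc)
    ultimately show "\<exists>c\<in>rat_core p G ?L. \<exists>t\<in>?T. h = c \<otimes> t" using h by blast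
  qed
qed

lemma rat_series_finite:
  assumes p: "0 < p" and S: "finite S" "S \<subseteq> carrier G" "generate G S = carrier G"
  shows "finite_index_in (rat_series p G (carrier G) i) (carrier G) \<and>
    finite_index_in (rat_series p G (carrier G) (Suc i)) (rat_series p G (carrier G) i)"
proof -
  let ?H = "rat_series p G (carrier G)"
  have sub: "subgroup (?H i) G" for i by (rule subgroup_rat_series[OF subgroup_self])
  have step: "finite_index_in (?H (Suc i)) (?H i)" if c: "finite_index_in (?H i) (carrier G)" for i
  proof -
    obtain Y where Y: "finite Y" "Y \<subseteq> ?H i" "generate G Y = ?H i"
      using finite_index_finitely_generated[OF S(1,2) sub[of i], unfolded S(3), OF c rat_series_subset] by blast
    have "Y \<subseteq> carrier G" using Y(2) rat_series_subset[of p G "carrier G" i] by (rule subset_trans)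
    then show ?thesis using finite_index_rat_core[OF p Y(1)] Y(3) by simp
  qed
  have "finite_index_in (?H i) (carrier G)" for i
  proof (induction i)
    case (Suc i)
    show ?case
      by (rule finite_index_in_trans[OF step[OF Suc] Suc _ rat_series_subset subgroup_self])
        (simp add: rat_core_subset)
  qed (use finite_index_in_refl[OF subgroup_self] in simp)
  then show ?thesis using step by blast
qed

lemma rad_Q_subset_rat_core:
  assumes H: "subgroup H G"
  shows "rad_Q (G\<lparr>carrier := H\<rparr>) \<subseteq> rat_core p G H"
proof
  fix g assume g: "g \<in> rad_Q (G\<lparr>carrier := H\<rparr>)"
  have "g \<in> H" using g by (simp add: rad_Q_def kernel_def)
  then show "g \<in> rat_core p G H"
    by (auto simp: rat_core_def dest!: rad_Q_integer[OF subgroup_imp_group[OF H] _ g])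
qed

lemma rat_core_quotient:
  assumes H: "subgroup H G" and cof: "finite_index_in (rat_core p G H) H"
  shows "finite_elementary_abelian p (G\<lparr>carrier := H\<rparr> Mod rat_core p G H)"
proof -
  let ?C = "rat_core p G H" and ?G = "G\<lparr>carrier := H\<rparr>"
  interpret H: group ?G by (rule subgroup_imp_group[OF H])
  interpret N: normal ?C ?G using rat_series_normal[OF H, of p "Suc 0"] by simp
  have mem: "x \<otimes> inv y \<in> ?C"
    if xy: "x \<in> H" "y \<in> H" and d: "\<And>\<chi>. \<chi> \<in> hom ?G integer_group \<Longrightarrow> int p dvd \<chi> x - \<chi> y" for x y
    unfolding rat_core_def
  proof (intro CollectI conjI ballI)
    show "x \<otimes> inv y \<in> H" by (intro subgroup.m_closed[OF H] subgroup.m_inv_closed[OF H] xy)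
    fix \<chi> assume \<chi>: "\<chi> \<in> hom ?G integer_group"
    then show "int p dvd \<chi> (x \<otimes> inv y)"
      using \<chi> d[OF \<chi>] int_hom_inv[OF H \<chi> xy(2)] xy subgroup.m_inv_closed[OF H]
      by (simp add: int_hom_iff)
  qed
  have coset: "?C #>\<^bsub>?G\<^esub> x = ?C #>\<^bsub>?G\<^esub> y"
    if xy: "x \<in> H" "y \<in> H" and d: "\<And>\<chi>. \<chi> \<in> hom ?G integer_group \<Longrightarrow> int p dvd \<chi> x - \<chi> y" for x y
  proof -
    have "x = x \<otimes> inv y \<otimes> y" using xy subgroup.mem_carrier[OF H] by (simp add: m_assoc)
    then have "x \<in> ?C #>\<^bsub>?G\<^esub> y" using mem[OF xy d] by (auto simp: r_coset_def)
    then show ?thesis using H.repr_independence[OF _ _ N.is_subgroup] xy by (metis partial_object.select_convs(1) partial_object.update_convs(1) partial_object.surjective monoid.surjective)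
  qed
  show ?thesis
    unfolding finite_elementary_abelian_def
  proof (intro conjI ballI)
    show "comm_group (?G Mod ?C)"
    proof (rule group.group_comm_groupI[OF N.factorgroup_is_group])
      fix U V assume "U \<in> carrier (?G Mod ?C)" "V \<in> carrier (?G Mod ?C)"
      then obtain x y where xy: "x \<in> H" "y \<in> H" "U = ?C #>\<^bsub>?G\<^esub> x" "V = ?C #>\<^bsub>?G\<^esub> y"
        by (auto simp: FactGroup_def RCOSETS_def)
      have "?C #>\<^bsub>?G\<^esub> (x \<otimes> y) = ?C #>\<^bsub>?G\<^esub> (y \<otimes> x)"
        using xy H by (intro coset) (auto simp: int_hom_iff subgroup.m_closed)
      then show "U \<otimes>\<^bsub>?G Mod ?C\<^esub> V = V \<otimes>\<^bsub>?G Mod ?C\<^esub> U"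
        using N.rcos_sum[of x y] N.rcos_sum[of y x] xy by simp
    qed
    have "finite_index_in ?C H = H.finite_index_in ?C (carrier ?G)"
      by (simp add: finite_index_in_def H.finite_index_in_def)
    then show "finite (carrier (?G Mod ?C))"
      using H.finite_index_imp_finite_rcosets[OF _ N.is_subgroup] cof by (simp add: FactGroup_def)
    fix U assume "U \<in> carrier (?G Mod ?C)"
    then obtain x where x: "x \<in> H" "U = ?C #>\<^bsub>?G\<^esub> x" by (auto simp: FactGroup_def RCOSETS_def)
    have "?C #>\<^bsub>?G\<^esub> (x [^]\<^bsub>?G\<^esub> p) = ?C #>\<^bsub>?G\<^esub> \<one>"
    proof (rule coset)
      show "x [^]\<^bsub>?G\<^esub> p \<in> H" using H.nat_pow_closed[of x p] x by simp
      show "\<one> \<in> H" by (rule subgroup.one_closed[OF H])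
      fix \<chi> assume \<chi>: "\<chi> \<in> hom ?G integer_group"
      have "\<chi> (x [^]\<^bsub>?G\<^esub> k) = int k * \<chi> x" for k
        using H.int_hom_pow[OF H.subgroup_self, of \<chi> x k] \<chi> x by simp
      moreover have "\<chi> \<one> = 0"
        using int_hom_one[OF H \<chi>] .
      ultimately show "int p dvd \<chi> (x [^]\<^bsub>?G\<^esub> p) - \<chi> \<one>" by simp
    qed
    then show "U [^]\<^bsub>?G Mod ?C\<^esub> p = \<one>\<^bsub>?G Mod ?C\<^esub>"
      using N.FactGroup_pow[of x p] x H.coset_mult_one[of ?C] N.subset by simp
  qed
qed

theorem rat_residual_trivial_imp_RFR:
  assumes p: "0 < p" and fg: "finitely_generated_group G"
    and res: "rat_residual p G (carrier G) = {\<one>}"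
  shows "RFRp p G" "RFRS G"
proof -
  let ?H = "rat_series p G (carrier G)"
  obtain S where S: "finite S" "S \<subseteq> carrier G" "generate G S = carrier G"
    using fg by (auto simp: finitely_generated_group_def)
  have sub: "subgroup (?H i) G" for i by (rule subgroup_rat_series[OF subgroup_self])
  note fin = rat_series_finite[OF p S]
  have nor: "?H (Suc i) \<lhd> G\<lparr>carrier := ?H i\<rparr>" for i
    using rat_series_normal[OF sub[of i], of p "Suc 0"] by simp
  have norG: "?H i \<lhd> G" for i using rat_series_normal[OF subgroup_self, of p i] by simp
  have res': "(\<Inter>i. ?H i) = {\<one>}" using res by (simp add: rat_residual_def)
  show "RFRp p G"
    unfolding RFRp_def
    using fg sub nor rad_Q_subset_rat_core[OF sub] rat_core_quotient[OF sub] fin res'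
    by (intro conjI exI[of _ ?H] allI) auto
  have "finite (rcosets (?H i))" for i
    using finite_index_imp_finite_rcosets[OF _ sub] fin by blast
  then show "RFRS G"
    unfolding RFRS_def
    using norG rad_Q_subset_rat_core[OF sub] rat_core_subset[of p G "?H _"] res'
    by (intro conjI exI[of _ ?H] allI is_group) auto
qed

end

section \<open>Free bases and words\<close>

text \<open>
  Freeness by a universal property, tested only on permutations of the integers.  A nonempty
  reduced word acts nontrivially for a suitable choice of permutations, so this is ordinary freeness,
  and it makes the two operations needed below easy: reading off exponents (translations) and
  inducing actions from a subgroup of index \<open>p\<close> (\<open>p\<close> copies of the integers, interleaved, are again the integers).
\<close>

definition free_basis :: "('a, 'm) monoid_scheme \<Rightarrow> 'a set \<Rightarrow> bool" where
  "free_basis G B \<longleftrightarrow> (\<forall>f :: 'a \<Rightarrow> int \<Rightarrow> int. (\<forall>b. bij (f b)) \<longrightarrow>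
    (\<exists>\<phi>. (\<forall>u\<in>generate G B. \<forall>v\<in>generate G B. \<phi> (u \<otimes>\<^bsub>G\<^esub> v) = \<phi> u \<circ> \<phi> v) \<and>
         \<phi> \<one>\<^bsub>G\<^esub> = id \<and> (\<forall>b\<in>B. \<phi> b = f b)))"

text \<open>
  The number is an upper bound for the length of a word, which need not be reduced: the empty word
  has every length.
\<close>

inductive spelled :: "('a, 'm) monoid_scheme \<Rightarrow> 'a set \<Rightarrow> nat \<Rightarrow> 'a \<Rightarrow> bool" for G B where
  spelled_one: "spelled G B n \<one>\<^bsub>G\<^esub>"
| spelled_pos: "x \<in> B \<Longrightarrow> spelled G B n u \<Longrightarrow> spelled G B (Suc n) (x \<otimes>\<^bsub>G\<^esub> u)"
| spelled_neg: "x \<in> B \<Longrightarrow> spelled G B n u \<Longrightarrow> spelled G B (Suc n) (inv\<^bsub>G\<^esub> x \<otimes>\<^bsub>G\<^esub> u)"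

context group
begin

lemma inv_cancel_left:
  assumes "a \<in> carrier G" "b \<in> carrier G"
  shows "inv a \<otimes> (a \<otimes> b) = b" "a \<otimes> (inv a \<otimes> b) = b"
  using assms by (simp_all add: m_assoc[symmetric])

lemmas group_normalize = m_assoc inv_mult_group inv_cancel_left

lemma conj_pow:
  assumes "g \<in> carrier G" "x \<in> carrier G"
  shows "(g \<otimes> x \<otimes> inv g) [^] (k::nat) = g \<otimes> x [^] k \<otimes> inv g"
  by (induction k) (use assms in \<open>simp_all add: group_normalize\<close>)

lemma conj_eq_imp_commute:
  assumes "h \<in> carrier G" "h' \<in> carrier G" "y \<in> carrier G"
    and "h \<otimes> y \<otimes> inv h = h' \<otimes> y \<otimes> inv h'"
  shows "(inv h' \<otimes> h) \<otimes> y = y \<otimes> (inv h' \<otimes> h)"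
proof -
  have "inv h' \<otimes> (h \<otimes> y \<otimes> inv h) \<otimes> h = inv h' \<otimes> (h' \<otimes> y \<otimes> inv h') \<otimes> h"
    using assms(4) by simp
  then show ?thesis using assms(1-3) by (simp add: group_normalize)
qed

lemma spelled_generate: "spelled G B n u \<Longrightarrow> u \<in> generate G B"
  by (induction rule: spelled.induct) (auto intro: generate.intros)

lemma spelled_carrier: "B \<subseteq> carrier G \<Longrightarrow> spelled G B n u \<Longrightarrow> u \<in> carrier G"
  using spelled_generate generate_in_carrier by blast

lemma spelled_mono:
  assumes "spelled G B m u"
  shows "m \<le> n \<Longrightarrow> spelled G B n u"
  using assms
proof (induction arbitrary: n rule: spelled.induct)
  case (spelled_pos x m u)
  then show ?case using spelled.spelled_pos[of x B G "n - 1" u] by (cases n) auto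
next
  case (spelled_neg x m u)
  then show ?case using spelled.spelled_neg[of x B G "n - 1" u] by (cases n) auto
qed (rule spelled.spelled_one)

lemma spelled_mult:
  assumes B: "B \<subseteq> carrier G" and v: "spelled G B n v"
  shows "spelled G B m u \<Longrightarrow> spelled G B (m + n) (u \<otimes> v)"
proof (induction rule: spelled.induct)
  case (spelled_one m)
  then show ?case using spelled_mono[OF v] spelled_carrier[OF B v] by simp
next
  case (spelled_pos x m u)
  then have "x \<otimes> u \<otimes> v = x \<otimes> (u \<otimes> v)"
    using B spelled_carrier[OF B] v by (intro m_assoc) auto
  then show ?case using spelled.spelled_pos[OF spelled_pos.hyps(1) spelled_pos.IH] by simp
next
  case (spelled_neg x m u)
  then have "inv x \<otimes> u \<otimes> v = inv x \<otimes> (u \<otimes> v)"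
    using B spelled_carrier[OF B] v by (intro m_assoc) auto
  then show ?case using spelled.spelled_neg[OF spelled_neg.hyps(1) spelled_neg.IH] by simp
qed

lemma spelled_letter:
  assumes "B \<subseteq> carrier G" "x \<in> B"
  shows "spelled G B (Suc 0) x" "spelled G B (Suc 0) (inv x)"
  using spelled_pos[OF assms(2) spelled_one[where n = 0 and G = G]]
    spelled_neg[OF assms(2) spelled_one[where n = 0 and G = G]] assms
  by (simp_all add: subset_iff)

lemma spelled_inv:
  assumes B: "B \<subseteq> carrier G"
  shows "spelled G B n u \<Longrightarrow> spelled G B n (inv u)"
proof (induction rule: spelled.induct)
  case (spelled_pos x m u)
  then have "inv (x \<otimes> u) = inv u \<otimes> inv x"
    using B spelled_carrier[OF B] by (intro inv_mult_group) auto
  then show ?case using spelled_mult[OF B spelled_letter(2)[OF B] spelled_pos.IH] spelled_pos.hyps by simp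
next
  case (spelled_neg x m u)
  then have "inv (inv x \<otimes> u) = inv u \<otimes> x"
    using B spelled_carrier[OF B] by (subst inv_mult_group) auto
  then show ?case using spelled_mult[OF B spelled_letter(1)[OF B] spelled_neg.IH] spelled_neg.hyps by simp
qed (simp add: spelled.spelled_one)

lemma generate_spelled:
  assumes B: "B \<subseteq> carrier G"
  shows "u \<in> generate G B \<Longrightarrow> \<exists>n. spelled G B n u"
proof (induction rule: generate.induct)
  case (eng h1 h2)
  then show ?case using spelled_mult[OF B] by blast
qed (use spelled_letter[OF B] in \<open>auto intro: spelled_one\<close>)

end


section \<open>Bases that are conjugated by a larger group\<close>

text \<open>
  The basis needs two elements because the exponent of \<open>x\<close> is extended to the large group by watching
  how that group conjugates some other basis element \<open>y\<close>.
\<close>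

locale conjugated_basis = group G for G (structure) +
  fixes K B :: "'a set"
  assumes K: "subgroup K G" and BK: "B \<subseteq> K"
    and free: "free_basis G B"
    and conj: "\<lbrakk>g \<in> K; y \<in> B\<rbrakk> \<Longrightarrow> \<exists>h\<in>generate G B. g \<otimes> y \<otimes> inv g = h \<otimes> y \<otimes> inv h"
    and another: "x \<in> B \<Longrightarrow> \<exists>y\<in>B. y \<noteq> x"
begin

abbreviation "F \<equiv> generate G B"

lemma Kc: "K \<subseteq> carrier G" by (rule subgroup.subset[OF K])
lemma Bc: "B \<subseteq> carrier G" using BK Kc by blast
lemma F: "subgroup F G" by (rule generate_is_subgroup[OF Bc])
lemma FK: "F \<subseteq> K" by (rule generate_subgroup_incl[OF BK K])
lemma Fc: "F \<subseteq> carrier G" by (rule subgroup.subset[OF F])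
lemma BF: "b \<in> B \<Longrightarrow> b \<in> F" by (rule generate.incl)

lemma extend_to_permutations:
  fixes f :: "'a \<Rightarrow> int \<Rightarrow> int"
  assumes "\<And>b. bij (f b)"
  obtains \<phi> where "\<And>u v a. u \<in> F \<Longrightarrow> v \<in> F \<Longrightarrow> \<phi> (u \<otimes> v) a = \<phi> u (\<phi> v a)"
    "\<And>a. \<phi> \<one> a = a" "\<And>b. b \<in> B \<Longrightarrow> \<phi> b = f b"
    "\<And>u a. u \<in> F \<Longrightarrow> \<phi> (inv u) (\<phi> u a) = a" "\<And>u a. u \<in> F \<Longrightarrow> \<phi> u (\<phi> (inv u) a) = a"
proof -
  obtain \<phi> where \<phi>: "\<forall>u\<in>F. \<forall>v\<in>F. \<phi> (u \<otimes> v) = \<phi> u \<circ> \<phi> v" "\<phi> \<one> = id" "\<forall>b\<in>B. \<phi> b = f b"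
    using free assms unfolding free_basis_def by blast
  have 1: "\<phi> (u \<otimes> v) a = \<phi> u (\<phi> v a)" if "u \<in> F" "v \<in> F" for u v a using \<phi>(1) that by simp
  have 2: "\<phi> (inv u) (\<phi> u a) = a" "\<phi> u (\<phi> (inv u) a) = a" if u: "u \<in> F" for u a
    using 1[OF subgroup.m_inv_closed[OF F u] u, of a] 1[OF u subgroup.m_inv_closed[OF F u], of a]
      u Fc \<phi>(2) by (auto simp: subset_iff)
  show thesis by (rule that[of \<phi>]) (use 1 2 \<phi> in auto)
qed

definition expo :: "'a \<Rightarrow> 'a \<Rightarrow> int" where
  "expo x = (SOME e. e \<in> hom (G\<lparr>carrier := F\<rparr>) integer_group \<and> (\<forall>y\<in>B. e y = (if y = x then 1 else 0)))"

text \<open>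
  Let \<open>x\<close> translate by one and every other basis element act trivially.
\<close>

lemma expo:
  assumes x: "x \<in> B"
  shows expo_hom: "expo x \<in> hom (G\<lparr>carrier := F\<rparr>) integer_group"
    and expo_basis: "y \<in> B \<Longrightarrow> expo x y = (if y = x then 1 else 0)"
proof -
  let ?f = "\<lambda>b n. if b = x then n + 1 else (n::int)"
  have "bij (?f b)" for b
    by (rule bij_betw_byWitness[where f' = "\<lambda>n. if b = x then n - 1 else n"]) auto
  then obtain \<phi> where \<phi>: "\<And>u v a. u \<in> F \<Longrightarrow> v \<in> F \<Longrightarrow> \<phi> (u \<otimes> v) a = \<phi> u (\<phi> v a)"
    "\<And>a. \<phi> \<one> a = a" "\<And>b. b \<in> B \<Longrightarrow> \<phi> b = ?f b"
    "\<And>u a. u \<in> F \<Longrightarrow> \<phi> (inv u) (\<phi> u a) = a"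
    by (rule extend_to_permutations[of ?f]) blast
  have tr: "\<exists>c. \<forall>n. \<phi> u n = n + c" if "u \<in> F" for u
    using that
  proof (induction rule: generate.induct)
    case one
    then show ?case using \<phi>(2) by (intro exI[of _ 0]) simp
  next
    case (incl h)
    then show ?case using \<phi>(3) by (intro exI[of _ "if h = x then 1 else 0"]) simp
  next
    case (inv h)
    have "\<phi> (inv h) n = n - (if h = x then 1 else 0)" for n
      using \<phi>(4)[OF BF[OF inv], of "n - (if h = x then 1 else 0)"] \<phi>(3)[OF inv]
      by (cases "h = x") simp_all
    then show ?case by (intro exI[of _ "- (if h = x then 1 else 0)"]) simp
  next
    case (eng h1 h2)
    then obtain c d where "\<forall>n. \<phi> h1 n = n + c" "\<forall>n. \<phi> h2 n = n + d" by blast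
    then show ?case using \<phi>(1)[OF eng.hyps] by (intro exI[of _ "c + d"]) simp
  qed
  define e where "e u = \<phi> u 0" for u
  have e: "\<phi> u n = n + e u" if u: "u \<in> F" for u n
  proof -
    obtain c where "\<forall>n. \<phi> u n = n + c" using tr[OF u] by blast
    then show ?thesis by (simp add: e_def)
  qed
  have "e (u \<otimes> v) = e u + e v" if "u \<in> F" "v \<in> F" for u v
    using \<phi>(1)[OF that, of 0] e[OF that(1), of "\<phi> v 0"] by (simp add: e_def)
  then have "e \<in> hom (G\<lparr>carrier := F\<rparr>) integer_group" by (simp add: int_hom_iff)
  moreover have "\<forall>y\<in>B. e y = (if y = x then 1 else 0)" using \<phi>(3) by (simp add: e_def)
  ultimately have ex: "\<exists>e. e \<in> hom (G\<lparr>carrier := F\<rparr>) integer_group \<and> (\<forall>y\<in>B. e y = (if y = x then 1 else 0))"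
    by (intro exI[of _ e]) simp
  from someI_ex[OF ex] have "expo x \<in> hom (G\<lparr>carrier := F\<rparr>) integer_group \<and>
      (\<forall>y\<in>B. expo x y = (if y = x then 1 else 0))"
    unfolding expo_def[symmetric] .
  then show "expo x \<in> hom (G\<lparr>carrier := F\<rparr>) integer_group"
    "y \<in> B \<Longrightarrow> expo x y = (if y = x then 1 else 0)" by simp_all
qed

lemma expo_mult: "x \<in> B \<Longrightarrow> u \<in> F \<Longrightarrow> v \<in> F \<Longrightarrow> expo x (u \<otimes> v) = expo x u + expo x v"
  using expo_hom by (simp add: int_hom_iff)

lemmas expo_inv = int_hom_inv[OF F expo_hom]
lemmas expo_pow = int_hom_pow[OF F expo_hom]
lemmas expo_one = int_hom_one[OF F expo_hom]

text \<open>
  In a free group the centralizer of a basis element \<open>y\<close> is generated by \<open>y\<close>.  Only the exponent of \<open>x\<close> is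
  at stake, and one permutation action decides it: \<open>x\<close> moves the blocks \<open>{2 m, 2 m + 1}\<close> one
  step to the right and \<open>y\<close> swaps the two points of the block \<open>{0, 1}\<close>.  If the exponent is not zero, then
  \<open>c\<close> moves this block to one that \<open>y\<close> fixes pointwise, so \<open>c\<close> and \<open>y\<close> do not commute.
\<close>

lemma expo_commuting:
  assumes x: "x \<in> B" and y: "y \<in> B" "y \<noteq> x" and c: "c \<in> F" and comm: "c \<otimes> y = y \<otimes> c"
  shows "expo x c = 0"
proof (rule ccontr)
  assume nz: "expo x c \<noteq> 0"
  let ?f = "\<lambda>b n. if b = x then n + 2 else if b = y then transpose 0 1 n else (n::int)"
  have "bij (?f b)" for b
    by (rule bij_betw_byWitness[where
          f' = "\<lambda>n. if b = x then n - 2 else if b = y then transpose 0 1 n else n"])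
      (use y in auto)
  then obtain \<phi> where \<phi>: "\<And>u v a. u \<in> F \<Longrightarrow> v \<in> F \<Longrightarrow> \<phi> (u \<otimes> v) a = \<phi> u (\<phi> v a)"
    "\<And>a. \<phi> \<one> a = a" "\<And>b. b \<in> B \<Longrightarrow> \<phi> b = ?f b"
    "\<And>u a. u \<in> F \<Longrightarrow> \<phi> u (\<phi> (inv u) a) = a"
    by (rule extend_to_permutations[of ?f]) blast
  have gen: "?f b n div 2 = n div 2 + (if b = x then 1 else 0)" for b and n :: int
    by (auto simp: transpose_def)
  have blk: "\<phi> u n div 2 = n div 2 + expo x u" if "u \<in> F" for u n
    using that
  proof (induction arbitrary: n rule: generate.induct)
    case one
    then show ?case using \<phi>(2) expo_one[OF x] by simp
  next
    case (incl h)
    then show ?case using \<phi>(3) gen expo_basis[OF x] by simp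
  next
    case (inv h)
    have "n = ?f h (\<phi> (inv h) n)" using \<phi>(4)[OF BF[OF inv], of n] \<phi>(3)[OF inv] by simp
    then have "n div 2 = \<phi> (inv h) n div 2 + (if h = x then 1 else 0)"
      using gen[of h "\<phi> (inv h) n"] by simp
    then show ?case using expo_inv[OF x BF[OF inv]] expo_basis[OF x inv] by simp
  next
    case (eng h1 h2)
    show ?case
      using eng.IH(1)[of "\<phi> h2 n"] eng.IH(2)[of n] \<phi>(1)[OF eng.hyps, of n] expo_mult[OF x eng.hyps]
      by simp
  qed
  have fy: "\<phi> y = ?f y" by (rule \<phi>(3)[OF y(1)])
  have "\<phi> c 0 div 2 \<noteq> 0" using blk[OF c, of 0] nz by simp
  then have "\<phi> c 0 \<noteq> 0" "\<phi> c 0 \<noteq> 1" by auto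
  then have "\<phi> y (\<phi> c 0) = \<phi> c 0" using fy y by (auto simp: transpose_def)
  moreover have "\<phi> c (\<phi> y 0) = \<phi> y (\<phi> c 0)"
    using comm \<phi>(1)[OF c BF[OF y(1)], of 0] \<phi>(1)[OF BF[OF y(1)] c, of 0] by simp
  moreover have "\<phi> y 0 = 1" using fy y by simp
  ultimately have eq: "\<phi> c 1 = \<phi> c 0" by simp
  have "\<phi> (inv c) (\<phi> c a) = a" for a
    using \<phi>(1)[OF subgroup.m_inv_closed[OF F c] c, of a] \<phi>(2) c Fc by (simp add: subset_iff)
  from this[of 1] this[of 0] eq show False by simp
qed

lemma F_conj: "g \<in> K \<Longrightarrow> x \<in> B \<Longrightarrow> u \<in> F \<Longrightarrow> g \<otimes> u \<otimes> inv g \<in> F \<and> expo x (g \<otimes> u \<otimes> inv g) = expo x u"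
proof -
  assume g: "g \<in> K" and x: "x \<in> B" and "u \<in> F"
  have gc: "g \<in> carrier G" using g Kc by blast
  have base: "g \<otimes> b \<otimes> inv g \<in> F \<and> expo x (g \<otimes> b \<otimes> inv g) = expo x b" if b: "b \<in> B" for b
  proof -
    obtain h where h: "h \<in> F" "g \<otimes> b \<otimes> inv g = h \<otimes> b \<otimes> inv h" using conj[OF g b] by blast
    have i: "inv h \<in> F" "h \<otimes> b \<in> F"
      using subgroup.m_inv_closed[OF F h(1)] subgroup.m_closed[OF F h(1) BF[OF b]] .
    have "expo x (h \<otimes> b \<otimes> inv h) = expo x b"
      using expo_mult[OF x i(2,1)] expo_mult[OF x h(1) BF[OF b]] expo_inv[OF x h(1)] by simp
    then show ?thesis using h(2) subgroup.m_closed[OF F i(2,1)] by simp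
  qed
  show ?thesis using \<open>u \<in> F\<close>
  proof (induction rule: generate.induct)
    case one
    have "g \<otimes> \<one> \<otimes> inv g = \<one>" using gc by simp
    then show ?case using subgroup.one_closed[OF F] by simp
  next
    case (incl h)
    then show ?case by (rule base)
  next
    case (inv h)
    have hc: "h \<in> carrier G" using inv Bc by blast
    have "g \<otimes> inv h \<otimes> inv g = inv (g \<otimes> h \<otimes> inv g)" using gc hc by (simp add: group_normalize)
    then show ?case
      using base[OF inv] subgroup.m_inv_closed[OF F] expo_inv[OF x] BF[OF inv] by simp
  next
    case (eng h1 h2)
    have hc: "h1 \<in> carrier G" "h2 \<in> carrier G" using eng.hyps Fc by auto
    show ?case
      using eng.IH conj_mult_distrib[OF gc hc] subgroup.m_closed[OF F] expo_mult[OF x] eng.hyps by simp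
  qed
qed

text \<open>
  The exponent of \<open>x\<close> in the conjugator that \<open>g\<close> applies to \<open>y\<close>.  For pure braids it is an
  integer combination of linking numbers of strands.
\<close>

definition twist :: "'a \<Rightarrow> 'a \<Rightarrow> 'a \<Rightarrow> int" where
  "twist x y g = expo x (SOME h. h \<in> F \<and> g \<otimes> y \<otimes> inv g = h \<otimes> y \<otimes> inv h)"

text \<open>
  Two conjugators of \<open>y\<close> differ by an element of its centralizer.
\<close>

lemma twist_eq:
  assumes x: "x \<in> B" and y: "y \<in> B" "y \<noteq> x" and h: "h \<in> F" "g \<otimes> y \<otimes> inv g = h \<otimes> y \<otimes> inv h"
  shows "twist x y g = expo x h"
proof -
  let ?P = "\<lambda>h. h \<in> F \<and> g \<otimes> y \<otimes> inv g = h \<otimes> y \<otimes> inv h"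
  define h' where "h' = (SOME h. ?P h)"
  have "?P h'" unfolding h'_def by (rule someI[of ?P h]) (use h in simp)
  then have h': "h' \<in> F" "h \<otimes> y \<otimes> inv h = h' \<otimes> y \<otimes> inv h'" using h by auto
  have c: "h \<in> carrier G" "h' \<in> carrier G" "y \<in> carrier G" using h(1) h'(1) y(1) Fc Bc by auto
  have i: "inv h' \<in> F" by (rule subgroup.m_inv_closed[OF F h'(1)])
  have "expo x (inv h' \<otimes> h) = 0"
    by (rule expo_commuting[OF x y subgroup.m_closed[OF F i h(1)] conj_eq_imp_commute[OF c h'(2)]])
  then have "expo x h = expo x h'" using expo_mult[OF x i h(1)] expo_inv[OF x h'(1)] by simp
  then show ?thesis by (simp add: twist_def h'_def)
qed

lemma twist_F:
  assumes "x \<in> B" "y \<in> B" "y \<noteq> x" "u \<in> F" shows "twist x y u = expo x u"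
  using twist_eq[OF assms] by simp

lemma twist_hom:
  assumes x: "x \<in> B" and y: "y \<in> B" "y \<noteq> x"
  shows "twist x y \<in> hom (G\<lparr>carrier := K\<rparr>) integer_group"
  unfolding int_hom_iff
proof (intro ballI)
  fix g1 g2 assume g: "g1 \<in> K" "g2 \<in> K"
  obtain h1 where h1: "h1 \<in> F" "g1 \<otimes> y \<otimes> inv g1 = h1 \<otimes> y \<otimes> inv h1" using conj[OF g(1) y(1)] by blast
  obtain h2 where h2: "h2 \<in> F" "g2 \<otimes> y \<otimes> inv g2 = h2 \<otimes> y \<otimes> inv h2" using conj[OF g(2) y(1)] by blast
  have c: "g1 \<in> carrier G" "g2 \<in> carrier G" "h1 \<in> carrier G" "h2 \<in> carrier G" "y \<in> carrier G"
    using g h1(1) h2(1) y(1) Kc Fc Bc by auto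
  let ?h = "(g1 \<otimes> h2 \<otimes> inv g1) \<otimes> h1"
  note k = F_conj[OF g(1) x h2(1)]
  have "(g1 \<otimes> g2) \<otimes> y \<otimes> inv (g1 \<otimes> g2) = g1 \<otimes> (g2 \<otimes> y \<otimes> inv g2) \<otimes> inv g1"
    using c by (simp add: group_normalize)
  also have "\<dots> = (g1 \<otimes> h2 \<otimes> inv g1) \<otimes> (g1 \<otimes> y \<otimes> inv g1) \<otimes> inv (g1 \<otimes> h2 \<otimes> inv g1)"
    unfolding h2(2) using c by (simp add: group_normalize)
  also have "\<dots> = ?h \<otimes> y \<otimes> inv ?h"
    unfolding h1(2) using c by (simp add: group_normalize)
  finally have "twist x y (g1 \<otimes> g2) = expo x ?h"
    using twist_eq[OF x y] k h1(1) subgroup.m_closed[OF F] by blast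
  also have "\<dots> = expo x h2 + expo x h1" using expo_mult[OF x] k h1(1) by simp
  finally show "twist x y (g1 \<otimes> g2) = twist x y g1 + twist x y g2"
    using twist_eq[OF x y h1] twist_eq[OF x y h2] by simp
qed

end

section \<open>Cyclic coverings branched over one basis element\<close>

lemma residue_decomp:
  fixes p a r :: int
  assumes "0 \<le> r" "r < p"
  shows "(p * a + r) div p = a" "(p * a + r) mod p = r"
  using assms by (simp_all add: div_pos_pos_trivial)

context conjugated_basis
begin

text \<open>
  The Schreier basis of the kernel of the exponent of \<open>x\<close> modulo \<open>p\<close>, for the transversal of the powers
  \<open>x\<^sup>k\<close> with \<open>0 \<le> k < p\<close>.
\<close>

definition cover_basis :: "nat \<Rightarrow> 'a \<Rightarrow> 'a set" where
  "cover_basis p x =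
    insert (x [^] p) {x [^] k \<otimes> y \<otimes> inv (x [^] k) | k y. k < p \<and> y \<in> B \<and> y \<noteq> x}"

definition cover_group :: "nat \<Rightarrow> 'a \<Rightarrow> 'a set" where
  "cover_group p x = {g \<in> K. \<forall>y\<in>B - {x}. int p dvd twist x y g}"

context
  fixes p :: nat and x :: 'a
  assumes p: "2 \<le> p" and x: "x \<in> B"
begin

abbreviation "B' \<equiv> cover_basis p x"
abbreviation "K' \<equiv> cover_group p x"
abbreviation "F' \<equiv> generate G B'"

lemma xc: "x \<in> carrier G" using x Bc by blast
lemma xpF: "x [^] (k::nat) \<in> F" by (rule subgroup_nat_pow[OF F BF[OF x]])

lemma cover_basis_cases:
  assumes "b \<in> B'"
  obtains "b = x [^] p"
  | k y where "k < p" "y \<in> B" "y \<noteq> x" "b = x [^] k \<otimes> y \<otimes> inv (x [^] k)"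
  using assms by (auto simp: cover_basis_def)

lemma cover_basis_pow: "x [^] p \<in> B'" by (simp add: cover_basis_def)

lemma cover_basis_conj:
  "k < p \<Longrightarrow> y \<in> B \<Longrightarrow> y \<noteq> x \<Longrightarrow> x [^] k \<otimes> y \<otimes> inv (x [^] k) \<in> B'"
  unfolding cover_basis_def by blast

lemma B'F: "B' \<subseteq> F"
proof
  fix b assume "b \<in> B'"
  then show "b \<in> F"
  proof (cases rule: cover_basis_cases)
    case 1
    then show ?thesis using xpF by simp
  next
    case (2 k y)
    then show ?thesis
      using subgroup.m_closed[OF F subgroup.m_closed[OF F xpF BF[OF 2(2)]] subgroup.m_inv_closed[OF F xpF]]
      by simp
  qed
qed

lemma B'c: "B' \<subseteq> carrier G" using B'F Fc by blast
lemma F': "subgroup F' G" by (rule generate_is_subgroup[OF B'c])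
lemma F'F: "F' \<subseteq> F" by (rule generate_subgroup_incl[OF B'F F])

lemma expo_cover:
  assumes "u \<in> F'" shows "int p dvd expo x u"
proof -
  have base: "int p dvd expo x b" if "b \<in> B'" for b
    using that
  proof (cases rule: cover_basis_cases)
    case 1
    then show ?thesis using expo_pow[OF x BF[OF x], of p] expo_basis[OF x x] by simp
  next
    case (2 k y)
    have "expo x b = 0"
      unfolding 2(4)
      using expo_mult[OF x subgroup.m_closed[OF F xpF BF[OF 2(2)]] subgroup.m_inv_closed[OF F xpF], of k k]
        expo_mult[OF x xpF BF[OF 2(2)], of k] expo_inv[OF x xpF, of k] expo_basis[OF x 2(2)] 2(3) by simp
    then show ?thesis by simp
  qed
  show ?thesis using assms
  proof (induction rule: generate.induct)
    case one
    then show ?case using expo_one[OF x] by simp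
  next
    case (incl b)
    then show ?case by (rule base)
  next
    case (inv b)
    have "b \<in> F" using inv B'F by blast
    then show ?case using expo_inv[OF x] base[OF inv] by simp
  next
    case (eng h1 h2)
    have "h1 \<in> F" "h2 \<in> F" using eng.hyps F'F by auto
    then show ?case using expo_mult[OF x] eng.IH by simp
  qed
qed

text \<open>
  Read the word from left to right and keep track of the coset \<open>x\<^sup>k\<close>.  Each letter contributes at
  most one element of the new basis: a letter \<open>y \<noteq> x\<close> contributes \<open>x\<^sup>k y x\<^sup>-\<^sup>k\<close>, and a letter \<open>x\<close>
  contributes \<open>x\<^sup>p\<close> when \<open>k\<close> wraps around and nothing otherwise.
\<close>

lemma schreier_rewriting:
  assumes "spelled G B n v" "k < p"
  shows "\<exists>l<p. spelled G B' n (x [^] k \<otimes> v \<otimes> inv (x [^] l))"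
  using assms
proof (induction arbitrary: k rule: spelled.induct)
  case (spelled_one n)
  have "x [^] k \<otimes> \<one> \<otimes> inv (x [^] k) = \<one>" using xc by simp
  then show ?case using spelled_one.prems spelled.spelled_one[of G B' n] by (intro exI[of _ k]) simp
next
  case (spelled_pos y n u)
  have c: "y \<in> carrier G" "u \<in> carrier G"
    using spelled_pos.hyps Bc spelled_carrier[OF Bc] by auto
  show ?case
  proof (cases "y = x")
    case False
    obtain l where l: "l < p" "spelled G B' n (x [^] k \<otimes> u \<otimes> inv (x [^] l))"
      using spelled_pos.IH[OF spelled_pos.prems] by blast
    have "x [^] k \<otimes> (y \<otimes> u) \<otimes> inv (x [^] l) =
        (x [^] k \<otimes> y \<otimes> inv (x [^] k)) \<otimes> (x [^] k \<otimes> u \<otimes> inv (x [^] l))"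
      using c xc by (simp add: group_normalize)
    then show ?thesis
      using spelled.spelled_pos[OF cover_basis_conj[OF spelled_pos.prems spelled_pos.hyps(1) False] l(2)] l(1)
      by auto
  next
    case True
    show ?thesis
    proof (cases "Suc k < p")
      case lt: True
      obtain l where l: "l < p" "spelled G B' n (x [^] Suc k \<otimes> u \<otimes> inv (x [^] l))"
        using spelled_pos.IH[OF lt] by blast
      have "x [^] k \<otimes> (y \<otimes> u) \<otimes> inv (x [^] l) = x [^] Suc k \<otimes> u \<otimes> inv (x [^] l)"
        using c xc True by (simp add: m_assoc)
      then show ?thesis using l spelled_mono[OF l(2), of "Suc n"] by auto
    next
      case False
      then have k: "p = Suc k" using spelled_pos.prems by simp
      obtain l where l: "l < p" "spelled G B' n (x [^] (0::nat) \<otimes> u \<otimes> inv (x [^] l))"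
        using spelled_pos.IH[of 0] p by auto
      have "x [^] k \<otimes> (y \<otimes> u) \<otimes> inv (x [^] l) = x [^] p \<otimes> (x [^] (0::nat) \<otimes> u \<otimes> inv (x [^] l))"
        using c xc True k by (simp add: m_assoc)
      then show ?thesis using l(1) spelled.spelled_pos[OF cover_basis_pow l(2)] by auto
    qed
  qed
next
  case (spelled_neg y n u)
  have c: "y \<in> carrier G" "u \<in> carrier G"
    using spelled_neg.hyps Bc spelled_carrier[OF Bc] by auto
  show ?case
  proof (cases "y = x")
    case False
    obtain l where l: "l < p" "spelled G B' n (x [^] k \<otimes> u \<otimes> inv (x [^] l))"
      using spelled_neg.IH[OF spelled_neg.prems] by blast
    have "x [^] k \<otimes> (inv y \<otimes> u) \<otimes> inv (x [^] l) =
        inv (x [^] k \<otimes> y \<otimes> inv (x [^] k)) \<otimes> (x [^] k \<otimes> u \<otimes> inv (x [^] l))"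
      using c xc by (simp add: group_normalize)
    then show ?thesis
      using spelled.spelled_neg[OF cover_basis_conj[OF spelled_neg.prems spelled_neg.hyps(1) False] l(2)] l(1)
      by auto
  next
    case True
    show ?thesis
    proof (cases k)
      case (Suc j)
      obtain l where l: "l < p" "spelled G B' n (x [^] j \<otimes> u \<otimes> inv (x [^] l))"
        using spelled_neg.IH[of j] spelled_neg.prems Suc by auto
      have "x [^] k \<otimes> (inv y \<otimes> u) \<otimes> inv (x [^] l) = x [^] j \<otimes> u \<otimes> inv (x [^] l)"
        using c xc True Suc by (simp add: group_normalize)
      then show ?thesis using l spelled_mono[OF l(2), of "Suc n"] by auto
    next
      case 0
      obtain l where l: "l < p" "spelled G B' n (x [^] (p - 1) \<otimes> u \<otimes> inv (x [^] l))"
        using spelled_neg.IH[of "p - 1"] p by auto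
      have "x [^] p = x [^] (p - 1) \<otimes> x"
        using p by (metis Suc_diff_1 nat_pow_Suc not_numeral_le_zero not_gr_zero)
      then have "x [^] k \<otimes> (inv y \<otimes> u) \<otimes> inv (x [^] l) =
          inv (x [^] p) \<otimes> (x [^] (p - 1) \<otimes> u \<otimes> inv (x [^] l))"
        using c xc True 0 by (simp add: group_normalize)
      then show ?thesis using l(1) spelled.spelled_neg[OF cover_basis_pow l(2)] by auto
    qed
  qed
qed

lemma cover_coset:
  assumes u: "u \<in> F"
  obtains l where "l < p" "u \<otimes> inv (x [^] l) \<in> F'" "int p dvd expo x u - int l"
proof -
  obtain n where "spelled G B n u" using generate_spelled[OF Bc u] by blast
  then obtain l where l: "l < p" "spelled G B' n (x [^] (0::nat) \<otimes> u \<otimes> inv (x [^] l))"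
    using schreier_rewriting[of n u 0] p by auto
  have uc: "u \<in> carrier G" using u Fc by blast
  have in': "u \<otimes> inv (x [^] l) \<in> F'" using spelled_generate[OF l(2)] uc by simp
  have "expo x (u \<otimes> inv (x [^] l)) = expo x u - int l"
    using expo_mult[OF x u subgroup.m_inv_closed[OF F xpF]] expo_inv[OF x xpF, of l]
      expo_pow[OF x BF[OF x], of l] expo_basis[OF x x] by simp
  then show thesis using that[OF l(1) in'] expo_cover[OF in'] by simp
qed

text \<open>
  The descent: the letter \<open>x\<close> at the front is absorbed by starting the rewriting in the coset of
  \<open>x\<close>, which is possible because \<open>1 < p\<close>.
\<close>

lemma cover_spelled:
  assumes u: "spelled G B n u" and e: "int p dvd expo x (x \<otimes> u)"
  shows "spelled G B' n (x \<otimes> u)"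
proof -
  obtain l where l: "l < p" "spelled G B' n (x [^] (1::nat) \<otimes> u \<otimes> inv (x [^] l))"
    using schreier_rewriting[OF u, of 1] p by auto
  have uF: "u \<in> F" by (rule spelled_generate[OF u])
  have xu: "x \<otimes> u \<in> F" by (rule subgroup.m_closed[OF F BF[OF x] uF])
  have s: "spelled G B' n (x \<otimes> u \<otimes> inv (x [^] l))" using l(2) xc by simp
  have "expo x (x \<otimes> u \<otimes> inv (x [^] l)) = expo x (x \<otimes> u) - int l"
    using expo_mult[OF x xu subgroup.m_inv_closed[OF F xpF]] expo_inv[OF x xpF, of l]
      expo_pow[OF x BF[OF x], of l] expo_basis[OF x x] by simp
  then have "int p dvd int l" using e expo_cover[OF spelled_generate[OF s]] by (simp add: dvd_diff_right_iff)
  then have "l = 0" using l(1) by (auto dest: zdvd_imp_le)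
  then show ?thesis using s xu Fc by (auto simp: subset_iff)
qed

lemma K'K: "K' \<subseteq> K" by (auto simp: cover_group_def)

lemma K': "subgroup K' G"
proof (rule subgroupI)
  show "K' \<subseteq> carrier G" using K'K Kc by blast
  have "twist x y \<one> = 0" if "y \<in> B - {x}" for y
    using int_hom_one[OF K twist_hom[OF x, of y]] that by simp
  then have "\<one> \<in> K'" using subgroup.one_closed[OF K] by (simp add: cover_group_def)
  then show "K' \<noteq> {}" by blast
next
  fix a assume a: "a \<in> K'"
  then have aK: "a \<in> K" using K'K by blast
  have "twist x y (inv a) = - twist x y a" if "y \<in> B - {x}" for y
    using int_hom_inv[OF K twist_hom[OF x, of y] aK] that by simp
  then show "inv a \<in> K'" using a subgroup.m_inv_closed[OF K aK] by (simp add: cover_group_def)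
next
  fix a b assume ab: "a \<in> K'" "b \<in> K'"
  then have abK: "a \<in> K" "b \<in> K" using K'K by blast+
  have "twist x y (a \<otimes> b) = twist x y a + twist x y b" if "y \<in> B - {x}" for y
    using twist_hom[OF x, of y] that abK by (simp add: int_hom_iff)
  then show "a \<otimes> b \<in> K'" using ab subgroup.m_closed[OF K abK] by (simp add: cover_group_def)
qed

lemma rat_core_subset_cover_group: "rat_core p G K \<subseteq> K'"
proof
  fix g assume g: "g \<in> rat_core p G K"
  have "g \<in> K" using g rat_core_subset[of p G K] by blast
  moreover have "int p dvd twist x y g" if "y \<in> B - {x}" for y
    using g twist_hom[OF x, of y] that by (simp add: rat_core_def)
  ultimately show "g \<in> K'" by (simp add: cover_group_def)
qed

text \<open>
  Every twist extends the exponent of \<open>x\<close>; the element \<open>y \<noteq> x\<close> of the basis provides at least one twist.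
\<close>

lemma cover_group_F:
  assumes "u \<in> F" shows "u \<in> K' \<longleftrightarrow> int p dvd expo x u"
proof -
  have t: "twist x y u = expo x u" if "y \<in> B - {x}" for y using twist_F[OF x] that assms by simp
  obtain y where "y \<in> B - {x}" using another[OF x] by blast
  then show ?thesis using t assms FK by (auto simp: cover_group_def)
qed

lemma B'K': "B' \<subseteq> K'"
  using cover_group_F B'F expo_cover generate.incl[of _ B' G] by blast

text \<open>
  If \<open>g y g\<^sup>-\<^sup>1 = h y h\<^sup>-\<^sup>1\<close>, then \<open>g\<close> carries \<open>x\<^sup>k y x\<^sup>-\<^sup>k\<close> to \<open>u y u\<^sup>-\<^sup>1\<close> with
  \<open>u = (g x\<^sup>k g\<^sup>-\<^sup>1) h\<close>, whose exponent of \<open>x\<close> is \<open>k\<close> plus the twist.  In general \<open>g\<close>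
  thus permutes the new basis up to conjugation by a cyclic shift of \<open>k\<close>; elements of \<open>K'\<close> have
  twist divisible by \<open>p\<close> and fix each conjugacy class.
\<close>

lemma cover_conj:
  assumes g: "g \<in> K'" and b: "b \<in> B'"
  shows "\<exists>h\<in>F'. g \<otimes> b \<otimes> inv g = h \<otimes> b \<otimes> inv h"
proof -
  have gK: "g \<in> K" using g K'K by blast
  have gc: "g \<in> carrier G" using gK Kc by blast
  obtain h where h: "h \<in> F" "g \<otimes> x \<otimes> inv g = h \<otimes> x \<otimes> inv h" using conj[OF gK x] by blast
  have hc: "h \<in> carrier G" using h(1) Fc by blast
  have pw: "g \<otimes> x [^] k \<otimes> inv g = h \<otimes> x [^] k \<otimes> inv h" for k :: nat
    using arg_cong[OF h(2), of "\<lambda>z. z [^] k"] unfolding conj_pow[OF gc xc] conj_pow[OF hc xc] .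
  show ?thesis
    using b
  proof (cases rule: cover_basis_cases)
    case b1: 1
    obtain l where "l < p" and l: "h \<otimes> inv (x [^] l) \<in> F'" and "int p dvd expo x h - int l"
      by (rule cover_coset[OF h(1)])
    have "inv (x [^] l) \<otimes> (x [^] p \<otimes> x [^] l) = x [^] p"
      using xc by (simp add: nat_pow_comm[of x p l] inv_cancel_left)
    then have 1: "h \<otimes> (inv (x [^] l) \<otimes> (x [^] p \<otimes> x [^] l)) \<otimes> inv h = h \<otimes> x [^] p \<otimes> inv h"
      by simp
    have 2: "(h \<otimes> inv (x [^] l)) \<otimes> x [^] p \<otimes> inv (h \<otimes> inv (x [^] l)) =
        h \<otimes> (inv (x [^] l) \<otimes> (x [^] p \<otimes> x [^] l)) \<otimes> inv h"
      using xc hc by (simp add: group_normalize)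
    show ?thesis using HOL.trans[OF 2 1] b1 l pw[of p] by (intro bexI[of _ "h \<otimes> inv (x [^] l)"]) simp
  next
    case (2 k y)
    obtain h1 where h1: "h1 \<in> F" "g \<otimes> y \<otimes> inv g = h1 \<otimes> y \<otimes> inv h1" using conj[OF gK 2(2)] by blast
    have c: "h1 \<in> carrier G" "y \<in> carrier G" using h1(1) 2(2) Fc Bc by auto
    let ?c = "g \<otimes> x [^] k \<otimes> inv g"
    have cF: "?c \<in> F" "expo x ?c = expo x (x [^] k)" using F_conj[OF gK x xpF] by auto
    define u where "u = ?c \<otimes> h1"
    have u: "u \<in> F" unfolding u_def by (rule subgroup.m_closed[OF F cF(1) h1(1)])
    have "expo x h1 = twist x y g" using twist_eq[OF x 2(2,3) h1] by simp
    then have e1: "int p dvd expo x h1" using g 2(2,3) by (simp add: cover_group_def)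
    have e2: "expo x u = int k + expo x h1"
      unfolding u_def using expo_mult[OF x cF(1) h1(1)] cF(2) expo_pow[OF x BF[OF x], of k] expo_basis[OF x x] by simp
    obtain l where l: "l < p" "u \<otimes> inv (x [^] l) \<in> F'" "int p dvd expo x u - int l"
      by (rule cover_coset[OF u])
    have "int p dvd int k - int l" using dvd_diff[OF l(3) e1] e2 by simp
    then have "int k mod int p = int l mod int p" by (simp add: mod_eq_dvd_iff)
    then have kl: "k = l" using 2(1) l(1) by simp
    let ?h = "u \<otimes> inv (x [^] k)"
    have uc: "u \<in> carrier G" using u Fc by blast
    have "g \<otimes> b \<otimes> inv g = ?c \<otimes> (g \<otimes> y \<otimes> inv g) \<otimes> inv ?c"
      unfolding 2(4) using gc c xc by (simp add: group_normalize)
    also have "\<dots> = u \<otimes> y \<otimes> inv u" unfolding h1(2) u_def using gc c xc by (simp add: group_normalize)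
    also have "\<dots> = ?h \<otimes> b \<otimes> inv ?h" unfolding 2(4) using uc c xc by (simp add: group_normalize)
    finally show ?thesis using l(2) kl by blast
  qed
qed

text \<open>
  Given permutations \<open>f' b\<close> for the new basis, induce an action of the old one: on the integers,
  seen as \<open>p\<close> levels \<open>p a + r\<close> with \<open>0 \<le> r < p\<close>, the element \<open>x\<close> goes down one level and applies \<open>f' (x\<^sup>p)\<close>
  when it passes from the bottom to the top, while \<open>y\<close> acts on level \<open>r\<close> by
  \<open>f' (x\<^sup>r y x\<^sup>-\<^sup>r)\<close>.  The subgroup generated by the new basis preserves level \<open>0\<close> and acts there as prescribed.
\<close>

lemma cover_free: "free_basis G B'"
  unfolding free_basis_def
proof (intro allI impI)
  fix f' :: "'a \<Rightarrow> int \<Rightarrow> int" assume f': "\<forall>b. bij (f' b)"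
  define P where "P = int p"
  have P: "P \<ge> 2" using p by (simp add: P_def)
  define w where "w y k = x [^] k \<otimes> y \<otimes> inv (x [^] k)" for y and k :: nat
  define f where "f b n = (if b = x then
      (if n mod P = 0 then P * f' (x [^] p) (n div P) + (P - 1) else n - 1)
    else P * f' (w b (nat (n mod P))) (n div P) + n mod P)" for b n
  define g where "g b n = (if b = x then
      (if n mod P = P - 1 then P * inv_into UNIV (f' (x [^] p)) (n div P) else n + 1)
    else P * inv_into UNIV (f' (w b (nat (n mod P)))) (n div P) + n mod P)" for b n
  have if': "inv_into UNIV (f' b) (f' b a) = a" "f' b (inv_into UNIV (f' b) a) = a" for b a
    using f' by (auto simp: bij_is_inj bij_is_surj surj_f_inv_f inv_f_f)
  have dec: "\<exists>a r. n = P * a + r \<and> 0 \<le> r \<and> r < P" for n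
    using P by (intro exI[of _ "n div P"] exI[of _ "n mod P"]) auto
  have fx0: "f x (P * a) = P * f' (x [^] p) a + (P - 1)" for a using P by (simp add: f_def)
  have fx: "f x (P * a + r) = P * a + (r - 1)" if "0 < r" "r < P" for a r
    using that residue_decomp[of r P a] by (simp add: f_def)
  have fy: "f y (P * a + r) = P * f' (w y (nat r)) a + r" if "y \<noteq> x" "0 \<le> r" "r < P" for y a r
    using that residue_decomp[of r P a] by (simp add: f_def)
  have gx0: "g x (P * a + (P - 1)) = P * inv_into UNIV (f' (x [^] p)) a" for a
    using P residue_decomp[of "P - 1" P a] by (simp add: g_def)
  have gx: "g x (P * a + r) = P * a + (r + 1)" if "0 \<le> r" "r < P - 1" for a r
    using that residue_decomp[of r P a] by (simp add: g_def)
  have gy: "g y (P * a + r) = P * inv_into UNIV (f' (w y (nat r))) a + r" if "y \<noteq> x" "0 \<le> r" "r < P" for y a r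
    using that residue_decomp[of r P a] by (simp add: g_def)
  (* g is the inverse of f; only x moves between levels. *)
  have gf: "g b (f b n) = n" for b n
  proof -
    obtain a r where r: "n = P * a + r" "0 \<le> r" "r < P" using dec by blast
    show ?thesis
    proof (cases "b = x")
      case True
      then show ?thesis
        using r fx0[of a] fx[of r a] gx0 gx[of "r - 1" a] if' by (cases "r = 0") auto
    next
      case False
      then show ?thesis using r fy[OF False, of r a] gy[OF False, of r] if' by simp
    qed
  qed
  have fg: "f b (g b n) = n" for b n
  proof -
    obtain a r where r: "n = P * a + r" "0 \<le> r" "r < P" using dec by blast
    show ?thesis
    proof (cases "b = x")
      case True
      then show ?thesis
        using r fx0 fx[of "r + 1" a] gx0[of a] gx[of r a] if' by (cases "r = P - 1") auto
    next
      case False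
      then show ?thesis using r fy[OF False, of r] gy[OF False, of r a] if' by simp
    qed
  qed
  have "bij (f b)" for b
    by (rule bij_betw_byWitness[where f' = "g b"]) (use gf fg in auto)
  then obtain \<phi> where \<phi>: "\<And>u v a. u \<in> F \<Longrightarrow> v \<in> F \<Longrightarrow> \<phi> (u \<otimes> v) a = \<phi> u (\<phi> v a)"
    "\<And>a. \<phi> \<one> a = a" "\<And>b. b \<in> B \<Longrightarrow> \<phi> b = f b"
    "\<And>u a. u \<in> F \<Longrightarrow> \<phi> (inv u) (\<phi> u a) = a" "\<And>u a. u \<in> F \<Longrightarrow> \<phi> u (\<phi> (inv u) a) = a"
    by (rule extend_to_permutations[of f]) blast
  have pow: "\<phi> (x [^] k) (P * a + int k) = P * a" if "k < p" for k :: nat and a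
    using that
  proof (induction k)
    case (Suc k)
    then have "\<phi> x (P * a + int (Suc k)) = P * a + int k"
      using fx[of "int (Suc k)" a] \<phi>(3)[OF x] by (simp add: P_def)
    then show ?case using \<phi>(1)[OF xpF BF[OF x], of k] Suc by simp
  qed (use \<phi>(2) in simp)
  have key: "\<phi> b (P * a) = P * f' b a" if b: "b \<in> B'" for b a
    using b
  proof (cases rule: cover_basis_cases)
    case 1
    have "x [^] p = x [^] (p - 1) \<otimes> x"
      using p by (metis Suc_diff_1 nat_pow_Suc not_numeral_le_zero not_gr_zero)
    then have "\<phi> (x [^] p) (P * a) = \<phi> (x [^] (p - 1)) (P * f' (x [^] p) a + (P - 1))"
      using \<phi>(1)[OF xpF BF[OF x], of "p - 1" "P * a"] \<phi>(3)[OF x] fx0 by simp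
    moreover have "P - 1 = int (p - 1)" using p by (simp add: P_def)
    ultimately show ?thesis using 1 pow[of "p - 1" "f' (x [^] p) a"] p by simp
  next
    case (2 k y)
    have i: "inv (x [^] k) \<in> F" "x [^] k \<otimes> y \<in> F"
      using subgroup.m_inv_closed[OF F xpF] subgroup.m_closed[OF F xpF BF[OF 2(2)]] .
    have "\<phi> (inv (x [^] k)) (P * a) = P * a + int k"
      using \<phi>(4)[OF xpF, of k "P * a + int k"] pow[OF 2(1), of a] by simp
    moreover have "\<phi> y (P * a + int k) = P * f' b a + int k"
      using \<phi>(3)[OF 2(2)] fy[OF 2(3), of "int k" a] 2(1,4) by (simp add: P_def w_def)
    ultimately show ?thesis
      using \<phi>(1)[OF i(2,1), of "P * a"] \<phi>(1)[OF xpF BF[OF 2(2)], of k "P * a + int k"]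
        pow[OF 2(1), of "f' b a"] 2(4) by simp
  qed
  define \<psi> where "\<psi> u a = \<phi> u (P * a) div P" for u a
  have \<psi>: "\<phi> u (P * a) = P * \<psi> u a" if u: "u \<in> F'" for u a
  proof -
    have "\<exists>c. \<phi> u (P * a) = P * c" using u
    proof (induction arbitrary: a rule: generate.induct)
      case (inv b)
      have "b \<in> F" using inv B'F by blast
      then have "\<phi> (inv b) (P * a) = P * inv_into UNIV (f' b) a"
        using key[OF inv, of "inv_into UNIV (f' b) a"] if' \<phi>(4)[of b "P * inv_into UNIV (f' b) a"] by simp
      then show ?case by blast
    next
      case (eng h1 h2)
      have "h1 \<in> F" "h2 \<in> F" using eng.hyps F'F by auto
      note m = \<phi>(1)[OF this, of "P * a"]
      obtain c where c: "\<phi> h2 (P * a) = P * c" using eng.IH(2) by blast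
      obtain d where "\<phi> h1 (P * c) = P * d" using eng.IH(1) by blast
      then show ?case using m c by auto
    qed (use key \<phi>(2) in auto)
    then show ?thesis using P by (auto simp: \<psi>_def)
  qed
  have "\<psi> (u \<otimes> v) = \<psi> u \<circ> \<psi> v" if uv: "u \<in> F'" "v \<in> F'" for u v
  proof
    fix a
    have "u \<in> F" "v \<in> F" using uv F'F by auto
    from \<phi>(1)[OF this, of "P * a"] have "P * \<psi> (u \<otimes> v) a = P * \<psi> u (\<psi> v a)"
      using \<psi>[OF uv(1)] \<psi>[OF uv(2)] \<psi>[OF subgroup.m_closed[OF F' uv]] by simp
    then show "\<psi> (u \<otimes> v) a = (\<psi> u \<circ> \<psi> v) a" using P by simp
  qed
  moreover have "\<psi> \<one> = id" using \<phi>(2) P by (auto simp: \<psi>_def)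
  moreover have "\<psi> b = f' b" if "b \<in> B'" for b
    using key[OF that] P by (auto simp: \<psi>_def)
  ultimately show "\<exists>\<psi>. (\<forall>u\<in>F'. \<forall>v\<in>F'. \<psi> (u \<otimes> v) = \<psi> u \<circ> \<psi> v) \<and> \<psi> \<one> = id \<and> (\<forall>b\<in>B'. \<psi> b = f' b)"
    by blast
qed

lemma cover_conjugated_basis: "conjugated_basis G K' B'"
  unfolding conjugated_basis_def conjugated_basis_axioms_def
proof (intro conjI allI impI)
  show "group G" by (rule is_group)
  show "subgroup K' G" by (rule K')
  show "B' \<subseteq> K'" by (rule B'K')
  show "free_basis G B'" by (rule cover_free)
  show "\<exists>h\<in>F'. g \<otimes> b \<otimes> inv g = h \<otimes> b \<otimes> inv h" if "g \<in> K'" "b \<in> B'" for g b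
    by (rule cover_conj[OF that])
  obtain y where y: "y \<in> B" "y \<noteq> x" using another[OF x] by blast
  have "x [^] (0::nat) \<otimes> y \<otimes> inv (x [^] (0::nat)) = y" using y(1) Bc by (auto simp: subset_iff)
  then have yB': "y \<in> B'" using cover_basis_conj[of 0 y] y p by simp
  have "expo x (x [^] p) = int p" using expo_pow[OF x BF[OF x], of p] expo_basis[OF x x] by simp
  then have "y \<noteq> x [^] p" using expo_basis[OF x y(1)] y(2) p by auto
  then show "\<exists>y\<in>B'. y \<noteq> b" if "b \<in> B'" for b
    using yB' cover_basis_pow by metis
qed

end

end

theorem conjugated_basis_residual:
  assumes p: "2 \<le> p"
  shows "conjugated_basis G K B \<Longrightarrow> spelled G B n u \<Longrightarrow> u \<in> rat_residual p G K \<Longrightarrow> u = \<one>\<^bsub>G\<^esub>"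
proof (induction n arbitrary: K B u)
  case 0
  then show ?case by (auto elim: spelled.cases)
next
  case (Suc n)
  interpret conjugated_basis G K B by (rule Suc.prems(1))
  have pos: "x \<otimes>\<^bsub>G\<^esub> v = \<one>\<^bsub>G\<^esub>"
    if x: "x \<in> B" and v: "spelled G B n v" and r: "x \<otimes>\<^bsub>G\<^esub> v \<in> rat_residual p G K" for x v
  proof (rule Suc.IH[OF cover_conjugated_basis[OF p x]])
    show r': "x \<otimes>\<^bsub>G\<^esub> v \<in> rat_residual p G (cover_group p x)"
      using rat_residual_between[OF rat_core_subset_cover_group[OF p x] K'K[OF p x]] r by blast
    then have "x \<otimes>\<^bsub>G\<^esub> v \<in> cover_group p x"
      using rat_residual_subset[of p G "cover_group p x"] by blast
    then have "int p dvd expo x (x \<otimes>\<^bsub>G\<^esub> v)"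
      using cover_group_F[OF p x] subgroup.m_closed[OF F BF[OF x] spelled_generate[OF v]] by blast
    then show "spelled G (cover_basis p x) n (x \<otimes>\<^bsub>G\<^esub> v)" by (rule cover_spelled[OF p x v])
  qed
  show ?case
    using Suc.prems(2)
  proof (cases rule: spelled.cases)
    case (spelled_pos x v)
    then show ?thesis using pos Suc.prems(3) by auto
  next
    case (spelled_neg x v)
    then have x: "x \<in> B" and v: "spelled G B n v" and u: "u = inv\<^bsub>G\<^esub> x \<otimes>\<^bsub>G\<^esub> v" by auto
    have c: "x \<in> carrier G" "v \<in> carrier G" using x Bc spelled_carrier[OF Bc v] by auto
    (* x u^-1 x^-1 also lies in the residual and has a word of the same length that begins with x *)
    have e: "x \<otimes>\<^bsub>G\<^esub> inv\<^bsub>G\<^esub> u \<otimes>\<^bsub>G\<^esub> inv\<^bsub>G\<^esub> x = x \<otimes>\<^bsub>G\<^esub> inv\<^bsub>G\<^esub> v"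
      unfolding u using c by (simp add: group_normalize)
    have "inv\<^bsub>G\<^esub> u \<in> rat_residual p G K"
      by (rule subgroup.m_inv_closed[OF subgroup_rat_residual[OF K] Suc.prems(3)])
    then have "x \<otimes>\<^bsub>G\<^esub> inv\<^bsub>G\<^esub> v \<in> rat_residual p G K"
      using rat_residual_conj[OF K, of x] x BK unfolding e[symmetric] by blast
    from pos[OF x spelled_inv[OF Bc v] this] have "x \<otimes>\<^bsub>G\<^esub> inv\<^bsub>G\<^esub> v = \<one>\<^bsub>G\<^esub>" .
    then have "x = v" using c by (metis inv_inv inv_equality inv_closed)
    then show ?thesis using u c by simp
  qed simp
qed

section \<open>Group identities behind the Artin action\<close>

context group
begin

text \<open>
  The braid relations force the action on loops.  Here \<open>s\<close>, \<open>s'\<close> are consecutive generators, \<open>t\<close>, \<open>t1\<close>, \<open>t2\<close>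
  consecutive tails and \<open>a\<close>, \<open>b\<close> the corresponding loops.  Multiplying both sides by a tail on the left
  replaces the loops by generators, so that no inverses occur.
\<close>

lemma artin_relations:
  assumes c: "s \<in> carrier G" "s' \<in> carrier G" "t \<in> carrier G" "t1 \<in> carrier G" "t2 \<in> carrier G"
      "a \<in> carrier G" "b \<in> carrier G"
    and t: "t = s \<otimes> t1" "t1 = s' \<otimes> t2" and ab: "t1 \<otimes> a = s \<otimes> t" "t2 \<otimes> b = s' \<otimes> t1"
    and comm: "s \<otimes> t2 = t2 \<otimes> s" "s' \<otimes> t = t \<otimes> s"
    and braid: "s \<otimes> (s' \<otimes> s) = s' \<otimes> (s \<otimes> s')"
  shows "s \<otimes> b = a \<otimes> s" "s \<otimes> (b \<otimes> a) = b \<otimes> (a \<otimes> s)"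
proof -
  have "t1 \<otimes> (s \<otimes> b) = s' \<otimes> ((t2 \<otimes> s) \<otimes> b)" using c unfolding t(2) by (simp add: m_assoc)
  also have "\<dots> = s' \<otimes> (s \<otimes> (t2 \<otimes> b))" using c unfolding comm(1)[symmetric] by (simp add: m_assoc)
  also have "\<dots> = (s' \<otimes> (s \<otimes> s')) \<otimes> t1" using c unfolding ab(2) by (simp add: m_assoc)
  also have "\<dots> = s \<otimes> (s' \<otimes> t)" using c unfolding braid[symmetric] t(1) by (simp add: m_assoc)
  also have "\<dots> = (s \<otimes> t) \<otimes> s" using c unfolding comm(2) by (simp add: m_assoc)
  also have "\<dots> = t1 \<otimes> (a \<otimes> s)" using c unfolding ab(1)[symmetric] by (simp add: m_assoc)
  finally show "s \<otimes> b = a \<otimes> s" using c by simp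
  have "t2 \<otimes> (s \<otimes> (b \<otimes> a)) = (t2 \<otimes> s) \<otimes> (b \<otimes> a)" using c by (simp add: m_assoc)
  also have "\<dots> = s \<otimes> ((t2 \<otimes> b) \<otimes> a)" using c unfolding comm(1)[symmetric] by (simp add: m_assoc)
  also have "\<dots> = s \<otimes> (s' \<otimes> (t1 \<otimes> a))" using c unfolding ab(2) by (simp add: m_assoc)
  also have "\<dots> = (s \<otimes> (s' \<otimes> s)) \<otimes> t" using c unfolding ab(1) by (simp add: m_assoc)
  also have "\<dots> = s' \<otimes> (s \<otimes> (s' \<otimes> t))" using c unfolding braid by (simp add: m_assoc)
  also have "\<dots> = s' \<otimes> ((s \<otimes> t) \<otimes> s)" using c unfolding comm(2) by (simp add: m_assoc)
  also have "\<dots> = (s' \<otimes> t1) \<otimes> (a \<otimes> s)" using c unfolding ab(1)[symmetric] by (simp add: m_assoc)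
  also have "\<dots> = t2 \<otimes> (b \<otimes> (a \<otimes> s))" using c unfolding ab(2)[symmetric] by (simp add: m_assoc)
  finally show "s \<otimes> (b \<otimes> a) = b \<otimes> (a \<otimes> s)" using c by simp
qed

lemma artin_commute:
  assumes c: "r \<in> carrier G" "r' \<in> carrier G" "s \<in> carrier G" "t \<in> carrier G" "t1 \<in> carrier G" "a \<in> carrier G"
    and a: "t1 \<otimes> a = s \<otimes> t"
    and comm: "r' \<otimes> t1 = t1 \<otimes> r" "r' \<otimes> t = t \<otimes> r" "r' \<otimes> s = s \<otimes> r'"
  shows "r \<otimes> a = a \<otimes> r"
proof -
  have "t1 \<otimes> (r \<otimes> a) = (t1 \<otimes> r) \<otimes> a" using c by (simp add: m_assoc)
  also have "\<dots> = r' \<otimes> (t1 \<otimes> a)" using c unfolding comm(1)[symmetric] by (simp add: m_assoc)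
  also have "\<dots> = (r' \<otimes> s) \<otimes> t" using c unfolding a by (simp add: m_assoc)
  also have "\<dots> = s \<otimes> (r' \<otimes> t)" using c unfolding comm(3) by (simp add: m_assoc)
  also have "\<dots> = (s \<otimes> t) \<otimes> r" using c unfolding comm(2) by (simp add: m_assoc)
  also have "\<dots> = t1 \<otimes> (a \<otimes> r)" using c unfolding a[symmetric] by (simp add: m_assoc)
  finally show ?thesis using c by simp
qed

lemma conj_of_commute:
  assumes "r \<in> carrier G" "a \<in> carrier G" "b \<in> carrier G" "r \<otimes> a = b \<otimes> r"
  shows "r \<otimes> a \<otimes> inv r = b" "inv r \<otimes> b \<otimes> inv (inv r) = a"
proof -
  show "r \<otimes> a \<otimes> inv r = b" using assms by (simp add: m_assoc)
  have "inv r \<otimes> (b \<otimes> r) = a" unfolding assms(4)[symmetric] using assms(1-3) by (simp add: inv_cancel_left)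
  then show "inv r \<otimes> b \<otimes> inv (inv r) = a" using assms(1-3) by (simp add: m_assoc)
qed

lemma artin_conj:
  assumes c: "s \<in> carrier G" "a \<in> carrier G" "b \<in> carrier G"
    and r: "s \<otimes> b = a \<otimes> s" "s \<otimes> (b \<otimes> a) = b \<otimes> (a \<otimes> s)"
  shows "s \<otimes> b \<otimes> inv s = a" "s \<otimes> a \<otimes> inv s = inv a \<otimes> b \<otimes> inv (inv a)"
    "inv s \<otimes> a \<otimes> inv (inv s) = b" "inv s \<otimes> b \<otimes> inv (inv s) = b \<otimes> a \<otimes> inv b"
proof -
  show "s \<otimes> b \<otimes> inv s = a" "inv s \<otimes> a \<otimes> inv (inv s) = b"
    using conj_of_commute[OF c(1,3,2) r(1)] .
  have "a \<otimes> (s \<otimes> a) = (a \<otimes> s) \<otimes> a" using c by (simp add: m_assoc)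
  also have "\<dots> = s \<otimes> (b \<otimes> a)" unfolding r(1)[symmetric] using c by (simp add: m_assoc)
  also have "\<dots> = b \<otimes> (a \<otimes> s)" by (rule r(2))
  finally have "s \<otimes> a = inv a \<otimes> (b \<otimes> (a \<otimes> s))" using c by (simp add: inv_solve_left)
  then have 1: "s \<otimes> a = (inv a \<otimes> b \<otimes> inv (inv a)) \<otimes> s" using c by (simp add: m_assoc)
  show "s \<otimes> a \<otimes> inv s = inv a \<otimes> b \<otimes> inv (inv a)"
    by (rule conj_of_commute[OF c(1,2) _ 1]) (use c in simp)
  have "s \<otimes> (b \<otimes> a \<otimes> inv b) = (s \<otimes> (b \<otimes> a)) \<otimes> inv b" using c by (simp add: m_assoc)
  also have "\<dots> = b \<otimes> ((a \<otimes> s) \<otimes> inv b)" unfolding r(2) using c by (simp add: m_assoc)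
  also have "\<dots> = b \<otimes> s" unfolding r(1)[symmetric] using c by (simp add: m_assoc)
  finally have 2: "s \<otimes> (b \<otimes> a \<otimes> inv b) = b \<otimes> s" .
  show "inv s \<otimes> b \<otimes> inv (inv s) = b \<otimes> a \<otimes> inv b"
    by (rule conj_of_commute(2)[OF c(1) _ c(3) 2]) (use c in simp)
qed

lemma conj_generate:
  assumes B: "B \<subseteq> carrier G" and g: "g \<in> carrier G"
    and b: "\<And>b. b \<in> B \<Longrightarrow> g \<otimes> b \<otimes> inv g \<in> generate G B"
  shows "u \<in> generate G B \<Longrightarrow> g \<otimes> u \<otimes> inv g \<in> generate G B"
proof (induction rule: generate.induct)
  case one
  have "g \<otimes> \<one> \<otimes> inv g = \<one>" using g by simp
  then show ?case using generate.one[of G B] by simp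
next
  case (incl h)
  then show ?case by (rule b)
next
  case (inv h)
  have "h \<in> carrier G" using inv B by blast
  then have "g \<otimes> inv h \<otimes> inv g = inv (g \<otimes> h \<otimes> inv g)" using g by (simp add: group_normalize)
  then show ?case using generate_m_inv_closed[OF B b[OF inv]] by simp
next
  case (eng h1 h2)
  have "h1 \<in> carrier G" "h2 \<in> carrier G" using eng.hyps generate_in_carrier[OF B] by auto
  then show ?case using conj_mult_distrib[OF g] generate.eng[OF eng.IH] by simp
qed

end


section \<open>Deleting a strand\<close>

text \<open>
  Words act from the right end, so \<open>word_perm w k\<close> is the position of strand \<open>k\<close> when the next letter
  arrives.  The letter is dropped if it involves the strand, and renumbered if it lies beyond it.
\<close>

fun delete_strand :: "nat \<Rightarrow> braid_word \<Rightarrow> braid_word" where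
  "delete_strand k [] = []"
| "delete_strand k ((i, b) # w) =
    (if Suc i < word_perm w k then [(i, b)]
     else if word_perm w k < i then [(i - 1, b)] else []) @ delete_strand k w"

lemma word_perm_Nil [simp]: "word_perm [] k = k"
  by (simp add: word_perm_def)

lemma word_perm_Cons [simp]: "word_perm ((i, b) # w) k = transpose i (Suc i) (word_perm w k)"
  by (simp add: word_perm_def)

lemma delete_strand_append:
  "delete_strand k (v @ w) = delete_strand (word_perm w k) v @ delete_strand k w"
  by (induction v) (auto simp: word_perm_append)

lemma word_perm_range: "w \<in> braid_words n \<Longrightarrow> k \<in> {1..n} \<Longrightarrow> word_perm w k \<in> {1..n}"
  using permutes_in_image[OF word_perm_permutes] by blast

lemma delete_strand_words:
  "w \<in> braid_words (Suc n) \<Longrightarrow> k \<in> {1..Suc n} \<Longrightarrow> delete_strand k w \<in> braid_words n"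
proof (induction w)
  case (Cons l w)
  obtain i b where l: "l = (i, b)" by force
  have "w \<in> braid_words (Suc n)" "i \<in> {1..<Suc n}" using Cons.prems by (auto simp: l)
  moreover have "word_perm w k \<in> {1..Suc n}" using word_perm_range[of w "Suc n" k] calculation Cons.prems by simp
  ultimately show ?case using Cons.IH Cons.prems by (auto simp: l)
qed simp

lemma braid_equiv_mid:
  assumes "u \<in> braid_words n" "v \<in> braid_words n" "braid_equiv n a b"
  shows "braid_equiv n (u @ a @ v) (u @ b @ v)"
  using braid_equiv_context[OF assms(3,1,2)] .

text \<open>
  Deleting a strand turns each relation into a relation of the same type among the other strands, or
  into an identity of words.
\<close>

lemma delete_strand_equiv:
  "braid_equiv (Suc n) v w \<Longrightarrow> k \<in> {1..Suc n} \<Longrightarrow> braid_equiv n (delete_strand k v) (delete_strand k w)"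
proof (induction arbitrary: k rule: braid_equiv.induct)
  case (refl w)
  then show ?case using delete_strand_words by (intro braid_equiv.refl) auto
next
  case (sym v w)
  then show ?case by (blast intro: braid_equiv.sym)
next
  case (trans u v w)
  then show ?case by (blast intro: braid_equiv.trans)
next
  case (cancel u v i b)
  let ?m = "word_perm v k"
  have m: "?m \<in> {1..Suc n}" using word_perm_range[OF cancel.hyps(2) cancel.prems] .
  have uv: "delete_strand ?m u \<in> braid_words n" "delete_strand k v \<in> braid_words n"
    using delete_strand_words cancel m by auto
  have eq: "word_perm [(i, b), (i, \<not> b)] ?m = ?m" by simp
  have "braid_equiv n (delete_strand ?m [(i, b), (i, \<not> b)]) []"
  proof -
    have f: "braid_equiv n [(i', b), (i', \<not> b)] []" if "i' \<in> {1..<n}" for i'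
      using braid_equiv.cancel[of "[]" n "[]" i' b] that by simp
    consider "?m < i" | "?m = i" | "?m = Suc i" | "Suc i < ?m" by linarith
    then show ?thesis
      using cancel.hyps(3) m by cases (auto intro!: f intro: braid_equiv.refl)
  qed
  from braid_equiv_mid[OF uv this] show ?case
    using eq by (simp only: delete_strand_append word_perm_append o_apply append_assoc append_Nil)
next
  case (far u v i j)
  let ?m = "word_perm v k"
  have m: "?m \<in> {1..Suc n}" using word_perm_range[OF far.hyps(2) far.prems] .
  let ?l = "[(i, True), (j, True)]" and ?r = "[(j, True), (i, True)]"
  have eq: "word_perm ?l ?m = word_perm ?r ?m" using far.hyps(5) by (auto simp: transpose_def)
  have uv: "delete_strand (word_perm ?l ?m) u \<in> braid_words n" "delete_strand k v \<in> braid_words n"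
    using delete_strand_words far word_perm_range[of ?l "Suc n" ?m] m by auto
  have f: "braid_equiv n [(i', True), (j', True)] [(j', True), (i', True)]"
    if "i' \<in> {1..<n}" "j' \<in> {1..<n}" "i' + 2 \<le> j'" for i' j'
    using braid_equiv.far[of "[]" n "[]" i' j'] that by simp
  have jn: "Suc 0 \<le> j - Suc 0 \<and> j - Suc 0 < n" using far.hyps(3-5) by auto
  have "braid_equiv n (delete_strand ?m ?l) (delete_strand ?m ?r)"
  proof -
    consider "?m < i" | "?m = i" | "?m = Suc i" | "Suc i < ?m" "?m < j" | "?m = j" | "?m = Suc j" | "Suc j < ?m"
      by linarith
    then show ?thesis
      using far.hyps(3-5) m jn by cases (auto intro!: f intro: braid_equiv.refl)
  qed
  from braid_equiv_mid[OF uv this] show ?case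
    using eq by (simp only: delete_strand_append word_perm_append o_apply append_assoc)
next
  case (braid u v i)
  let ?m = "word_perm v k"
  have m: "?m \<in> {1..Suc n}" using word_perm_range[OF braid.hyps(2) braid.prems] .
  let ?l = "[(i, True), (Suc i, True), (i, True)]" and ?r = "[(Suc i, True), (i, True), (Suc i, True)]"
  have eq: "word_perm ?l ?m = word_perm ?r ?m" by (auto simp: transpose_def)
  have uv: "delete_strand (word_perm ?l ?m) u \<in> braid_words n" "delete_strand k v \<in> braid_words n"
    using delete_strand_words braid word_perm_range[of ?l "Suc n" ?m] m by auto
  have f: "braid_equiv n [(i', True), (Suc i', True), (i', True)] [(Suc i', True), (i', True), (Suc i', True)]"
    if "i' \<in> {1..<n}" "Suc i' \<in> {1..<n}" for i'
    using braid_equiv.braid[of "[]" n "[]" i'] that by simp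
  have f': "braid_equiv n [(i - 1, True), (i, True), (i - 1, True)] [(i, True), (i - 1, True), (i, True)]"
    if "?m < i"
  proof -
    have "i - 1 \<in> {1..<n}" "Suc (i - 1) \<in> {1..<n}" "Suc (i - 1) = i" using that braid.hyps(4) m by auto
    then show ?thesis using f[of "i - 1"] by simp
  qed
  have "braid_equiv n (delete_strand ?m ?l) (delete_strand ?m ?r)"
  proof -
    consider "?m < i" | "?m = i" | "?m = Suc i" | "?m = Suc (Suc i)" | "Suc (Suc i) < ?m" by linarith
    then show ?thesis
      using braid.hyps(3,4) m f' by cases (auto intro!: f intro: braid_equiv.refl)
  qed
  from braid_equiv_mid[OF uv this] show ?case
    using eq by (simp only: delete_strand_append word_perm_append o_apply append_assoc)
qed


section \<open>The Hurwitz action of the braid group\<close>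

abbreviation perm_inv :: "(int \<Rightarrow> int) \<Rightarrow> int \<Rightarrow> int" where
  "perm_inv f \<equiv> inv_into UNIV f"

text \<open>
  The Hurwitz action on tuples of permutations is what the Artin action on the free group becomes when
  a tuple is read as the images of the basis elements.
\<close>

definition hurwitz :: "nat \<Rightarrow> bool \<Rightarrow> (nat \<Rightarrow> int \<Rightarrow> int) \<Rightarrow> nat \<Rightarrow> int \<Rightarrow> int" where
  "hurwitz i b t = (if b then t(i := t (Suc i), Suc i := t (Suc i) \<circ> t i \<circ> perm_inv (t (Suc i)))
    else t(i := perm_inv (t i) \<circ> t (Suc i) \<circ> t i, Suc i := t i))"

type_synonym hurwitz_state = "nat \<times> (nat \<Rightarrow> int \<Rightarrow> int) \<times> int"

text \<open>
  The action of the braid group on \<open>n + 1\<close> strands induced from the stabilizer of one strand.  A state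
  \<open>(k, t, a)\<close> records the position of that strand, a tuple of permutations and an integer.  The other
  strands act on the tuple by the Hurwitz action; when the marked strand is crossed, the
  position changes, and one of the two crossings of a full twist also applies \<open>t i\<close> to \<open>a\<close>.  Since
  the permutations in the tuple are arbitrary, this action shows that the loops satisfy no relation.
\<close>

fun letter_act :: "nat \<times> bool \<Rightarrow> hurwitz_state \<Rightarrow> hurwitz_state" where
  "letter_act (i, b) (k, t, a) =
    (if Suc i < k then (k, hurwitz i b t, a)
     else if k < i then (k, hurwitz (i - 1) b t, a)
     else if k = i then (Suc i, t, if b then t i a else a)
     else (i, t, if b then a else perm_inv (t i) a))"

definition word_act :: "braid_word \<Rightarrow> hurwitz_state \<Rightarrow> hurwitz_state" where
  "word_act w = foldr letter_act w"

definition perm_state :: "hurwitz_state \<Rightarrow> bool" where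
  "perm_state s \<longleftrightarrow> (\<forall>i. bij (fst (snd s) i))"

lemma word_act_append: "word_act (v @ w) s = word_act v (word_act w s)"
  by (simp add: word_act_def)

lemma word_act_simps [simp]: "word_act [] s = s" "word_act (l # w) s = letter_act l (word_act w s)"
  by (simp_all add: word_act_def)

lemma perm_inv_simps:
  assumes "bij f" shows "perm_inv f (f x) = x" "f (perm_inv f x) = x"
  using assms by (simp_all add: bij_is_inj bij_is_surj surj_f_inv_f)

lemma bij_hurwitz: "\<forall>i. bij (t i) \<Longrightarrow> bij (hurwitz i b t j)"
  by (auto simp: hurwitz_def intro!: bij_comp bij_imp_bij_inv)

lemma perm_state_letter_act: "perm_state s \<Longrightarrow> perm_state (letter_act l s)"
  by (cases s; cases l) (auto simp: perm_state_def bij_hurwitz)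

lemma perm_state_word_act: "perm_state s \<Longrightarrow> perm_state (word_act w s)"
  by (induction w) (auto simp: perm_state_letter_act)

lemma perm_inv_conj:
  assumes "bij f" "bij g" shows "perm_inv (f \<circ> g \<circ> perm_inv f) = f \<circ> perm_inv g \<circ> perm_inv f"
    "perm_inv (perm_inv f \<circ> g \<circ> f) = perm_inv f \<circ> perm_inv g \<circ> f"
proof -
  have eq: "perm_inv h = h'" if h: "bij h" and h': "\<And>x. h (h' x) = x" for h h'
  proof
    fix x
    show "perm_inv h x = h' x" using perm_inv_simps(1)[OF h, of "h' x"] h' by simp
  qed
  show "perm_inv (f \<circ> g \<circ> perm_inv f) = f \<circ> perm_inv g \<circ> perm_inv f"
    "perm_inv (perm_inv f \<circ> g \<circ> f) = perm_inv f \<circ> perm_inv g \<circ> f"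
    by (rule eq; use assms in \<open>auto intro!: bij_comp bij_imp_bij_inv simp: perm_inv_simps\<close>)+
qed

lemma hurwitz_cancel: "\<forall>i. bij (t i) \<Longrightarrow> hurwitz i b (hurwitz i (\<not> b) t) = t"
  by (auto simp: hurwitz_def fun_eq_iff perm_inv_simps)

lemma hurwitz_far: "i + 2 \<le> j \<Longrightarrow> hurwitz i b (hurwitz j c t) = hurwitz j c (hurwitz i b t)"
  by (auto simp: hurwitz_def fun_eq_iff)

lemma hurwitz_braid:
  "\<forall>i. bij (t i) \<Longrightarrow> hurwitz i True (hurwitz (Suc i) True (hurwitz i True t)) =
    hurwitz (Suc i) True (hurwitz i True (hurwitz (Suc i) True t))"
  by (auto simp: hurwitz_def fun_eq_iff perm_inv_conj perm_inv_simps)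

lemma letter_act_cancel: "perm_state s \<Longrightarrow> letter_act (i, b) (letter_act (i, \<not> b) s) = s"
  by (cases s) (auto simp: perm_state_def hurwitz_cancel perm_inv_simps)

lemma letter_act_far:
  assumes "1 \<le> i" "i + 2 \<le> j"
  shows "letter_act (i, True) (letter_act (j, True) s) = letter_act (j, True) (letter_act (i, True) s)"
proof -
  obtain k t a where s: "s = (k, t, a)" by (cases s)
  have v: "hurwitz j True t i = t i" "hurwitz (j - 1) True t i = t i" "hurwitz i True t j = t j"
    "hurwitz (i - 1) True t j = t j"
    using assms by (auto simp: hurwitz_def)
  consider "k < i" | "k = i" | "k = Suc i" | "Suc i < k" "k < j" | "k = j" | "k = Suc j" | "Suc j < k"
    by linarith
  then show ?thesis
    using assms hurwitz_far[of i j True True t] hurwitz_far[of i "j - 1" True True t]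
      hurwitz_far[of "i - 1" "j - 1" True True t] v
    by cases (auto simp: s)
qed

lemma letter_act_braid:
  assumes "1 \<le> i" "perm_state s"
  shows "letter_act (i, True) (letter_act (Suc i, True) (letter_act (i, True) s)) =
    letter_act (Suc i, True) (letter_act (i, True) (letter_act (Suc i, True) s))"
proof -
  obtain k t a where s: "s = (k, t, a)" by (cases s)
  have t: "\<forall>i. bij (t i)" using assms(2) by (simp add: perm_state_def s)
  have v: "hurwitz i True t i = t (Suc i)"
    "hurwitz i True t (Suc i) (t (Suc i) a) = t (Suc i) (t i a)"
    "hurwitz i True t (Suc i) = t (Suc i) \<circ> t i \<circ> perm_inv (t (Suc i))"
    using t by (auto simp: hurwitz_def perm_inv_simps)
  consider "k < i" | "k = i" | "k = Suc i" | "k = Suc (Suc i)" | "Suc (Suc i) < k" by linarith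
  then show ?thesis
    using assms(1) hurwitz_braid[OF t, of i] hurwitz_braid[OF t, of "i - 1"] v
    by cases (auto simp: s)
qed

lemma word_act_cong: "braid_equiv n v w \<Longrightarrow> perm_state s \<Longrightarrow> word_act v s = word_act w s"
proof (induction arbitrary: s rule: braid_equiv.induct)
  case (cancel u v i b)
  then show ?case by (simp add: word_act_append letter_act_cancel perm_state_word_act)
next
  case (far u v i j)
  then show ?case using letter_act_far[of i j] by (simp add: word_act_append)
next
  case (braid u v i)
  then show ?case using letter_act_braid[of i "word_act v s"] by (simp add: word_act_append perm_state_word_act)
qed auto

section \<open>Combing\<close>

definition braid_class :: "nat \<Rightarrow> braid_word \<Rightarrow> braid_word set" where
  "braid_class n w = braid_rel n `` {w}"

lemma braid_class_append:
  "v \<in> braid_words n \<Longrightarrow> w \<in> braid_words n \<Longrightarrow>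
    braid_class n (v @ w) = braid_class n v \<otimes>\<^bsub>braid_group n\<^esub> braid_class n w"
  by (simp add: braid_class_def braid_group_mult_class)

lemma braid_class_Nil: "braid_class n [] = \<one>\<^bsub>braid_group n\<^esub>"
  by (simp add: braid_class_def braid_group_def)

lemma braid_class_carrier: "w \<in> braid_words n \<Longrightarrow> braid_class n w \<in> carrier (braid_group n)"
  by (simp add: braid_class_def)

lemma braid_class_eq:
  "v \<in> braid_words n \<Longrightarrow> w \<in> braid_words n \<Longrightarrow> braid_class n v = braid_class n w \<longleftrightarrow> braid_equiv n v w"
  by (simp add: braid_class_def braid_class_eq_iff)

lemma braid_carrierE:
  assumes "A \<in> carrier (braid_group n)"
  obtains w where "w \<in> braid_words n" "A = braid_class n w"
  using assms by (elim braid_group_carrierE) (auto simp: braid_class_def)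

lemma braid_class_letter_inv:
  assumes "i \<in> {1..<n}"
  shows "braid_class n [(i, False)] = inv\<^bsub>braid_group n\<^esub> braid_class n [(i, True)]"
proof -
  interpret group "braid_group n" by (rule group_braid_group)
  have "braid_equiv n [(i, False), (i, True)] []"
    using braid_equiv.cancel[of "[]" n "[]" i False] assms by simp
  then have "braid_class n [(i, False)] \<otimes>\<^bsub>braid_group n\<^esub> braid_class n [(i, True)] = \<one>\<^bsub>braid_group n\<^esub>"
    using assms by (simp add: braid_class_append[symmetric] braid_class_eq braid_class_Nil[symmetric])
  then show ?thesis using assms by (intro inv_equality[symmetric]) (auto intro: braid_class_carrier)
qed

definition word_of :: "nat \<Rightarrow> braid_word set \<Rightarrow> braid_word" where
  "word_of n A = (SOME w. w \<in> braid_words n \<and> A = braid_class n w)"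

lemma word_of:
  assumes "w \<in> braid_words n"
  shows "word_of n (braid_class n w) \<in> braid_words n" "braid_equiv n (word_of n (braid_class n w)) w"
proof -
  have "word_of n (braid_class n w) \<in> braid_words n \<and> braid_class n w = braid_class n (word_of n (braid_class n w))"
    unfolding word_of_def by (rule someI[of _ w]) (simp add: assms)
  then show "word_of n (braid_class n w) \<in> braid_words n" "braid_equiv n (word_of n (braid_class n w)) w"
    using assms braid_class_eq by metis+
qed

definition pure_braids :: "nat \<Rightarrow> braid_word set set" where
  "pure_braids n = kernel (braid_group n) (sym_group n) braid_perm"

lemma braid_perm_group_hom: "group_hom (braid_group n) (sym_group n) braid_perm"
  by (simp add: group_hom_def group_hom_axioms_def group_braid_group sym_group_is_group braid_perm_hom)

lemma subgroup_pure_braids: "subgroup (pure_braids n) (braid_group n)"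
  unfolding pure_braids_def using group_hom.subgroup_kernel[OF braid_perm_group_hom] .

lemma pure_braids_class:
  assumes "w \<in> braid_words n"
  shows "braid_class n w \<in> pure_braids n \<longleftrightarrow> word_perm w = id"
  using assms braid_perm_class[OF assms]
  by (auto simp: pure_braids_def kernel_def braid_class_def sym_group_def)

lemma pure_braidsE:
  assumes "A \<in> pure_braids n"
  obtains w where "w \<in> braid_words n" "A = braid_class n w" "word_perm w = id"
proof -
  have "A \<in> carrier (braid_group n)" using assms by (simp add: pure_braids_def kernel_def)
  then obtain w where "w \<in> braid_words n" "A = braid_class n w" by (rule braid_carrierE)
  then show thesis using that assms pure_braids_class by blast
qed

lemma braid_words_mono: "w \<in> braid_words n \<Longrightarrow> w \<in> braid_words (Suc n)"
  by (auto simp: braid_words_def lists_eq_set)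

lemma braid_equiv_mono: "braid_equiv n v w \<Longrightarrow> braid_equiv (Suc n) v w"
proof (induction rule: braid_equiv.induct)
  case (cancel u v i b)
  then show ?case by (intro braid_equiv.cancel) (auto intro: braid_words_mono)
next
  case (far u v i j)
  then show ?case by (intro braid_equiv.far) (auto intro: braid_words_mono)
next
  case (braid u v i)
  then show ?case by (intro braid_equiv.braid) (auto intro: braid_words_mono)
qed (auto intro: braid_equiv.refl braid_equiv.sym braid_equiv.trans braid_words_mono)

context
  fixes n :: nat
begin

abbreviation "BG \<equiv> braid_group (Suc n)"
abbreviation "cl \<equiv> braid_class (Suc n)"

interpretation BG: group BG by (rule group_braid_group)

definition sigma :: "nat \<Rightarrow> braid_word set" where
  "sigma i = cl [(i, True)]"

text \<open>
  Coset representatives for the stabilizer of the last strand, and the pure braids in which the last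
  strand runs once around strand \<open>i\<close>.
\<close>

definition tail_braid :: "nat \<Rightarrow> braid_word set" where
  "tail_braid k = cl (map (\<lambda>i. (i, True)) [k..<Suc n])"

definition loop_braid :: "nat \<Rightarrow> braid_word set" where
  "loop_braid i = inv\<^bsub>BG\<^esub> tail_braid (Suc i) \<otimes>\<^bsub>BG\<^esub> (sigma i \<otimes>\<^bsub>BG\<^esub> tail_braid i)"

lemma sigma_carrier: "i \<in> {1..n} \<Longrightarrow> sigma i \<in> carrier BG"
  by (auto simp: sigma_def intro: braid_class_carrier)

lemma tail_words: "1 \<le> k \<Longrightarrow> map (\<lambda>i. (i, True)) [k..<Suc n] \<in> braid_words (Suc n)"
  by (auto simp: braid_words_def)

lemma tail_carrier: "1 \<le> k \<Longrightarrow> tail_braid k \<in> carrier BG"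
  unfolding tail_braid_def using tail_words by (rule braid_class_carrier)

lemma tail_last: "tail_braid (Suc n) = \<one>\<^bsub>BG\<^esub>"
  by (simp add: tail_braid_def braid_class_Nil)

lemma tail_step: "k \<in> {1..n} \<Longrightarrow> tail_braid k = sigma k \<otimes>\<^bsub>BG\<^esub> tail_braid (Suc k)"
  using tail_words[of "Suc k"] braid_class_append[of "[(k, True)]" "Suc n" "map (\<lambda>i. (i, True)) [Suc k..<Suc n]"]
  by (simp add: tail_braid_def sigma_def upt_conv_Cons del: upt_Suc)

lemma loop_carrier: "i \<in> {1..n} \<Longrightarrow> loop_braid i \<in> carrier BG"
  unfolding loop_braid_def by (intro BG.m_closed BG.inv_closed sigma_carrier tail_carrier) auto

lemma tail_loop: "i \<in> {1..n} \<Longrightarrow> tail_braid (Suc i) \<otimes>\<^bsub>BG\<^esub> loop_braid i = sigma i \<otimes>\<^bsub>BG\<^esub> tail_braid i"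
  unfolding loop_braid_def by (intro BG.inv_cancel_left BG.m_closed sigma_carrier tail_carrier) auto

lemma sigma_far:
  assumes "i \<in> {1..n}" "j \<in> {1..n}" "i + 2 \<le> j"
  shows "sigma i \<otimes>\<^bsub>BG\<^esub> sigma j = sigma j \<otimes>\<^bsub>BG\<^esub> sigma i"
  using braid_equiv.far[of "[]" "Suc n" "[]" i j] assms
  by (simp add: sigma_def braid_class_append[symmetric] braid_class_eq)

lemma sigma_braid:
  assumes "i \<in> {1..n}" "Suc i \<in> {1..n}"
  shows "sigma i \<otimes>\<^bsub>BG\<^esub> (sigma (Suc i) \<otimes>\<^bsub>BG\<^esub> sigma i) = sigma (Suc i) \<otimes>\<^bsub>BG\<^esub> (sigma i \<otimes>\<^bsub>BG\<^esub> sigma (Suc i))"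
  using braid_equiv.braid[of "[]" "Suc n" "[]" i] assms
  by (simp add: sigma_def braid_class_append[symmetric] braid_class_eq)

lemma tail_far:
  assumes "1 \<le> j" "j + 2 \<le> k" "k \<le> Suc n"
  shows "sigma j \<otimes>\<^bsub>BG\<^esub> tail_braid k = tail_braid k \<otimes>\<^bsub>BG\<^esub> sigma j"
  using assms(3)
proof (induction rule: inc_induct)
  case base
  show ?case using sigma_carrier[of j] assms by (simp add: tail_last)
next
  case (step m)
  have m: "m \<in> {1..n}" and j: "j \<in> {1..n}" and jm: "j + 2 \<le> m" using step.hyps assms by auto
  have c: "sigma m \<in> carrier BG" "sigma j \<in> carrier BG" "tail_braid (Suc m) \<in> carrier BG"
    using sigma_carrier m j tail_carrier by auto
  have "sigma j \<otimes>\<^bsub>BG\<^esub> tail_braid m = (sigma j \<otimes>\<^bsub>BG\<^esub> sigma m) \<otimes>\<^bsub>BG\<^esub> tail_braid (Suc m)"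
    using c by (simp add: tail_step[OF m] BG.m_assoc)
  also have "\<dots> = sigma m \<otimes>\<^bsub>BG\<^esub> (sigma j \<otimes>\<^bsub>BG\<^esub> tail_braid (Suc m))"
    using c by (simp add: sigma_far[OF j m jm] BG.m_assoc)
  also have "\<dots> = tail_braid m \<otimes>\<^bsub>BG\<^esub> sigma j"
    using c by (simp add: step.IH tail_step[OF m] BG.m_assoc)
  finally show ?case .
qed

text \<open>
  The generator commutes with the letters of the tail until it meets its own strands, where one
  braid relation lowers its index.
\<close>

lemma tail_shift:
  assumes "1 \<le> k" "k \<le> i" "Suc i \<le> n"
  shows "sigma (Suc i) \<otimes>\<^bsub>BG\<^esub> tail_braid k = tail_braid k \<otimes>\<^bsub>BG\<^esub> sigma i"
  using assms(2)
proof (induction rule: inc_induct)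
  case base
  have i: "i \<in> {1..n}" "Suc i \<in> {1..n}" using assms by auto
  have c: "sigma i \<in> carrier BG" "sigma (Suc i) \<in> carrier BG" "tail_braid (Suc (Suc i)) \<in> carrier BG"
    using sigma_carrier i tail_carrier by auto
  have "sigma (Suc i) \<otimes>\<^bsub>BG\<^esub> tail_braid i =
      (sigma (Suc i) \<otimes>\<^bsub>BG\<^esub> (sigma i \<otimes>\<^bsub>BG\<^esub> sigma (Suc i))) \<otimes>\<^bsub>BG\<^esub> tail_braid (Suc (Suc i))"
    using c by (simp add: tail_step[OF i(1)] tail_step[OF i(2)] BG.m_assoc)
  also have "\<dots> = sigma i \<otimes>\<^bsub>BG\<^esub> (sigma (Suc i) \<otimes>\<^bsub>BG\<^esub> (sigma i \<otimes>\<^bsub>BG\<^esub> tail_braid (Suc (Suc i))))"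
    using c by (simp add: sigma_braid[OF i, symmetric] BG.m_assoc)
  also have "\<dots> = tail_braid i \<otimes>\<^bsub>BG\<^esub> sigma i"
    using c tail_far[of i "Suc (Suc i)"] assms
    by (simp add: tail_step[OF i(1)] tail_step[OF i(2)] BG.m_assoc)
  finally show ?case .
next
  case (step m)
  have m: "m \<in> {1..n}" and i: "Suc i \<in> {1..n}" "i \<in> {1..n}" and mi: "m + 2 \<le> Suc i"
    using step.hyps assms by auto
  have c: "sigma m \<in> carrier BG" "sigma (Suc i) \<in> carrier BG" "sigma i \<in> carrier BG" "tail_braid (Suc m) \<in> carrier BG"
    using sigma_carrier m i tail_carrier by auto
  have "sigma (Suc i) \<otimes>\<^bsub>BG\<^esub> tail_braid m = (sigma (Suc i) \<otimes>\<^bsub>BG\<^esub> sigma m) \<otimes>\<^bsub>BG\<^esub> tail_braid (Suc m)"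
    using c by (simp add: tail_step[OF m] BG.m_assoc)
  also have "\<dots> = sigma m \<otimes>\<^bsub>BG\<^esub> (sigma (Suc i) \<otimes>\<^bsub>BG\<^esub> tail_braid (Suc m))"
    using c by (simp add: sigma_far[OF m i(1) mi, symmetric] BG.m_assoc)
  also have "\<dots> = tail_braid m \<otimes>\<^bsub>BG\<^esub> sigma i"
    using c by (simp add: step.IH tail_step[OF m] BG.m_assoc)
  finally show ?case .
qed

lemma loop_artin:
  assumes i: "i \<in> {1..<n}"
  shows "sigma i \<otimes>\<^bsub>BG\<^esub> loop_braid (Suc i) = loop_braid i \<otimes>\<^bsub>BG\<^esub> sigma i"
    "sigma i \<otimes>\<^bsub>BG\<^esub> (loop_braid (Suc i) \<otimes>\<^bsub>BG\<^esub> loop_braid i) = loop_braid (Suc i) \<otimes>\<^bsub>BG\<^esub> (loop_braid i \<otimes>\<^bsub>BG\<^esub> sigma i)"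
proof -
  have i': "i \<in> {1..n}" "Suc i \<in> {1..n}" using i by auto
  have c: "sigma i \<in> carrier BG" "sigma (Suc i) \<in> carrier BG" "tail_braid i \<in> carrier BG"
    "tail_braid (Suc i) \<in> carrier BG" "tail_braid (Suc (Suc i)) \<in> carrier BG" "loop_braid i \<in> carrier BG" "loop_braid (Suc i) \<in> carrier BG"
    using sigma_carrier loop_carrier i' by (simp_all add: tail_carrier)
  have far: "sigma i \<otimes>\<^bsub>BG\<^esub> tail_braid (Suc (Suc i)) = tail_braid (Suc (Suc i)) \<otimes>\<^bsub>BG\<^esub> sigma i"
    by (rule tail_far) (use i in auto)
  have shift: "sigma (Suc i) \<otimes>\<^bsub>BG\<^esub> tail_braid i = tail_braid i \<otimes>\<^bsub>BG\<^esub> sigma i"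
    by (rule tail_shift) (use i in auto)
  show "sigma i \<otimes>\<^bsub>BG\<^esub> loop_braid (Suc i) = loop_braid i \<otimes>\<^bsub>BG\<^esub> sigma i"
    "sigma i \<otimes>\<^bsub>BG\<^esub> (loop_braid (Suc i) \<otimes>\<^bsub>BG\<^esub> loop_braid i) = loop_braid (Suc i) \<otimes>\<^bsub>BG\<^esub> (loop_braid i \<otimes>\<^bsub>BG\<^esub> sigma i)"
    using BG.artin_relations[OF c tail_step[OF i'(1)] tail_step[OF i'(2)] tail_loop[OF i'(1)]
        tail_loop[OF i'(2)] far shift sigma_braid[OF i']] .
qed

lemma loop_commute:
  assumes j: "j \<in> {1..<n}" and i: "i \<in> {1..n}" and ij: "i \<noteq> j" "i \<noteq> Suc j"
  shows "sigma j \<otimes>\<^bsub>BG\<^esub> loop_braid i = loop_braid i \<otimes>\<^bsub>BG\<^esub> sigma j"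
proof (cases "i < j")
  case True
  have j': "j \<in> {1..n}" "Suc j \<in> {1..n}" using j by auto
  have c: "sigma j \<in> carrier BG" "sigma (Suc j) \<in> carrier BG" "sigma i \<in> carrier BG" "tail_braid i \<in> carrier BG"
    "tail_braid (Suc i) \<in> carrier BG" "loop_braid i \<in> carrier BG"
    using sigma_carrier tail_carrier loop_carrier j' i by auto
  show ?thesis
  proof (rule BG.artin_commute[OF c tail_loop[OF i]])
    show "sigma (Suc j) \<otimes>\<^bsub>BG\<^esub> tail_braid (Suc i) = tail_braid (Suc i) \<otimes>\<^bsub>BG\<^esub> sigma j"
      by (rule tail_shift) (use True j in auto)
    show "sigma (Suc j) \<otimes>\<^bsub>BG\<^esub> tail_braid i = tail_braid i \<otimes>\<^bsub>BG\<^esub> sigma j"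
      by (rule tail_shift) (use True i j in auto)
    show "sigma (Suc j) \<otimes>\<^bsub>BG\<^esub> sigma i = sigma i \<otimes>\<^bsub>BG\<^esub> sigma (Suc j)"
      by (rule sigma_far[OF i j'(2), symmetric]) (use True in simp)
  qed
next
  case False
  have j': "j \<in> {1..n}" using j by auto
  have c: "sigma j \<in> carrier BG" "sigma j \<in> carrier BG" "sigma i \<in> carrier BG" "tail_braid i \<in> carrier BG"
    "tail_braid (Suc i) \<in> carrier BG" "loop_braid i \<in> carrier BG"
    using sigma_carrier tail_carrier loop_carrier j' i by auto
  show ?thesis
  proof (rule BG.artin_commute[OF c tail_loop[OF i]])
    show "sigma j \<otimes>\<^bsub>BG\<^esub> tail_braid (Suc i) = tail_braid (Suc i) \<otimes>\<^bsub>BG\<^esub> sigma j"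
      by (rule tail_far) (use False ij i j in auto)
    show "sigma j \<otimes>\<^bsub>BG\<^esub> tail_braid i = tail_braid i \<otimes>\<^bsub>BG\<^esub> sigma j"
      by (rule tail_far) (use False ij i j in auto)
    show "sigma j \<otimes>\<^bsub>BG\<^esub> sigma i = sigma i \<otimes>\<^bsub>BG\<^esub> sigma j"
      by (rule sigma_far[OF j' i]) (use False ij in simp)
  qed
qed

abbreviation "loops \<equiv> loop_braid ` {Suc 0..n}"
abbreviation "LF \<equiv> generate BG loops"

lemma loops_carrier: "loops \<subseteq> carrier BG" using loop_carrier by auto

interpretation LF: subgroup LF BG by (rule BG.generate_is_subgroup[OF loops_carrier])

lemma loop_LF: "i \<in> {1..n} \<Longrightarrow> loop_braid i \<in> LF" by (auto intro: generate.incl)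

text \<open>
  By the Artin relations only the loops around the two strands that cross are affected; the generator
  commutes with all others.
\<close>

lemma letter_conj_loop:
  assumes j: "j \<in> {1..<n}" and i: "i \<in> {1..n}"
  shows "\<exists>h\<in>LF. cl [(j, b)] \<otimes>\<^bsub>BG\<^esub> loop_braid i \<otimes>\<^bsub>BG\<^esub> inv\<^bsub>BG\<^esub> cl [(j, b)] =
    h \<otimes>\<^bsub>BG\<^esub> loop_braid (transpose j (Suc j) i) \<otimes>\<^bsub>BG\<^esub> inv\<^bsub>BG\<^esub> h"
proof -
  have j': "j \<in> {1..n}" "Suc j \<in> {1..n}" "j \<in> {1..<Suc n}" using j by auto
  have c: "sigma j \<in> carrier BG" "loop_braid j \<in> carrier BG" "loop_braid (Suc j) \<in> carrier BG" "loop_braid i \<in> carrier BG"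
    using sigma_carrier loop_carrier j' i by auto
  note r = BG.artin_conj[OF c(1-3) loop_artin[OF j]]
  have one: "\<one>\<^bsub>BG\<^esub> \<otimes>\<^bsub>BG\<^esub> x \<otimes>\<^bsub>BG\<^esub> inv\<^bsub>BG\<^esub> \<one>\<^bsub>BG\<^esub> = x" if "x \<in> carrier BG" for x using that by simp
  have T: "cl [(j, True)] = sigma j" by (simp add: sigma_def)
  have F: "cl [(j, False)] = inv\<^bsub>BG\<^esub> sigma j"
    unfolding sigma_def by (rule braid_class_letter_inv[OF j'(3)])
  have L: "inv\<^bsub>BG\<^esub> loop_braid j \<in> LF" "loop_braid (Suc j) \<in> LF" "\<one>\<^bsub>BG\<^esub> \<in> LF"
    using loop_LF[OF j'(1)] loop_LF[OF j'(2)] by simp_all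
  let ?R = "\<lambda>g. \<exists>h\<in>LF. g \<otimes>\<^bsub>BG\<^esub> loop_braid i \<otimes>\<^bsub>BG\<^esub> inv\<^bsub>BG\<^esub> g =
    h \<otimes>\<^bsub>BG\<^esub> loop_braid (transpose j (Suc j) i) \<otimes>\<^bsub>BG\<^esub> inv\<^bsub>BG\<^esub> h"
  have "?R (sigma j) \<and> ?R (inv\<^bsub>BG\<^esub> sigma j)"
  proof -
    consider "i = j" | "i = Suc j" | "i \<noteq> j" "i \<noteq> Suc j" by blast
    then show ?thesis
    proof cases
      case 1
      then have "transpose j (Suc j) i = Suc j" by simp
      then show ?thesis using r(2,3) one[OF c(3)] L(1,3) 1 by metis
    next
      case 2
      then have "transpose j (Suc j) i = j" by simp
      then show ?thesis using r(1,4) one[OF c(2)] L(2,3) 2 by metis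
    next
      case 3
      then have "transpose j (Suc j) i = i" by simp
      then show ?thesis
        using BG.conj_of_commute[OF c(1,4,4) loop_commute[OF j i 3]] one[OF c(4)] L(3) by metis
    qed
  qed
  then show ?thesis by (cases b) (simp_all only: T F)
qed

lemma inner_words_carrier: "v \<in> braid_words n \<Longrightarrow> cl v \<in> carrier BG"
  by (intro braid_class_carrier braid_words_mono)

lemma letter_normalizes:
  assumes j: "j \<in> {1..<n}" and u: "u \<in> LF"
  shows "cl [(j, b)] \<otimes>\<^bsub>BG\<^esub> u \<otimes>\<^bsub>BG\<^esub> inv\<^bsub>BG\<^esub> cl [(j, b)] \<in> LF"
proof (rule BG.conj_generate[OF loops_carrier _ _ u])
  show "cl [(j, b)] \<in> carrier BG" using j by (intro inner_words_carrier) simp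
  fix x assume "x \<in> loops"
  then obtain i where i: "i \<in> {1..n}" "x = loop_braid i" by auto
  obtain h where h: "h \<in> LF" "cl [(j, b)] \<otimes>\<^bsub>BG\<^esub> loop_braid i \<otimes>\<^bsub>BG\<^esub> inv\<^bsub>BG\<^esub> cl [(j, b)] =
      h \<otimes>\<^bsub>BG\<^esub> loop_braid (transpose j (Suc j) i) \<otimes>\<^bsub>BG\<^esub> inv\<^bsub>BG\<^esub> h"
    using letter_conj_loop[OF j i(1)] by blast
  have "transpose j (Suc j) i \<in> {1..n}" using i(1) j by (auto simp: transpose_def)
  then show "cl [(j, b)] \<otimes>\<^bsub>BG\<^esub> x \<otimes>\<^bsub>BG\<^esub> inv\<^bsub>BG\<^esub> cl [(j, b)] \<in> LF"
    unfolding i(2) h(2) using h(1) loop_LF by simp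
qed

lemma inner_conj_loop:
  "v \<in> braid_words n \<Longrightarrow> i \<in> {1..n} \<Longrightarrow>
    \<exists>h\<in>LF. cl v \<otimes>\<^bsub>BG\<^esub> loop_braid i \<otimes>\<^bsub>BG\<^esub> inv\<^bsub>BG\<^esub> cl v = h \<otimes>\<^bsub>BG\<^esub> loop_braid (word_perm v i) \<otimes>\<^bsub>BG\<^esub> inv\<^bsub>BG\<^esub> h"
proof (induction v)
  case Nil
  have "cl [] \<otimes>\<^bsub>BG\<^esub> loop_braid i \<otimes>\<^bsub>BG\<^esub> inv\<^bsub>BG\<^esub> cl [] = \<one>\<^bsub>BG\<^esub> \<otimes>\<^bsub>BG\<^esub> loop_braid (word_perm [] i) \<otimes>\<^bsub>BG\<^esub> inv\<^bsub>BG\<^esub> \<one>\<^bsub>BG\<^esub>"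
    by (simp add: braid_class_Nil)
  then show ?case using LF.one_closed by blast
next
  case (Cons l v)
  obtain j b where l: "l = (j, b)" by force
  have v: "v \<in> braid_words n" and j: "j \<in> {1..<n}" using Cons.prems by (auto simp: l)
  obtain h where h: "h \<in> LF" "cl v \<otimes>\<^bsub>BG\<^esub> loop_braid i \<otimes>\<^bsub>BG\<^esub> inv\<^bsub>BG\<^esub> cl v =
      h \<otimes>\<^bsub>BG\<^esub> loop_braid (word_perm v i) \<otimes>\<^bsub>BG\<^esub> inv\<^bsub>BG\<^esub> h"
    using Cons.IH[OF v Cons.prems(2)] by blast
  have m: "word_perm v i \<in> {1..n}" by (rule word_perm_range[OF v Cons.prems(2)])
  obtain h' where h': "h' \<in> LF" "cl [l] \<otimes>\<^bsub>BG\<^esub> loop_braid (word_perm v i) \<otimes>\<^bsub>BG\<^esub> inv\<^bsub>BG\<^esub> cl [l] =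
      h' \<otimes>\<^bsub>BG\<^esub> loop_braid (word_perm (l # v) i) \<otimes>\<^bsub>BG\<^esub> inv\<^bsub>BG\<^esub> h'"
    using letter_conj_loop[OF j m, of b] by (auto simp: l)
  have lw: "[l] \<in> braid_words n" using j by (simp add: l)
  have c: "cl v \<in> carrier BG" "cl [l] \<in> carrier BG" "h \<in> carrier BG" "h' \<in> carrier BG"
    "loop_braid i \<in> carrier BG" "loop_braid (word_perm v i) \<in> carrier BG" "loop_braid (word_perm (l # v) i) \<in> carrier BG"
    using inner_words_carrier v lw h(1) h'(1) loop_carrier Cons.prems(2) m
      word_perm_range[OF Cons.prems] LF.mem_carrier by auto
  let ?g = "cl [l] \<otimes>\<^bsub>BG\<^esub> h \<otimes>\<^bsub>BG\<^esub> inv\<^bsub>BG\<^esub> cl [l]"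
  have g: "?g \<in> LF" unfolding l by (rule letter_normalizes[OF j h(1)])
  have "cl (l # v) = cl [l] \<otimes>\<^bsub>BG\<^esub> cl v"
    using braid_class_append[of "[l]" "Suc n" v] lw v braid_words_mono by simp
  then have "cl (l # v) \<otimes>\<^bsub>BG\<^esub> loop_braid i \<otimes>\<^bsub>BG\<^esub> inv\<^bsub>BG\<^esub> cl (l # v) =
      cl [l] \<otimes>\<^bsub>BG\<^esub> (cl v \<otimes>\<^bsub>BG\<^esub> loop_braid i \<otimes>\<^bsub>BG\<^esub> inv\<^bsub>BG\<^esub> cl v) \<otimes>\<^bsub>BG\<^esub> inv\<^bsub>BG\<^esub> cl [l]"
    using c by (simp add: BG.group_normalize)
  also have "\<dots> = ?g \<otimes>\<^bsub>BG\<^esub> (cl [l] \<otimes>\<^bsub>BG\<^esub> loop_braid (word_perm v i) \<otimes>\<^bsub>BG\<^esub> inv\<^bsub>BG\<^esub> cl [l]) \<otimes>\<^bsub>BG\<^esub> inv\<^bsub>BG\<^esub> ?g"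
    unfolding h(2) using c by (simp add: BG.group_normalize)
  also have "\<dots> = (?g \<otimes>\<^bsub>BG\<^esub> h') \<otimes>\<^bsub>BG\<^esub> loop_braid (word_perm (l # v) i) \<otimes>\<^bsub>BG\<^esub> inv\<^bsub>BG\<^esub> (?g \<otimes>\<^bsub>BG\<^esub> h')"
    unfolding h'(2) using c by (simp add: BG.group_normalize)
  finally show ?case using LF.m_closed[OF g h'(1)] by blast
qed

text \<open>
  The rewriting rule behind combing: a letter times a coset representative is again a representative
  times an element of the stabilizer.  A loop appears at one of the two crossings of a full
  twist of strand \<open>i\<close> with the last strand.
\<close>

lemma letter_combing:
  assumes i: "i \<in> {1..n}" and k: "k \<in> {1..Suc n}"
  shows "\<exists>u\<in>LF. cl [(i, b)] \<otimes>\<^bsub>BG\<^esub> tail_braid k =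
    tail_braid (transpose i (Suc i) k) \<otimes>\<^bsub>BG\<^esub> (u \<otimes>\<^bsub>BG\<^esub> cl (delete_strand k [(i, b)]))"
proof -
  have i': "i \<in> {1..<Suc n}" using i by auto
  have c: "sigma i \<in> carrier BG" "loop_braid i \<in> carrier BG" "tail_braid i \<in> carrier BG" "tail_braid (Suc i) \<in> carrier BG" "tail_braid k \<in> carrier BG"
    using sigma_carrier loop_carrier tail_carrier i k by auto
  have T: "cl [(i, True)] = sigma i" by (simp add: sigma_def)
  have F: "cl [(i, False)] = inv\<^bsub>BG\<^esub> sigma i"
    unfolding sigma_def by (rule braid_class_letter_inv[OF i'])
  consider "k < i" | "k = i" | "k = Suc i" | "Suc i < k" by linarith
  then show ?thesis
  proof cases
    case 1
    have i1: "i - 1 \<in> {1..n}" "i - 1 \<in> {1..<Suc n}" "Suc (i - 1) = i" using 1 i k by auto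
    have c1: "sigma (i - 1) \<in> carrier BG" by (rule sigma_carrier[OF i1(1)])
    have s: "sigma i \<otimes>\<^bsub>BG\<^esub> tail_braid k = tail_braid k \<otimes>\<^bsub>BG\<^esub> sigma (i - 1)"
      using tail_shift[of k "i - 1"] i1 i k 1 by simp
    have s': "inv\<^bsub>BG\<^esub> sigma i \<otimes>\<^bsub>BG\<^esub> tail_braid k = tail_braid k \<otimes>\<^bsub>BG\<^esub> inv\<^bsub>BG\<^esub> sigma (i - 1)"
    proof -
      have "sigma i \<otimes>\<^bsub>BG\<^esub> (tail_braid k \<otimes>\<^bsub>BG\<^esub> inv\<^bsub>BG\<^esub> sigma (i - 1)) = (sigma i \<otimes>\<^bsub>BG\<^esub> tail_braid k) \<otimes>\<^bsub>BG\<^esub> inv\<^bsub>BG\<^esub> sigma (i - 1)"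
        using c c1 by (simp add: BG.m_assoc)
      also have "\<dots> = tail_braid k" unfolding s using c c1 by (simp add: BG.m_assoc)
      finally show ?thesis using c c1 by (simp add: BG.inv_solve_left')
    qed
    have F1: "cl [(i - 1, False)] = inv\<^bsub>BG\<^esub> sigma (i - 1)"
      unfolding sigma_def by (rule braid_class_letter_inv[OF i1(2)])
    have "transpose i (Suc i) k = k" using 1 by simp
    then show ?thesis using 1 s s' c1 F1
      by (intro bexI[OF _ LF.one_closed]) (cases b; simp add: T F sigma_def[symmetric])
  next
    case 2
    have t: "inv\<^bsub>BG\<^esub> sigma i \<otimes>\<^bsub>BG\<^esub> tail_braid i = tail_braid (Suc i)"
      using c by (simp add: tail_step[OF i] BG.inv_cancel_left)
    show ?thesis
    proof (cases b)
      case True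
      then show ?thesis using 2 c tail_loop[OF i]
        by (intro bexI[OF _ loop_LF[OF i]]) (simp add: T braid_class_Nil)
    next
      case False
      then show ?thesis using 2 c t
        by (intro bexI[OF _ LF.one_closed]) (simp add: F braid_class_Nil)
    qed
  next
    case 3
    have t: "inv\<^bsub>BG\<^esub> sigma i \<otimes>\<^bsub>BG\<^esub> tail_braid (Suc i) = tail_braid i \<otimes>\<^bsub>BG\<^esub> inv\<^bsub>BG\<^esub> loop_braid i"
    proof -
      have "sigma i \<otimes>\<^bsub>BG\<^esub> (tail_braid i \<otimes>\<^bsub>BG\<^esub> inv\<^bsub>BG\<^esub> loop_braid i) = (sigma i \<otimes>\<^bsub>BG\<^esub> tail_braid i) \<otimes>\<^bsub>BG\<^esub> inv\<^bsub>BG\<^esub> loop_braid i"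
        using c by (simp add: BG.m_assoc)
      also have "\<dots> = tail_braid (Suc i)" unfolding tail_loop[OF i, symmetric] using c by (simp add: BG.m_assoc)
      finally show ?thesis using c by (simp add: BG.inv_solve_left')
    qed
    show ?thesis
    proof (cases b)
      case True
      then show ?thesis using 3 c
        by (intro bexI[OF _ LF.one_closed]) (simp add: T braid_class_Nil tail_step[OF i])
    next
      case False
      have "inv\<^bsub>BG\<^esub> loop_braid i \<in> LF" using loop_LF[OF i] by simp
      then show ?thesis using 3 c t False
        by (intro bexI[of _ "inv\<^bsub>BG\<^esub> loop_braid i"]) (simp_all add: F braid_class_Nil)
    qed
  next
    case 4
    have s: "sigma i \<otimes>\<^bsub>BG\<^esub> tail_braid k = tail_braid k \<otimes>\<^bsub>BG\<^esub> sigma i"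
      by (rule tail_far) (use 4 i k in auto)
    have s': "inv\<^bsub>BG\<^esub> sigma i \<otimes>\<^bsub>BG\<^esub> tail_braid k = tail_braid k \<otimes>\<^bsub>BG\<^esub> inv\<^bsub>BG\<^esub> sigma i"
    proof -
      have "sigma i \<otimes>\<^bsub>BG\<^esub> (tail_braid k \<otimes>\<^bsub>BG\<^esub> inv\<^bsub>BG\<^esub> sigma i) = (sigma i \<otimes>\<^bsub>BG\<^esub> tail_braid k) \<otimes>\<^bsub>BG\<^esub> inv\<^bsub>BG\<^esub> sigma i"
        using c by (simp add: BG.m_assoc)
      also have "\<dots> = tail_braid k" unfolding s using c by (simp add: BG.m_assoc)
      finally show ?thesis using c by (simp add: BG.inv_solve_left')
    qed
    have "transpose i (Suc i) k = k" using 4 by simp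
    then show ?thesis using 4 s s' c
      by (intro bexI[OF _ LF.one_closed]) (cases b; simp add: T F)
  qed
qed

text \<open>
  Every braid is, up to a tail, a product of loops followed by the braid with one strand deleted.  Loops
  produced late can be collected at the front because the smaller braid group normalizes the group they generate.
\<close>

lemma combing:
  "w \<in> braid_words (Suc n) \<Longrightarrow> k \<in> {1..Suc n} \<Longrightarrow>
    \<exists>u\<in>LF. cl w \<otimes>\<^bsub>BG\<^esub> tail_braid k = tail_braid (word_perm w k) \<otimes>\<^bsub>BG\<^esub> (u \<otimes>\<^bsub>BG\<^esub> cl (delete_strand k w))"
proof (induction w)
  case Nil
  then show ?case using tail_carrier[of k] by (intro bexI[OF _ LF.one_closed]) (simp add: braid_class_Nil)
next
  case (Cons l w)
  obtain i b where l: "l = (i, b)" by force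
  have w: "w \<in> braid_words (Suc n)" and i: "i \<in> {1..n}" using Cons.prems by (auto simp: l)
  let ?m = "word_perm w k" and ?v = "delete_strand k w"
  have m: "?m \<in> {1..Suc n}" by (rule word_perm_range[OF w Cons.prems(2)])
  have m': "word_perm (l # w) k \<in> {1..Suc n}" by (rule word_perm_range[OF Cons.prems])
  let ?x = "delete_strand ?m [l]"
  obtain u where u: "u \<in> LF" "cl w \<otimes>\<^bsub>BG\<^esub> tail_braid k = tail_braid ?m \<otimes>\<^bsub>BG\<^esub> (u \<otimes>\<^bsub>BG\<^esub> cl ?v)"
    using Cons.IH[OF w Cons.prems(2)] by blast
  obtain u' where u': "u' \<in> LF" "cl [l] \<otimes>\<^bsub>BG\<^esub> tail_braid ?m = tail_braid (word_perm (l # w) k) \<otimes>\<^bsub>BG\<^esub> (u' \<otimes>\<^bsub>BG\<^esub> cl ?x)"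
    using letter_combing[OF i m, of b] by (auto simp: l)
  have lw: "[l] \<in> braid_words (Suc n)" using i by (simp add: l)
  have xw: "?x \<in> braid_words n" by (rule delete_strand_words[OF lw m])
  have vw: "?v \<in> braid_words n" by (rule delete_strand_words[OF w Cons.prems(2)])
  have c: "cl [l] \<in> carrier BG" "cl w \<in> carrier BG" "tail_braid k \<in> carrier BG" "tail_braid ?m \<in> carrier BG"
    "tail_braid (word_perm (l # w) k) \<in> carrier BG" "u \<in> carrier BG" "u' \<in> carrier BG"
    "cl ?x \<in> carrier BG" "cl ?v \<in> carrier BG"
    using braid_class_carrier[OF lw] braid_class_carrier[OF w] tail_carrier Cons.prems(2) m m'
      LF.mem_carrier[OF u(1)] LF.mem_carrier[OF u'(1)] inner_words_carrier[OF xw] inner_words_carrier[OF vw]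
    by auto
  (* ?x is what remains of the letter l: one letter of the smaller group, or nothing. *)
  have norm: "cl ?x \<otimes>\<^bsub>BG\<^esub> u \<otimes>\<^bsub>BG\<^esub> inv\<^bsub>BG\<^esub> cl ?x \<in> LF"
  proof -
    consider j where "j \<in> {1..<n}" "?x = [(j, b)]" | "?x = []"
      using xw by (auto simp: l split: if_splits)
    then show ?thesis
    proof cases
      case 1
      then show ?thesis using letter_normalizes[OF 1(1) u(1)] by simp
    next
      case 2
      then show ?thesis using u(1) c by (simp add: braid_class_Nil)
    qed
  qed
  have del: "cl (delete_strand k (l # w)) = cl ?x \<otimes>\<^bsub>BG\<^esub> cl ?v"
    using braid_class_append[of ?x "Suc n" ?v] delete_strand_append[of k "[l]" w] xw vw
    by (simp add: braid_words_mono)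
  have "cl (l # w) \<otimes>\<^bsub>BG\<^esub> tail_braid k = cl [l] \<otimes>\<^bsub>BG\<^esub> (cl w \<otimes>\<^bsub>BG\<^esub> tail_braid k)"
    using braid_class_append[OF lw w] c by (simp add: BG.m_assoc)
  also have "\<dots> = (cl [l] \<otimes>\<^bsub>BG\<^esub> tail_braid ?m) \<otimes>\<^bsub>BG\<^esub> (u \<otimes>\<^bsub>BG\<^esub> cl ?v)"
    unfolding u(2) using c by (simp add: BG.m_assoc)
  also have "\<dots> = tail_braid (word_perm (l # w) k) \<otimes>\<^bsub>BG\<^esub>
      ((u' \<otimes>\<^bsub>BG\<^esub> (cl ?x \<otimes>\<^bsub>BG\<^esub> u \<otimes>\<^bsub>BG\<^esub> inv\<^bsub>BG\<^esub> cl ?x)) \<otimes>\<^bsub>BG\<^esub> cl (delete_strand k (l # w)))"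
    unfolding u'(2) del using c by (simp add: BG.group_normalize)
  finally show ?case using LF.m_closed[OF u'(1) norm] by blast
qed

end

section \<open>The loops are a free basis\<close>

definition class_act :: "nat \<Rightarrow> braid_word set \<Rightarrow> hurwitz_state \<Rightarrow> hurwitz_state" where
  "class_act n A = word_act (word_of n A)"

lemma class_act_class:
  assumes "w \<in> braid_words n" "perm_state s"
  shows "class_act n (braid_class n w) s = word_act w s"
  using word_act_cong[OF word_of(2)[OF assms(1)] assms(2)] by (simp add: class_act_def)

lemma class_act_one: "perm_state s \<Longrightarrow> class_act n \<one>\<^bsub>braid_group n\<^esub> s = s"
  using class_act_class[of "[]" n s] by (simp add: braid_class_Nil)

lemma class_act_mult:
  assumes "A \<in> carrier (braid_group n)" "B \<in> carrier (braid_group n)" "perm_state s"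
  shows "class_act n (A \<otimes>\<^bsub>braid_group n\<^esub> B) s = class_act n A (class_act n B s)"
proof -
  obtain v where v: "v \<in> braid_words n" "A = braid_class n v" using assms(1) by (rule braid_carrierE)
  obtain w where w: "w \<in> braid_words n" "B = braid_class n w" using assms(2) by (rule braid_carrierE)
  have "class_act n (A \<otimes>\<^bsub>braid_group n\<^esub> B) s = word_act (v @ w) s"
    using class_act_class[of "v @ w" n s] v w assms(3) by (simp add: braid_class_append)
  also have "\<dots> = class_act n A (class_act n B s)"
    using class_act_class[OF w(1) assms(3)] class_act_class[OF v(1) perm_state_word_act[OF assms(3)]] v(2) w(2)
    by (simp add: word_act_append)
  finally show ?thesis .
qed

lemma class_act_inv:
  assumes "A \<in> carrier (braid_group n)" "perm_state s"
  shows "class_act n (inv\<^bsub>braid_group n\<^esub> A) (class_act n A s) = s"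
proof -
  interpret group "braid_group n" by (rule group_braid_group)
  have "class_act n (inv\<^bsub>braid_group n\<^esub> A \<otimes>\<^bsub>braid_group n\<^esub> A) s = s"
    using assms class_act_one by simp
  then show ?thesis using class_act_mult[OF inv_closed[OF assms(1)] assms] by simp
qed

lemma sigma_act:
  assumes "i \<in> {1..n}" "perm_state s"
  shows "class_act (Suc n) (sigma n i) s = letter_act (i, True) s"
  using class_act_class[of "[(i, True)]" "Suc n" s] assms by (simp add: sigma_def)

lemma perm_state_triple: "perm_state (k, t, a) \<longleftrightarrow> (\<forall>i. bij (t i))"
  by (simp add: perm_state_def)

lemma tail_act:
  assumes t: "\<forall>i. bij (t i)" and k: "1 \<le> k" "k \<le> Suc n"
  shows "class_act (Suc n) (tail_braid n k) (Suc n, t, a) = (k, t, a)"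
  using k(2)
proof (induction rule: inc_induct)
  case base
  then show ?case using t class_act_one[of "(Suc n, t, a)" "Suc n"] by (simp add: tail_last perm_state_triple)
next
  case (step m)
  have m: "m \<in> {1..n}" using step.hyps k by auto
  show ?case
    using class_act_mult[OF sigma_carrier[OF m] tail_carrier[of "Suc m"], of "(Suc n, t, a)"]
      sigma_act[OF m, of "(Suc m, t, a)"] step.IH t
    by (simp add: tail_step[OF m] perm_state_triple)
qed

lemma loop_act:
  assumes t: "\<forall>i. bij (t i)" and i: "i \<in> {1..n}"
  shows "class_act (Suc n) (loop_braid n i) (Suc n, t, a) = (Suc n, t, t i a)"
proof -
  interpret BG: group "braid_group (Suc n)" by (rule group_braid_group)
  have g: "perm_state (k, t, b)" for k b using t by (simp add: perm_state_triple)
  have c: "sigma n i \<in> carrier (braid_group (Suc n))" "tail_braid n i \<in> carrier (braid_group (Suc n))"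
    "tail_braid n (Suc i) \<in> carrier (braid_group (Suc n))"
    using sigma_carrier[OF i] tail_carrier i by auto
  have "class_act (Suc n) (sigma n i \<otimes>\<^bsub>braid_group (Suc n)\<^esub> tail_braid n i) (Suc n, t, a) = (Suc i, t, t i a)"
    using class_act_mult[OF c(1,2) g] tail_act[OF t, of i n a] sigma_act[OF i g] i by simp
  moreover have "class_act (Suc n) (inv\<^bsub>braid_group (Suc n)\<^esub> tail_braid n (Suc i)) (Suc i, t, t i a) = (Suc n, t, t i a)"
    using class_act_inv[OF c(3) g, of "Suc n" "t i a"] tail_act[OF t, of "Suc i" n "t i a"] i by simp
  ultimately show ?thesis
    using class_act_mult[OF BG.inv_closed[OF c(3)] BG.m_closed[OF c(1,2)] g] by (simp add: loop_braid_def)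
qed

text \<open>
  For prescribed images \<open>f\<close> of the loops take the state whose tuple is \<open>t i = f (loop_braid n i)\<close>.  The
  \<open>i\<close>-th loop fixes position and tuple and applies \<open>t i\<close> to the integer.
\<close>

lemma free_basis_loops: "free_basis (braid_group (Suc n)) (loop_braid n ` {Suc 0..n})"
  unfolding free_basis_def
proof (intro allI impI)
  fix f :: "braid_word set \<Rightarrow> int \<Rightarrow> int" assume f: "\<forall>b. bij (f b)"
  let ?B = "loop_braid n ` {Suc 0..n}"
  interpret BG: group "braid_group (Suc n)" by (rule group_braid_group)
  define t where "t i = f (loop_braid n i)" for i
  have t: "\<forall>i. bij (t i)" using f by (simp add: t_def)
  have g: "perm_state (k, t, a)" for k a using t by (simp add: perm_state_triple)
  define \<phi> where "\<phi> u a = snd (snd (class_act (Suc n) u (Suc n, t, a)))" for u a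
  have \<phi>: "class_act (Suc n) u (Suc n, t, a) = (Suc n, t, \<phi> u a)" if "u \<in> generate (braid_group (Suc n)) ?B" for u a
  proof -
    have "\<exists>b. class_act (Suc n) u (Suc n, t, a) = (Suc n, t, b)"
      using that
    proof (induction arbitrary: a rule: generate.induct)
      case one
      then show ?case using class_act_one[OF g] by simp
    next
      case (incl h)
      then show ?case using loop_act[OF t] by auto
    next
      case (inv h)
      then obtain i where i: "i \<in> {1..n}" "h = loop_braid n i" by auto
      have "class_act (Suc n) h (Suc n, t, perm_inv (t i) a) = (Suc n, t, a)"
        using loop_act[OF t i(1), of "perm_inv (t i) a"] t by (simp add: i(2) perm_inv_simps)
      then have "class_act (Suc n) (inv\<^bsub>braid_group (Suc n)\<^esub> h) (Suc n, t, a) = (Suc n, t, perm_inv (t i) a)"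
        using class_act_inv[OF loop_carrier[OF i(1)] g, of "Suc n" "perm_inv (t i) a"] by (simp add: i(2))
      then show ?case by blast
    next
      case (eng h1 h2)
      obtain b where b: "class_act (Suc n) h2 (Suc n, t, a) = (Suc n, t, b)" using eng.IH(2) by blast
      obtain c where c: "class_act (Suc n) h1 (Suc n, t, b) = (Suc n, t, c)" using eng.IH(1) by blast
      have "h1 \<in> carrier (braid_group (Suc n))" "h2 \<in> carrier (braid_group (Suc n))"
        using eng.hyps BG.generate_in_carrier[OF loops_carrier] by auto
      then show ?case using class_act_mult[OF _ _ g] b c by simp
    qed
    then show ?thesis by (auto simp: \<phi>_def)
  qed
  have "\<phi> (u \<otimes>\<^bsub>braid_group (Suc n)\<^esub> v) = \<phi> u \<circ> \<phi> v"
    if uv: "u \<in> generate (braid_group (Suc n)) ?B" "v \<in> generate (braid_group (Suc n)) ?B" for u v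
  proof
    fix a
    have "u \<in> carrier (braid_group (Suc n))" "v \<in> carrier (braid_group (Suc n))"
      using uv BG.generate_in_carrier[OF loops_carrier] by auto
    from class_act_mult[OF this g, of "Suc n" a] show "\<phi> (u \<otimes>\<^bsub>braid_group (Suc n)\<^esub> v) a = (\<phi> u \<circ> \<phi> v) a"
      using \<phi>[OF generate.eng[OF uv]] \<phi>[OF uv(1)] \<phi>[OF uv(2)] by simp
  qed
  moreover have "\<phi> \<one>\<^bsub>braid_group (Suc n)\<^esub> = id"
    using class_act_one[OF g, of "Suc n"] by (auto simp: \<phi>_def)
  moreover have "\<phi> b = f b" if "b \<in> ?B" for b
  proof
    fix a
    obtain i where "i \<in> {1..n}" "b = loop_braid n i" using \<open>b \<in> ?B\<close> by auto
    then show "\<phi> b a = f b a" using loop_act[OF t, of i n a] by (simp add: \<phi>_def) (simp add: t_def)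
  qed
  ultimately show "\<exists>\<phi>. (\<forall>u\<in>generate (braid_group (Suc n)) ?B. \<forall>v\<in>generate (braid_group (Suc n)) ?B.
      \<phi> (u \<otimes>\<^bsub>braid_group (Suc n)\<^esub> v) = \<phi> u \<circ> \<phi> v) \<and> \<phi> \<one>\<^bsub>braid_group (Suc n)\<^esub> = id \<and> (\<forall>b\<in>?B. \<phi> b = f b)"
    by blast
qed

lemma inj_loop: "inj_on (loop_braid n) {1..n}"
proof (rule inj_onI)
  fix i j assume ij: "i \<in> {1..n}" "j \<in> {1..n}" "loop_braid n i = loop_braid n j"
  show "i = j"
  proof (rule ccontr)
    assume "i \<noteq> j"
    define t where "t k = (if k = i then (\<lambda>x. x + 1) else (\<lambda>x. x :: int))" for k
    have "bij (t k)" for k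
      by (rule bij_betw_byWitness[where f' = "if k = i then (\<lambda>x. x - 1) else (\<lambda>x. x)"])
        (auto simp: t_def)
    then have "\<forall>k. bij (t k)" by blast
    from loop_act[OF this ij(1), of 0] loop_act[OF this ij(2), of 0] ij(3) \<open>i \<noteq> j\<close>
    show False by (simp add: t_def)
  qed
qed


section \<open>Pure braid groups\<close>

lemma pure_braids_carrier: "pure_braids n \<subseteq> carrier (braid_group n)"
  by (rule subgroup.subset[OF subgroup_pure_braids])

lemma loop_pure:
  assumes i: "i \<in> {1..n}"
  shows "loop_braid n i \<in> pure_braids (Suc n)"
proof -
  interpret BG: group "braid_group (Suc n)" by (rule group_braid_group)
  interpret P: normal "pure_braids (Suc n)" "braid_group (Suc n)"
    unfolding pure_braids_def by (rule group_hom.normal_kernel[OF braid_perm_group_hom])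
  have c: "sigma n i \<in> carrier (braid_group (Suc n))" "tail_braid n (Suc i) \<in> carrier (braid_group (Suc n))"
    using sigma_carrier[OF i] tail_carrier by auto
  have "sigma n i \<otimes>\<^bsub>braid_group (Suc n)\<^esub> sigma n i = braid_class (Suc n) [(i, True), (i, True)]"
    using braid_class_append[of "[(i, True)]" "Suc n" "[(i, True)]"] i by (simp add: sigma_def)
  also have "\<dots> \<in> pure_braids (Suc n)"
    using i by (subst pure_braids_class) (auto simp: word_perm_def)
  finally have "inv\<^bsub>braid_group (Suc n)\<^esub> tail_braid n (Suc i) \<otimes>\<^bsub>braid_group (Suc n)\<^esub>
      (sigma n i \<otimes>\<^bsub>braid_group (Suc n)\<^esub> sigma n i) \<otimes>\<^bsub>braid_group (Suc n)\<^esub> tail_braid n (Suc i) \<in> pure_braids (Suc n)"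
    by (rule P.inv_op_closed1[OF c(2)])
  then show ?thesis using c by (simp add: loop_braid_def tail_step[OF i] BG.m_assoc)
qed

lemma generate_loops_pure: "generate (braid_group (Suc n)) (loop_braid n ` {Suc 0..n}) \<subseteq> pure_braids (Suc n)"
  using loop_pure by (intro group.generate_subgroup_incl[OF group_braid_group] subgroup_pure_braids) auto

lemma pure_combing:
  assumes w: "w \<in> braid_words (Suc n)" "word_perm w = id"
  obtains u where "u \<in> generate (braid_group (Suc n)) (loop_braid n ` {Suc 0..n})"
    "braid_class (Suc n) w = u \<otimes>\<^bsub>braid_group (Suc n)\<^esub> braid_class (Suc n) (delete_strand (Suc n) w)"
    "word_perm (delete_strand (Suc n) w) = id"
proof -
  interpret BG: group "braid_group (Suc n)" by (rule group_braid_group)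
  let ?d = "delete_strand (Suc n) w"
  have d: "?d \<in> braid_words (Suc n)" using delete_strand_words[OF w(1)] braid_words_mono by simp
  obtain u where u: "u \<in> generate (braid_group (Suc n)) (loop_braid n ` {Suc 0..n})"
    "braid_class (Suc n) w \<otimes>\<^bsub>braid_group (Suc n)\<^esub> tail_braid n (Suc n) =
      tail_braid n (word_perm w (Suc n)) \<otimes>\<^bsub>braid_group (Suc n)\<^esub> (u \<otimes>\<^bsub>braid_group (Suc n)\<^esub> braid_class (Suc n) ?d)"
    using combing[OF w(1), of "Suc n"] by auto
  have c: "u \<in> carrier (braid_group (Suc n))" "braid_class (Suc n) w \<in> carrier (braid_group (Suc n))"
    "braid_class (Suc n) ?d \<in> carrier (braid_group (Suc n))"
    using u(1) BG.generate_in_carrier[OF loops_carrier] braid_class_carrier w(1) d by auto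
  have eq: "braid_class (Suc n) w = u \<otimes>\<^bsub>braid_group (Suc n)\<^esub> braid_class (Suc n) ?d"
    using u(2) w(2) c by (simp add: tail_last)
  have P: "subgroup (pure_braids (Suc n)) (braid_group (Suc n))" by (rule subgroup_pure_braids)
  have "u \<in> pure_braids (Suc n)" using u(1) generate_loops_pure by blast
  moreover have "braid_class (Suc n) w \<in> pure_braids (Suc n)" using pure_braids_class w by simp
  moreover have "braid_class (Suc n) ?d = inv\<^bsub>braid_group (Suc n)\<^esub> u \<otimes>\<^bsub>braid_group (Suc n)\<^esub> braid_class (Suc n) w"
    unfolding eq using c by (simp add: BG.inv_cancel_left)
  ultimately have "braid_class (Suc n) ?d \<in> pure_braids (Suc n)"
    using subgroup.m_closed[OF P subgroup.m_inv_closed[OF P]] by simp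
  then have "word_perm ?d = id" using pure_braids_class[OF d] by simp
  then show thesis using that u(1) eq by blast
qed

definition forget_strand :: "nat \<Rightarrow> braid_word set \<Rightarrow> braid_word set" where
  "forget_strand n A = braid_class n (delete_strand (Suc n) (word_of (Suc n) A))"

lemma forget_strand_class:
  assumes w: "w \<in> braid_words (Suc n)"
  shows "forget_strand n (braid_class (Suc n) w) = braid_class n (delete_strand (Suc n) w)"
proof -
  have "braid_equiv n (delete_strand (Suc n) (word_of (Suc n) (braid_class (Suc n) w))) (delete_strand (Suc n) w)"
    by (rule delete_strand_equiv[OF word_of(2)[OF w]]) simp
  then show ?thesis
    using delete_strand_words[OF w] delete_strand_words[OF word_of(1)[OF w]]
    by (simp add: forget_strand_def braid_class_eq)
qed

lemma forget_strand_pure: "A \<in> pure_braids (Suc n) \<Longrightarrow> forget_strand n A \<in> pure_braids n"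
proof (erule pure_braidsE)
  fix w assume w: "w \<in> braid_words (Suc n)" "A = braid_class (Suc n) w" "word_perm w = id"
  have "word_perm (delete_strand (Suc n) w) = id" by (rule pure_combing[OF w(1,3)])
  then show "forget_strand n A \<in> pure_braids n"
    using delete_strand_words[OF w(1)] by (simp add: w(2) forget_strand_class[OF w(1)] pure_braids_class)
qed

lemma forget_strand_mult:
  assumes "A \<in> pure_braids (Suc n)" "B \<in> pure_braids (Suc n)"
  shows "forget_strand n (A \<otimes>\<^bsub>braid_group (Suc n)\<^esub> B) = forget_strand n A \<otimes>\<^bsub>braid_group n\<^esub> forget_strand n B"
proof -
  obtain v where v: "v \<in> braid_words (Suc n)" "A = braid_class (Suc n) v" "word_perm v = id"
    using assms(1) by (rule pure_braidsE)
  obtain w where w: "w \<in> braid_words (Suc n)" "B = braid_class (Suc n) w" "word_perm w = id"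
    using assms(2) by (rule pure_braidsE)
  have "forget_strand n (A \<otimes>\<^bsub>braid_group (Suc n)\<^esub> B) = braid_class n (delete_strand (Suc n) (v @ w))"
    using forget_strand_class[of "v @ w" n] v(1) w(1) by (simp add: v(2) w(2) braid_class_append)
  also have "\<dots> = forget_strand n A \<otimes>\<^bsub>braid_group n\<^esub> forget_strand n B"
    using v w delete_strand_words[OF v(1)] delete_strand_words[OF w(1)]
    by (simp add: delete_strand_append braid_class_append forget_strand_class)
  finally show ?thesis .
qed

text \<open>
  If the braid obtained by deleting the last strand is trivial on \<open>n\<close> strands, it stays trivial when
  a strand is added, and combing leaves only the product of loops.
\<close>

lemma forget_strand_kernel:
  assumes A: "A \<in> pure_braids (Suc n)" and one: "forget_strand n A = \<one>\<^bsub>braid_group n\<^esub>"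
  shows "A \<in> generate (braid_group (Suc n)) (loop_braid n ` {Suc 0..n})"
proof -
  interpret BG: group "braid_group (Suc n)" by (rule group_braid_group)
  obtain w where w: "w \<in> braid_words (Suc n)" "A = braid_class (Suc n) w" "word_perm w = id"
    using A by (rule pure_braidsE)
  let ?d = "delete_strand (Suc n) w"
  have d: "?d \<in> braid_words n" using delete_strand_words[OF w(1)] by simp
  have "braid_class n ?d = braid_class n []"
    using one by (simp add: w(2) forget_strand_class[OF w(1)] braid_class_Nil)
  then have "braid_equiv n ?d []" using d by (simp add: braid_class_eq)
  then have "braid_equiv (Suc n) ?d []" by (rule braid_equiv_mono)
  then have dd: "braid_class (Suc n) ?d = \<one>\<^bsub>braid_group (Suc n)\<^esub>"
    using d braid_words_mono by (simp add: braid_class_eq braid_class_Nil[symmetric])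
  obtain u where u: "u \<in> generate (braid_group (Suc n)) (loop_braid n ` {Suc 0..n})"
    "braid_class (Suc n) w = u \<otimes>\<^bsub>braid_group (Suc n)\<^esub> braid_class (Suc n) ?d" "word_perm ?d = id"
    by (rule pure_combing[OF w(1,3)])
  have "u \<in> carrier (braid_group (Suc n))" using u(1) BG.generate_in_carrier[OF loops_carrier] by blast
  then show ?thesis using u(1,2) dd w(2) by simp
qed

lemma pure_conj_loop:
  assumes A: "A \<in> pure_braids (Suc n)" and y: "y \<in> loop_braid n ` {Suc 0..n}"
  shows "\<exists>h\<in>generate (braid_group (Suc n)) (loop_braid n ` {Suc 0..n}).
    A \<otimes>\<^bsub>braid_group (Suc n)\<^esub> y \<otimes>\<^bsub>braid_group (Suc n)\<^esub> inv\<^bsub>braid_group (Suc n)\<^esub> A =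
    h \<otimes>\<^bsub>braid_group (Suc n)\<^esub> y \<otimes>\<^bsub>braid_group (Suc n)\<^esub> inv\<^bsub>braid_group (Suc n)\<^esub> h"
proof -
  interpret BG: group "braid_group (Suc n)" by (rule group_braid_group)
  obtain i where i: "i \<in> {1..n}" "y = loop_braid n i" using y by auto
  obtain w where w: "w \<in> braid_words (Suc n)" "A = braid_class (Suc n) w" "word_perm w = id"
    using A by (rule pure_braidsE)
  let ?d = "delete_strand (Suc n) w"
  have d: "?d \<in> braid_words n" using delete_strand_words[OF w(1)] by simp
  obtain u where u: "u \<in> generate (braid_group (Suc n)) (loop_braid n ` {Suc 0..n})"
    "braid_class (Suc n) w = u \<otimes>\<^bsub>braid_group (Suc n)\<^esub> braid_class (Suc n) ?d" "word_perm ?d = id"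
    by (rule pure_combing[OF w(1,3)])
  let ?D = "braid_class (Suc n) ?d"
  obtain h where h: "h \<in> generate (braid_group (Suc n)) (loop_braid n ` {Suc 0..n})"
    "?D \<otimes>\<^bsub>braid_group (Suc n)\<^esub> y \<otimes>\<^bsub>braid_group (Suc n)\<^esub> inv\<^bsub>braid_group (Suc n)\<^esub> ?D =
    h \<otimes>\<^bsub>braid_group (Suc n)\<^esub> y \<otimes>\<^bsub>braid_group (Suc n)\<^esub> inv\<^bsub>braid_group (Suc n)\<^esub> h"
    using inner_conj_loop[OF d i(1)] u(3) i(2) by auto
  have c: "u \<in> carrier (braid_group (Suc n))" "h \<in> carrier (braid_group (Suc n))"
    "?D \<in> carrier (braid_group (Suc n))" "y \<in> carrier (braid_group (Suc n))"
    using u(1) h(1) BG.generate_in_carrier[OF loops_carrier] inner_words_carrier[OF d] loop_carrier[OF i(1)] i(2)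
    by auto
  have "A \<otimes>\<^bsub>braid_group (Suc n)\<^esub> y \<otimes>\<^bsub>braid_group (Suc n)\<^esub> inv\<^bsub>braid_group (Suc n)\<^esub> A =
      u \<otimes>\<^bsub>braid_group (Suc n)\<^esub> (?D \<otimes>\<^bsub>braid_group (Suc n)\<^esub> y \<otimes>\<^bsub>braid_group (Suc n)\<^esub> inv\<^bsub>braid_group (Suc n)\<^esub> ?D)
        \<otimes>\<^bsub>braid_group (Suc n)\<^esub> inv\<^bsub>braid_group (Suc n)\<^esub> u"
    unfolding w(2) u(2) using c by (simp add: BG.group_normalize)
  also have "\<dots> = (u \<otimes>\<^bsub>braid_group (Suc n)\<^esub> h) \<otimes>\<^bsub>braid_group (Suc n)\<^esub> y
      \<otimes>\<^bsub>braid_group (Suc n)\<^esub> inv\<^bsub>braid_group (Suc n)\<^esub> (u \<otimes>\<^bsub>braid_group (Suc n)\<^esub> h)"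
    unfolding h(2) using c by (simp add: BG.group_normalize)
  finally show ?thesis using generate.eng[OF u(1) h(1)] by blast
qed

lemma conjugated_basis_loops:
  assumes "2 \<le> n"
  shows "conjugated_basis (braid_group (Suc n)) (pure_braids (Suc n)) (loop_braid n ` {Suc 0..n})"
  unfolding conjugated_basis_def conjugated_basis_axioms_def
proof (intro conjI allI impI)
  show "group (braid_group (Suc n))" by (rule group_braid_group)
  show "subgroup (pure_braids (Suc n)) (braid_group (Suc n))" by (rule subgroup_pure_braids)
  show "loop_braid n ` {Suc 0..n} \<subseteq> pure_braids (Suc n)" using loop_pure by auto
  show "free_basis (braid_group (Suc n)) (loop_braid n ` {Suc 0..n})" by (rule free_basis_loops)
  show "\<exists>h\<in>generate (braid_group (Suc n)) (loop_braid n ` {Suc 0..n}).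
      g \<otimes>\<^bsub>braid_group (Suc n)\<^esub> y \<otimes>\<^bsub>braid_group (Suc n)\<^esub> inv\<^bsub>braid_group (Suc n)\<^esub> g =
      h \<otimes>\<^bsub>braid_group (Suc n)\<^esub> y \<otimes>\<^bsub>braid_group (Suc n)\<^esub> inv\<^bsub>braid_group (Suc n)\<^esub> h"
    if "g \<in> pure_braids (Suc n)" "y \<in> loop_braid n ` {Suc 0..n}" for g y
    by (rule pure_conj_loop[OF that])
  have "loop_braid n 1 \<noteq> loop_braid n 2" using inj_onD[OF inj_loop, of n 1 2] assms by auto
  moreover have "loop_braid n 1 \<in> loop_braid n ` {Suc 0..n}" "loop_braid n 2 \<in> loop_braid n ` {Suc 0..n}" using assms by auto
  ultimately show "\<exists>y\<in>loop_braid n ` {Suc 0..n}. y \<noteq> x" if "x \<in> loop_braid n ` {Suc 0..n}" for x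
    by metis
qed

definition word_exponent :: "braid_word \<Rightarrow> int" where
  "word_exponent w = (\<Sum>(i, b)\<leftarrow>w. if b then 1 else - 1)"

lemma word_exponent_cong: "braid_equiv n v w \<Longrightarrow> word_exponent v = word_exponent w"
  by (induction rule: braid_equiv.induct) (auto simp: word_exponent_def)

text \<open>
  With two strands there is a single loop, a full twist, and twists between different basis elements
  are not available.  The group is infinite cyclic and the exponent sum detects it.
\<close>

lemma pure_braids_2_residual:
  assumes p: "2 \<le> p" and u: "u \<in> rat_residual p (braid_group 2) (pure_braids 2)"
    and mem: "u \<in> generate (braid_group 2) {loop_braid 1 1}"
  shows "u = \<one>\<^bsub>braid_group 2\<^esub>"
proof -
  interpret group "braid_group 2" by (rule group_braid_group)
  define \<chi> where "\<chi> A = word_exponent (word_of 2 A)" for A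
  have \<chi>: "\<chi> (braid_class 2 w) = word_exponent w" if "w \<in> braid_words 2" for w
    unfolding \<chi>_def by (rule word_exponent_cong[OF word_of(2)[OF that]])
  have mult: "\<chi> (A \<otimes>\<^bsub>braid_group 2\<^esub> B) = \<chi> A + \<chi> B"
    if AB: "A \<in> carrier (braid_group 2)" "B \<in> carrier (braid_group 2)" for A B
  proof -
    obtain v where v: "v \<in> braid_words 2" "A = braid_class 2 v" using AB(1) by (rule braid_carrierE)
    obtain w where w: "w \<in> braid_words 2" "B = braid_class 2 w" using AB(2) by (rule braid_carrierE)
    show ?thesis
      using \<chi>[of "v @ w"] \<chi>[OF v(1)] \<chi>[OF w(1)] v w
      by (simp add: braid_class_append[symmetric] word_exponent_def)
  qed
  have hom: "\<chi> \<in> hom (braid_group 2) integer_group" using mult by (auto simp: hom_def)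
  have "\<chi> \<in> hom (braid_group 2\<lparr>carrier := pure_braids 2\<rparr>) integer_group"
    using mult pure_braids_carrier[of 2] by (auto simp: int_hom_iff)
  from rat_residual_integer[OF p this u] have 0: "\<chi> u = 0" .
  have two: "Suc 1 = 2" by simp
  have c: "sigma 1 1 \<in> carrier (braid_group 2)" "loop_braid 1 1 \<in> carrier (braid_group 2)"
    using sigma_carrier[of 1 1] loop_carrier[of 1 1] by (simp_all add: numeral_2_eq_2)
  have g1: "\<chi> (sigma 1 1) = 1" unfolding sigma_def two by (subst \<chi>) (auto simp: word_exponent_def)
  have t: "tail_braid 1 2 = \<one>\<^bsub>braid_group 2\<^esub>" using tail_last[of 1] by (simp add: numeral_2_eq_2)
  have "tail_braid 1 1 = sigma 1 1 \<otimes>\<^bsub>braid_group 2\<^esub> tail_braid 1 2"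
    using tail_step[of 1 1] unfolding two by simp
  then have t1: "tail_braid 1 1 = sigma 1 1" using c(1) t by simp
  have "loop_braid 1 1 = inv\<^bsub>braid_group 2\<^esub> tail_braid 1 2 \<otimes>\<^bsub>braid_group 2\<^esub> (sigma 1 1 \<otimes>\<^bsub>braid_group 2\<^esub> tail_braid 1 1)"
    unfolding loop_braid_def two ..
  then have "loop_braid 1 1 = sigma 1 1 \<otimes>\<^bsub>braid_group 2\<^esub> sigma 1 1"
    unfolding t t1 using c(1) by simp
  then have l: "\<chi> (loop_braid 1 1) = 2" using mult c g1 by simp
  obtain k :: int where k: "u = loop_braid 1 1 [^]\<^bsub>braid_group 2\<^esub> k"
    using mem generate_pow[OF c(2)] by auto
  have "\<chi> u = k * 2"
  proof -
    interpret h: group_hom "braid_group 2" integer_group \<chi>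
      by (simp add: group_hom_def group_hom_axioms_def hom group_braid_group)
    show ?thesis using h.hom_int_pow[OF c(2), of k] l by (simp add: k)
  qed
  then have "k = 0" using 0 by simp
  then show ?thesis using k by simp
qed

theorem pure_braids_residual:
  assumes p: "2 \<le> p" and n: "1 \<le> n"
  shows "rat_residual p (braid_group n) (pure_braids n) = {\<one>\<^bsub>braid_group n\<^esub>}"
proof -
  have one: "\<one>\<^bsub>braid_group n\<^esub> \<in> rat_residual p (braid_group n) (pure_braids n)" for n
    by (rule subgroup.one_closed[OF group.subgroup_rat_residual[OF group_braid_group subgroup_pure_braids]])
  have "A = \<one>\<^bsub>braid_group n\<^esub>" if "A \<in> rat_residual p (braid_group n) (pure_braids n)" for A
    using n that
  proof (induction n arbitrary: A rule: dec_induct)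
    case base
    then have "A \<in> carrier (braid_group 1)"
      using rat_residual_subset[of p "braid_group 1" "pure_braids 1"] pure_braids_carrier[of 1] by auto
    then obtain w where w: "w \<in> braid_words 1" "A = braid_class 1 w" by (rule braid_carrierE)
    have "w = []" using w(1) by (cases w) auto
    then show ?case using w(2) by (simp add: braid_class_Nil)
  next
    case (step n)
    let ?G = "braid_group (Suc n)" and ?B = "loop_braid n ` {Suc 0..n}"
    interpret group ?G by (rule group_braid_group)
    have "forget_strand n A \<in> rat_residual p (braid_group n) (pure_braids n)"
      by (rule rat_residual_image[of "pure_braids (Suc n)" "forget_strand n" "pure_braids n" ?G "braid_group n" A p])
        (use forget_strand_pure forget_strand_mult step.prems in auto)
    then have one: "forget_strand n A = \<one>\<^bsub>braid_group n\<^esub>" by (rule step.IH)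
    have "A \<in> pure_braids (Suc n)"
      using step.prems rat_residual_subset[of p ?G "pure_braids (Suc n)"] by blast
    from forget_strand_kernel[OF this one] have mem: "A \<in> generate ?G ?B" .
    show ?case
    proof (cases "n = 1")
      case True
      then show ?thesis using pure_braids_2_residual[OF p, of A] step.prems mem by (simp add: numeral_2_eq_2)
    next
      case False
      then have "2 \<le> n" using step.hyps by simp
      from generate_spelled[OF loops_carrier mem] obtain k where "spelled ?G ?B k A" by blast
      then show ?thesis
        by (rule conjugated_basis_residual[OF p conjugated_basis_loops[OF \<open>2 \<le> n\<close>] _ step.prems])
    qed
  qed
  then show ?thesis using one by blast
qed

lemma rat_series_carrier_update:
  "rat_series p (G\<lparr>carrier := K\<rparr>) H i = rat_series p G H i"
  by (induction i) (simp_all add: rat_core_def)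

text \<open>
  It has finite index in the finitely generated braid group, being the kernel of a homomorphism to a
  finite group.
\<close>

lemma finitely_generated_pure_braid_group: "finitely_generated_group (pure_braid_group n)"
proof -
  interpret G: group "braid_group n" by (rule group_braid_group)
  have P: "subgroup (pure_braids n) (braid_group n)" by (rule subgroup_pure_braids)
  define S where "S = (\<lambda>i. braid_class n [(i, True)]) ` {1..<n}"
  have S: "finite S" "S \<subseteq> carrier (braid_group n)"
    unfolding S_def by (auto intro: braid_class_carrier)
  have words: "w \<in> braid_words n \<Longrightarrow> braid_class n w \<in> generate (braid_group n) S" for w
  proof (induction w)
    case Nil
    then show ?case using generate.one[of "braid_group n" S] by (simp add: braid_class_Nil)
  next
    case (Cons l w)
    obtain i b where l: "l = (i, b)" by force
    have i: "i \<in> {1..<n}" and w: "w \<in> braid_words n" using Cons.prems by (auto simp: l)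
    have s: "braid_class n [(i, True)] \<in> S" unfolding S_def using i by blast
    have "braid_class n [l] \<in> generate (braid_group n) S"
      using generate.incl[OF s, of "braid_group n"] generate.inv[OF s, of "braid_group n"] braid_class_letter_inv[OF i]
      by (cases b) (simp_all add: l)
    then have "braid_class n [l] \<otimes>\<^bsub>braid_group n\<^esub> braid_class n w \<in> generate (braid_group n) S"
      using Cons.IH[OF w] by (rule generate.eng)
    then show ?case using braid_class_append[of "[l]" n w] i w by (simp add: l)
  qed
  have full: "generate (braid_group n) S = carrier (braid_group n)"
  proof
    show "generate (braid_group n) S \<subseteq> carrier (braid_group n)" by (rule G.generate_incl[OF S(2)])
    show "carrier (braid_group n) \<subseteq> generate (braid_group n) S"
      using words by (auto elim: braid_carrierE)
  qed
  interpret h: group_hom "braid_group n" "sym_group n" braid_perm by (rule braid_perm_group_hom)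
  have cof: "G.finite_index_in (pure_braids n) (carrier (braid_group n))"
    unfolding G.finite_index_in_def
  proof (intro exI[of _ "inv_into (carrier (braid_group n)) braid_perm ` braid_perm ` carrier (braid_group n)"] conjI ballI)
    have "braid_perm ` carrier (braid_group n) \<subseteq> {\<pi>. \<pi> permutes {1..n}}"
      using h.hom_closed by (auto simp: sym_group_carrier)
    then have "finite (braid_perm ` carrier (braid_group n))"
      by (rule finite_subset) (rule finite_permutations, simp)
    then show "finite (inv_into (carrier (braid_group n)) braid_perm ` braid_perm ` carrier (braid_group n))"
      by (rule finite_imageI)
    show "inv_into (carrier (braid_group n)) braid_perm ` braid_perm ` carrier (braid_group n) \<subseteq> carrier (braid_group n)"
      by (auto intro: inv_into_into)
    fix g assume g: "g \<in> carrier (braid_group n)"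
    let ?t = "inv_into (carrier (braid_group n)) braid_perm (braid_perm g)"
    have t: "?t \<in> carrier (braid_group n)" "braid_perm ?t = braid_perm g"
      by (rule inv_into_into f_inv_into_f, rule imageI, rule g)+
    have "g \<otimes>\<^bsub>braid_group n\<^esub> inv\<^bsub>braid_group n\<^esub> ?t \<in> pure_braids n"
    proof -
      have "braid_perm g \<in> carrier (sym_group n)" using g by (rule h.hom_closed)
      then have "braid_perm g \<otimes>\<^bsub>sym_group n\<^esub> inv\<^bsub>sym_group n\<^esub> braid_perm g = \<one>\<^bsub>sym_group n\<^esub>"
        by (rule h.H.r_inv)
      moreover have "braid_perm (g \<otimes>\<^bsub>braid_group n\<^esub> inv\<^bsub>braid_group n\<^esub> ?t) =
          braid_perm g \<otimes>\<^bsub>sym_group n\<^esub> inv\<^bsub>sym_group n\<^esub> braid_perm g"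
        using h.hom_mult[OF g G.inv_closed[OF t(1)]] h.hom_inv[OF t(1)] t(2) by simp
      ultimately show ?thesis using g t(1) by (simp add: pure_braids_def kernel_def)
    qed
    moreover have "g = (g \<otimes>\<^bsub>braid_group n\<^esub> inv\<^bsub>braid_group n\<^esub> ?t) \<otimes>\<^bsub>braid_group n\<^esub> ?t"
      using g t(1) by (simp add: G.m_assoc)
    ultimately show "\<exists>h\<in>pure_braids n. \<exists>t\<in>inv_into (carrier (braid_group n)) braid_perm ` braid_perm ` carrier (braid_group n).
        g = h \<otimes>\<^bsub>braid_group n\<^esub> t"
      using g by blast
  qed
  obtain Y where Y: "finite Y" "Y \<subseteq> pure_braids n" "generate (braid_group n) Y = pure_braids n"
    using G.finite_index_finitely_generated[OF S P, unfolded full, OF cof pure_braids_carrier] by blast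
  have e: "pure_braid_group n = braid_group n\<lparr>carrier := pure_braids n\<rparr>"
    by (simp add: pure_braid_group_def pure_braids_def)
  have "generate (pure_braid_group n) Y = carrier (pure_braid_group n)"
    unfolding e using G.generate_consistent[OF Y(2) P] Y(3) by simp
  then show ?thesis
    unfolding finitely_generated_group_def
    using group_pure_braid_group[of n] Y(1,2) by (intro conjI exI[of _ Y]) (auto simp: e)
qed

lemma pure_braid_group_RFR:
  assumes "2 \<le> p" "1 \<le> n"
  shows "RFRp p (pure_braid_group n)" "RFRS (pure_braid_group n)"
proof -
  interpret group "pure_braid_group n" by (rule group_pure_braid_group)
  have e: "pure_braid_group n = braid_group n\<lparr>carrier := pure_braids n\<rparr>"
    by (simp add: pure_braid_group_def pure_braids_def)
  have "rat_residual p (pure_braid_group n) (carrier (pure_braid_group n)) = {\<one>\<^bsub>pure_braid_group n\<^esub>}"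
    using pure_braids_residual[OF assms] by (simp add: e rat_residual_def rat_series_carrier_update)
  from rat_residual_trivial_imp_RFR[OF _ finitely_generated_pure_braid_group this] assms(1)
  show "RFRp p (pure_braid_group n)" "RFRS (pure_braid_group n)" by auto
qed

theorem theorem1:
  shows "(\<forall>n\<ge>1. RFRS (pure_braid_group n)) \<and>
    (\<forall>n\<ge>1. \<forall>p. Factorial_Ring.prime p \<longrightarrow> RFRp p (pure_braid_group n))"
  using pure_braid_group_RFR(2)[of 2] pure_braid_group_RFR(1) prime_ge_2_nat by blast

end
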